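(* Fix an integer $p\geq 2$, and let $\{F_n\}_{n\geq 1}$ be a sequence of random variables belonging to the finite sum of Wiener chaoses $\bigoplus_{k=0}^p\mathcal{H}_k$. Assume that $F_n$ converges in distribution, as $n\to\infty$, towards a real random variable $F_\infty$ satisfying $\mathrm{Var}(F_\infty)>0$. Then the following three assertions hold: (1) the sequence $\{F_n\}$ is uniformly bounded in all the $L^r(\Omega)$, that is, $\sup_{n\geq 1}E[|F_n|^r]<\infty$ for all $r\geq 1$; (2) there exists $c>0$ such that, for all $n\geq 1$, $$d_{TV}(F_n,F_\infty)\leq c\, d_{FM}(F_n,F_\infty)^{\frac{1}{2p+1}};$$ in particular, $F_n$ converges in total variation towards $F_\infty$; (3) the law of $F_\infty$ is absolutely continuous with respect to the Lebesgue measure.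
   Context: Let $\mathfrak{H}$ be a real separable Hilbert space and let $X=\{X(h):h\in\mathfrak{H}\}$ be an isonormal Gaussian process over $\mathfrak{H}$: a centered Gaussian family on a probability space $(\Omega,\mathcal{F},P)$ with $E[X(h)X(g)]=\langle h,g\rangle_{\mathfrak{H}}$; assume $\mathcal{F}=\sigma(X)$. For $k\geq 1$, the $k$th Wiener chaos $\mathcal{H}_k$ is the closed linear subspace of $L^2(\Omega)=L^2(\Omega,\mathcal{F},P)$ generated by $\{H_k(X(h)):h\in\mathfrak{H},\|h\|_{\mathfrak{H}}=1\}$, where $H_k(x)=(-1)^k e^{x^2/2}\frac{d^k}{dx^k}\big(e^{-x^2/2}\big)$ is the $k$th Hermite polynomial; $\mathcal{H}_0=\mathbb{R}$ (constants). For real random variables $F,G$, $d_{TV}(F,G)=\sup_{A\in\mathcal{B}(\mathbb{R})}|P(F\in A)-P(G\in A)|$ is the total variation distance between their laws, and $d_{FM}(F,G)=\sup_\phi|E[\phi(F)]-E[\phi(G)]|$ is the Fortet-Mourier distance, the supremum being over all $1$-Lipschitz functions $\phi:\mathbb{R}\to\mathbb{R}$ bounded by $1$ in absolute value. Only the laws of the random variables matter in these distances, so $F_\infty$ may be defined on another probability space. *)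

theory Defs
  imports "HOL-Probability.Probability"
begin

definition hermite :: "nat \<Rightarrow> real \<Rightarrow> real" where
  "hermite k x = (- 1) ^ k * exp (x\<^sup>2 / 2) * (deriv ^^ k) (\<lambda>y. exp (- (y\<^sup>2 / 2))) x"

(* Variance zero is allowed; that law is the point mass at 0 and has no density. *)
definition centered_gaussian :: "'a measure \<Rightarrow> ('a \<Rightarrow> real) \<Rightarrow> bool" where
  "centered_gaussian M Y \<longleftrightarrow> Y \<in> borel_measurable M \<and>
     ((AE \<omega> in M. Y \<omega> = 0) \<or> (\<exists>\<sigma>>0. distributed M lborel Y (normal_density 0 \<sigma>)))"

(* A family is Gaussian when all its finite linear combinations are. *)
locale isonormal_gaussian_process = prob_space M
  for M :: "'a measure" +
  fixes X :: "'h::{real_inner, complete_space} \<Rightarrow> 'a \<Rightarrow> real"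
  assumes separable: "separable_space (euclidean :: 'h topology)"
    and gaussian: "\<And>S c. finite S \<Longrightarrow> centered_gaussian M (\<lambda>\<omega>. \<Sum>h\<in>S. c h * X h \<omega>)"
    and covariance: "\<And>h g. expectation (\<lambda>\<omega>. X h \<omega> * X g \<omega>) = inner h g"

definition generated_sets :: "'a measure \<Rightarrow> ('h \<Rightarrow> 'a \<Rightarrow> real) \<Rightarrow> 'a set set" where
  "generated_sets M X =
     sigma_sets (space M) {X h -` B \<inter> space M | h B. B \<in> sets borel}"

definition hermite_span ::
  "('h::real_normed_vector \<Rightarrow> 'a \<Rightarrow> real) \<Rightarrow> nat \<Rightarrow> ('a \<Rightarrow> real) set" where
  "hermite_span X k =
     {(\<lambda>\<omega>. \<Sum>h\<in>S. c h * hermite k (X h \<omega>)) | S c. finite S \<and> (\<forall>h\<in>S. norm h = 1)}"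

(* Elements of L^2 are represented by functions, so the chaoses below are closed under
   modification on null sets. For k > 0 the chaos is the L^2-closure of hermite_span.
   The case k = 0 is separate because the constants also form the chaos of order 0
   when the Hilbert space is trivial and has no unit vector. *)
definition wiener_chaos ::
  "'a measure \<Rightarrow> ('h::real_normed_vector \<Rightarrow> 'a \<Rightarrow> real) \<Rightarrow> nat \<Rightarrow> ('a \<Rightarrow> real) set" where
  "wiener_chaos M X k =
     (if k = 0 then {F \<in> borel_measurable M. \<exists>c. AE \<omega> in M. F \<omega> = c}
      else {F \<in> borel_measurable M. integrable M (\<lambda>\<omega>. (F \<omega>)\<^sup>2) \<and>
              (\<forall>\<epsilon>>0. \<exists>G\<in>hermite_span X k.
                 (\<integral>\<^sup>+ \<omega>. ennreal ((F \<omega> - G \<omega>)\<^sup>2) \<partial>M) < ennreal \<epsilon>)})"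

definition wiener_chaos_sum ::
  "'a measure \<Rightarrow> ('h::real_normed_vector \<Rightarrow> 'a \<Rightarrow> real) \<Rightarrow> nat \<Rightarrow> ('a \<Rightarrow> real) set" where
  "wiener_chaos_sum M X p =
     {F \<in> borel_measurable M. \<exists>G. (\<forall>k\<le>p. G k \<in> wiener_chaos M X k) \<and>
        (AE \<omega> in M. F \<omega> = (\<Sum>k\<le>p. G k \<omega>))}"

definition d_TV ::
  "'a measure \<Rightarrow> ('a \<Rightarrow> real) \<Rightarrow> 'b measure \<Rightarrow> ('b \<Rightarrow> real) \<Rightarrow> real" where
  "d_TV M F N G =
     (SUP A\<in>sets (borel :: real measure).
        \<bar>measure M {\<omega> \<in> space M. F \<omega> \<in> A} - measure N {\<omega> \<in> space N. G \<omega> \<in> A}\<bar>)"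

definition d_FM ::
  "'a measure \<Rightarrow> ('a \<Rightarrow> real) \<Rightarrow> 'b measure \<Rightarrow> ('b \<Rightarrow> real) \<Rightarrow> real" where
  "d_FM M F N G =
     (SUP \<phi>\<in>{\<phi> :: real \<Rightarrow> real. 1-lipschitz_on UNIV \<phi> \<and> (\<forall>x. \<bar>\<phi> x\<bar> \<le> 1)}.
        \<bar>(\<integral>\<omega>. \<phi> (F \<omega>) \<partial>M) - (\<integral>\<omega>. \<phi> (G \<omega>) \<partial>N)\<bar>)"

end

theory Submission
  imports Defs
begin

text \<open>
  Write a chaos element as an L2-limit of polynomials f(G) of degree at most p in a standard
  Gaussian vector G, and let G' be an independent copy of G. The pair
  (G_\<theta>, G'_\<theta>) = (cos \<theta> G + sin \<theta> G', cos \<theta> G' - sin \<theta> G) has the law of (G, G'), and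
  T(\<theta>) = f(G_\<theta>) is a trigonometric polynomial with T' = \<langle>\<nabla>f(G_\<theta>), G'_\<theta>\<rangle>. Everything is read
  off this curve, with constants that do not depend on the dimension.

  The fundamental theorem of calculus in \<theta> gives the Poincare inequality and Parseval gives its
  converse E|\<nabla>f|^2 \<le> p^2 E f^2. Poincare applied to powers of f, with induction over the degree
  through the partial derivatives, yields hypercontractivity.

  Integrating \<phi>'(T) by parts against w = T'/(T'^2 + \<eta>^2), whose total variation is at most a
  constant over \<eta> because w' has boundedly many zeros, gives
  E \<phi>'(f(G)) \<le> C (\<parallel>\<phi>\<parallel>/\<eta> + \<parallel>\<phi>'\<parallel> E \<eta>/(\<eta>^2 + |\<nabla>f(G)|^2)^{1/2}). By convexity the last expectation
  reduces to scalar polynomials of degree p - 1, so that small ball estimates follow by induction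
  over the degree, and the law of f(G) satisfies
  E \<phi>'(f(G)) \<le> C (\<parallel>\<phi>\<parallel>/\<eta> + \<parallel>\<phi>'\<parallel> \<eta>^{1/(2p-1)}). This passes to the weak limit, gives absolute
  continuity, and, after smoothing a test function at scale \<eta>^{2p/(2p-1)}, the exponent 1/(2p+1).
\<close>

text \<open>No constant may depend on the dimension. Sums over partial derivatives are therefore
  weighted by second moments: a normalised partial derivative is a polynomial of smaller degree and
  unit L2 norm, and the weights add up to E |grad f|^2, which the Poincare inequality and its
  converse tie to f. Hypercontractivity and the convexity argument both run on this.

  The obstacle in the small ball induction is a mismatch of normalisations. The smoothing bound
  scales with the variance, which is what bounds the gradient from below, whereas a normalised
  partial derivative has unit second moment and may be nearly constant. In that case it stays away
  from 0 by Chebyshev's inequality, but the threshold between the two cases costs some of the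
  exponent: in degree d the small ball exponent is 1/(2d + 1/2), and the damped gradient gets 1/(2d
  + 1).

  Weak convergence alone controls neither moments nor variances. Hypercontractivity bounds the
  moments and truncation keeps the variances away from 0 for all large n; the remaining n are
  absorbed in the final constant.\<close>

section \<open>Standard Gaussian vectors and their rotations\<close>

text \<open>Applied below with the weights \<open>1 + cos Z\<close> and \<open>1 + sin Z\<close>, because Levy's theorem needs a positive
  measure and cannot take the complex weight \<open>iexp Z\<close>.\<close>

lemma levy_weighted:
  assumes "prob_space M" and Y[measurable]: "Y \<in> borel_measurable M" and g[measurable]: "g \<in> borel_measurable M"
    and g0: "\<And>\<omega>. 0 \<le> g \<omega>" and gB: "\<And>\<omega>. g \<omega> \<le> (C::real)" and K: "K > 0" and N: "real_distribution N"
    and ch: "\<And>s. (CLINT \<omega>|M. of_real (g \<omega>) * iexp (s * Y \<omega>)) = of_real K * char N s"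
    and B[measurable]: "B \<in> sets borel"
  shows "(LINT \<omega>|M. g \<omega> * indicator B (Y \<omega>)) = K * measure N B"
proof -
  interpret prob_space M by fact
  interpret N: real_distribution N by fact
  have ig: "integrable M g"
    by (rule integrable_const_bound[where B=C]) (use g0 gB in auto)
  \<comment> \<open>At s = 0 the hypothesis says that K is the total mass of the weight.\<close>
  have "(CLINT \<omega>|M. of_real (g \<omega>)) = of_real K"
    using ch[of 0] by (simp add: N.char_zero)
  hence gK: "(LINT \<omega>|M. g \<omega>) = K" by (metis integral_complex_of_real of_real_eq_iff)
  let ?D = "density M (\<lambda>\<omega>. ennreal (g \<omega> / K))"
  have "prob_space ?D"
  proof
    have "emeasure ?D (space ?D) = (\<integral>\<^sup>+ \<omega>. ennreal (g \<omega> / K) \<partial>M)"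
      by (subst emeasure_density) (auto intro!: nn_integral_cong)
    also have "\<dots> = ennreal (LINT \<omega>|M. g \<omega> / K)"
      by (rule nn_integral_eq_integral) (use ig K g0 in auto)
    finally show "emeasure ?D (space ?D) = 1" using gK K by simp
  qed
  then interpret D: prob_space ?D .
  have rd: "real_distribution (distr ?D borel Y)"
    by (rule D.real_distribution_distr) simp
  have "char (distr ?D borel Y) s = char N s" for s
  proof -
    have "char (distr ?D borel Y) s = (CLINT \<omega>|?D. iexp (s * Y \<omega>))"
      unfolding char_def by (subst integral_distr) simp_all
    also have "\<dots> = (CLINT \<omega>|M. (g \<omega> / K) *\<^sub>R iexp (s * Y \<omega>))"
      by (rule integral_density) (use K g0 in auto)
    also have "\<dots> = (CLINT \<omega>|M. of_real (g \<omega>) * iexp (s * Y \<omega>) / of_real K)"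
      by (rule Bochner_Integration.integral_cong) (auto simp: scaleR_conv_of_real)
    also have "\<dots> = (CLINT \<omega>|M. of_real (g \<omega>) * iexp (s * Y \<omega>)) / of_real K"
      by simp
    finally show ?thesis unfolding ch using K by simp
  qed
  then have eq: "distr ?D borel Y = N"
    by (intro Levy_uniqueness rd N) auto
  have "measure N B = measure ?D (Y -` B \<inter> space M)"
    unfolding eq[symmetric] by (subst measure_distr) auto
  also have "\<dots> = (LINT \<omega>|?D. indicator (Y -` B \<inter> space M) \<omega>)"
    by simp
  also have "\<dots> = (LINT \<omega>|M. (g \<omega> / K) *\<^sub>R indicator (Y -` B \<inter> space M) \<omega>)"
    by (rule integral_density) (use K g0 in auto)
  also have "\<dots> = (LINT \<omega>|M. g \<omega> * indicator B (Y \<omega>) / K)"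
    by (rule Bochner_Integration.integral_cong) (auto simp: indicator_def)
  finally show ?thesis using K by simp
qed

lemma iexp_integrable:
  assumes "prob_space M" "Y \<in> borel_measurable M"
  shows "integrable M (\<lambda>\<omega>. iexp (Y \<omega>))"
proof -
  interpret prob_space M by fact
  note [measurable] = assms(2)
  show ?thesis by (rule integrable_const_bound[where B=1]) auto
qed

text \<open>At s = 0 the hypotheses make c the expectation of \<open>iexp Z\<close>, and for other s
  they say that \<open>iexp Z\<close> is uncorrelated with \<open>iexp (s * Y)\<close>. The weights
  1, \<open>1 + cos Z\<close> and \<open>1 + sin Z\<close>, of masses 1, \<open>1 + c\<close> and 1,
  extend this by \<open>levy_weighted\<close> from exponentials to indicator functions of Y.\<close>

lemma char_factor_indicator:
  assumes "prob_space M" and Y[measurable]: "Y \<in> borel_measurable M" and Z[measurable]: "Z \<in> borel_measurable M"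
    and c: "0 \<le> (c::real)" and N: "real_distribution N"
    and ch0: "\<And>s. (CLINT \<omega>|M. iexp (s * Y \<omega>)) = char N s"
    and ch1: "\<And>s. (CLINT \<omega>|M. iexp (s * Y \<omega> + Z \<omega>)) = of_real c * char N s"
    and ch2: "\<And>s. (CLINT \<omega>|M. iexp (s * Y \<omega> - Z \<omega>)) = of_real c * char N s"
    and B[measurable]: "B \<in> sets borel"
  shows "(CLINT \<omega>|M. indicator B (Y \<omega>) * iexp (Z \<omega>)) = of_real (c * measure N B)"
    and "measure M {\<omega>\<in>space M. Y \<omega> \<in> B} = measure N B"
proof -
  interpret prob_space M by fact
  note ii = iexp_integrable[OF \<open>prob_space M\<close>]
  have ip: "iexp (s * Y \<omega> + Z \<omega>) = iexp (s * Y \<omega>) * iexp (Z \<omega>)" 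
       and im: "iexp (s * Y \<omega> - Z \<omega>) = iexp (s * Y \<omega>) * iexp (- Z \<omega>)" for s \<omega>
    unfolding exp_add[symmetric] by (rule arg_cong[where f=exp], simp add: algebra_simps)+
  have cosZ: "complex_of_real (cos x) = (iexp x + iexp (- x)) / 2" for x
    by (simp add: cos_exp_eq flip: cos_of_real)
  have sinZ: "complex_of_real (sin x) = (iexp x - iexp (- x)) / (2 * \<i>)" for x
    by (simp add: sin_exp_eq field_simps flip: sin_of_real)
  have 1: "(LINT \<omega>|M. (1::real) * indicator B (Y \<omega>)) = 1 * measure N B"
    by (rule levy_weighted[OF assms(1) Y, where C=1]) (use N ch0 in auto)
  have "(LINT \<omega>|M. indicator B (Y \<omega>)) = (LINT \<omega>|M. (indicator {\<omega>\<in>space M. Y \<omega> \<in> B} \<omega> :: real))"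
    by (rule Bochner_Integration.integral_cong) (auto simp: indicator_def)
  with 1 show m: "measure M {\<omega>\<in>space M. Y \<omega> \<in> B} = measure N B"
    by simp
  have 2: "(LINT \<omega>|M. (1 + cos (Z \<omega>)) * indicator B (Y \<omega>)) = (1 + c) * measure N B"
  proof (rule levy_weighted[OF assms(1) Y, where C=2])
    fix s
    have e: "complex_of_real (1 + cos (Z \<omega>)) * iexp (s * Y \<omega>) =
      iexp (s * Y \<omega>) + (iexp (s * Y \<omega> + Z \<omega>) + iexp (s * Y \<omega> - Z \<omega>)) / 2" for \<omega>
      unfolding ip im of_real_add[of 1 "cos _"] cosZ by (simp add: algebra_simps)
    show "(CLINT \<omega>|M. complex_of_real (1 + cos (Z \<omega>)) * iexp (s * Y \<omega>)) = of_real (1 + c) * char N s"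
      unfolding e
      by (subst Bochner_Integration.integral_add, (intro ii integrable_divide_zero Bochner_Integration.integrable_add Bochner_Integration.integrable_diff; simp)+,
          subst integral_divide_zero, subst Bochner_Integration.integral_add, (intro ii; simp)+)
        (simp only: ch0 ch1 ch2, simp add: algebra_simps)
  next
    fix \<omega> show "0 \<le> 1 + cos (Z \<omega>)" using cos_ge_minus_one[of "Z \<omega>"] by linarith
    show "1 + cos (Z \<omega>) \<le> 2" using cos_le_one[of "Z \<omega>"] by linarith
  qed (use N c in auto)
  have 3: "(LINT \<omega>|M. (1 + sin (Z \<omega>)) * indicator B (Y \<omega>)) = 1 * measure N B"
  proof (rule levy_weighted[OF assms(1) Y, where C=2])
    fix s
    have e: "complex_of_real (1 + sin (Z \<omega>)) * iexp (s * Y \<omega>) =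
      iexp (s * Y \<omega>) + (iexp (s * Y \<omega> + Z \<omega>) - iexp (s * Y \<omega> - Z \<omega>)) / (2 * \<i>)" for \<omega>
      unfolding ip im of_real_add[of 1 "sin _"] sinZ by (simp add: algebra_simps diff_divide_distrib)
    show "(CLINT \<omega>|M. complex_of_real (1 + sin (Z \<omega>)) * iexp (s * Y \<omega>)) = of_real 1 * char N s"
      unfolding e
      by (subst Bochner_Integration.integral_add, (intro ii integrable_divide_zero Bochner_Integration.integrable_add Bochner_Integration.integrable_diff; simp)+,
          subst integral_divide_zero, subst Bochner_Integration.integral_diff, (intro ii; simp)+)
        (simp only: ch0 ch1 ch2, simp add: algebra_simps)
  next
    fix \<omega> show "0 \<le> 1 + sin (Z \<omega>)" using sin_ge_minus_one[of "Z \<omega>"] by linarith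
    show "1 + sin (Z \<omega>) \<le> 2" using sin_le_one[of "Z \<omega>"] by linarith
  qed (use N c in auto)
  have i: "integrable M (\<lambda>\<omega>. indicator B (Y \<omega>) :: real)"
    "integrable M (\<lambda>\<omega>. cos (Z \<omega>) * indicator B (Y \<omega>))"
    "integrable M (\<lambda>\<omega>. sin (Z \<omega>) * indicator B (Y \<omega>))"
    by (rule integrable_const_bound[where B=1]; auto simp: indicator_def)+
  have c': "(LINT \<omega>|M. cos (Z \<omega>) * indicator B (Y \<omega>)) = c * measure N B"
    using 1 2 i by (simp add: algebra_simps)
  have s': "(LINT \<omega>|M. sin (Z \<omega>) * indicator B (Y \<omega>)) = 0"
    using 1 3 i by (simp add: algebra_simps)
  have e: "indicator B (Y \<omega>) * iexp (Z \<omega>) = complex_of_real (cos (Z \<omega>) * indicator B (Y \<omega>)) + 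
      \<i> * complex_of_real (sin (Z \<omega>) * indicator B (Y \<omega>))" for \<omega>
    by (simp add: exp_Euler cos_of_real sin_of_real algebra_simps indicator_def)
  show "(CLINT \<omega>|M. indicator B (Y \<omega>) * iexp (Z \<omega>)) = of_real (c * measure N B)"
    unfolding e Bochner_Integration.integral_add[OF integrable_of_real[OF i(2)] integrable_mult_right[OF integrable_of_real[OF i(3)]]]
      integral_mult_right_zero integral_complex_of_real c' s' by simp
qed

text \<open>Induction over \<open>J\<close>: conditionally on one coordinate lying in a set, the remaining ones still have
  the same characteristic function, so the induction hypothesis applies to the conditioned measure.\<close>

lemma gaussian_family_rectangle:
  assumes "finite J" "prob_space M" "\<And>j. j \<in> J \<Longrightarrow> Y j \<in> borel_measurable M"
    and "\<And>t. (CLINT \<omega>|M. iexp (\<Sum>j\<in>J. t j * Y j \<omega>)) = of_real (exp (- (\<Sum>j\<in>J. (t j)\<^sup>2) / 2))"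
    and "\<And>j. j \<in> J \<Longrightarrow> A j \<in> sets borel"
  shows "measure M {\<omega>\<in>space M. \<forall>j\<in>J. Y j \<omega> \<in> A j} = (\<Prod>j\<in>J. measure std_normal_distribution (A j))"
  using assms
proof (induction J arbitrary: M rule: finite_induct)
  case empty
  then show ?case by (simp add: prob_space.prob_space)
next
  case (insert k J M)
  interpret prob_space M by fact
  have Yk[measurable]: "Y k \<in> borel_measurable M" and YJ[measurable]: "\<And>j. j\<in>J \<Longrightarrow> Y j \<in> borel_measurable M" using insert by auto
  note ch = insert.prems(3)
  \<comment> \<open>The values u = 0, 1 and -1 give the three hypotheses of
    \<open>char_factor_indicator\<close>.\<close>
  have chs: "(CLINT \<omega>|M. iexp (s * Y k \<omega> + u * (\<Sum>j\<in>J. t j * Y j \<omega>)))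
      = of_real (exp (- (u\<^sup>2 * (\<Sum>j\<in>J. (t j)\<^sup>2)) / 2)) * char std_normal_distribution s" for s u t
  proof -
    let ?t = "\<lambda>j. if j = k then s else u * t j"
    have "(\<Sum>j\<in>insert k J. ?t j * Y j \<omega>) = s * Y k \<omega> + u * (\<Sum>j\<in>J. t j * Y j \<omega>)" for \<omega>
    proof -
      have "(\<Sum>j\<in>J. ?t j * Y j \<omega>) = (\<Sum>j\<in>J. u * (t j * Y j \<omega>))" using insert.hyps by (intro sum.cong) auto
      thus ?thesis using insert.hyps by (simp add: sum_distrib_left)
    qed
    moreover have "(\<Sum>j\<in>insert k J. (?t j)\<^sup>2) = s\<^sup>2 + u\<^sup>2 * (\<Sum>j\<in>J. (t j)\<^sup>2)"
    proof -
      have "(\<Sum>j\<in>J. (?t j)\<^sup>2) = (\<Sum>j\<in>J. u\<^sup>2 * (t j)\<^sup>2)" using insert.hyps by (intro sum.cong) (auto simp: power_mult_distrib)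
      thus ?thesis using insert.hyps by (simp add: sum_distrib_left)
    qed
    ultimately show ?thesis using ch[of ?t]
      by (simp add: char_std_normal_distribution add_divide_distrib diff_divide_distrib flip: of_real_mult exp_add)
  qed
  have rdN: "real_distribution std_normal_distribution" by (rule real_dist_normal_dist)
  let ?N = "std_normal_distribution"
  have Am: "A k \<in> sets borel" "\<And>j. j\<in>J \<Longrightarrow> A j \<in> sets borel" using insert by auto
  have fac: "(CLINT \<omega>|M. indicator (A k) (Y k \<omega>) * iexp (\<Sum>j\<in>J. t j * Y j \<omega>))
      = of_real (exp (- (\<Sum>j\<in>J. (t j)\<^sup>2) / 2) * measure ?N (A k))"
    and mk: "measure M {\<omega>\<in>space M. Y k \<omega> \<in> A k} = measure ?N (A k)" for t
  proof -
    have a0: "(CLINT \<omega>|M. iexp (s * Y k \<omega>)) = char ?N s" for s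
      using chs[of s 0 t] by simp
    have a1: "(CLINT \<omega>|M. iexp (s * Y k \<omega> + (\<Sum>j\<in>J. t j * Y j \<omega>))) = of_real (exp (- (\<Sum>j\<in>J. (t j)\<^sup>2) / 2)) * char ?N s" for s
      using chs[of s 1 t] by (simp only: mult_1 power_one)
    have a2: "(CLINT \<omega>|M. iexp (s * Y k \<omega> - (\<Sum>j\<in>J. t j * Y j \<omega>))) = of_real (exp (- (\<Sum>j\<in>J. (t j)\<^sup>2) / 2)) * char ?N s" for s
      using chs[of s "-1" t] by (simp only: mult_minus1 power2_minus power_one mult_1 diff_conv_add_uminus)
    note * = char_factor_indicator[OF \<open>prob_space M\<close> Yk _ _ rdN a0 a1 a2 Am(1)]
    show "(CLINT \<omega>|M. indicator (A k) (Y k \<omega>) * iexp (\<Sum>j\<in>J. t j * Y j \<omega>))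
      = of_real (exp (- (\<Sum>j\<in>J. (t j)\<^sup>2) / 2) * measure ?N (A k))"
      by (rule *(1)) auto
    show "measure M {\<omega>\<in>space M. Y k \<omega> \<in> A k} = measure ?N (A k)"
      by (rule *(2)) auto
  qed
  let ?E = "{\<omega>\<in>space M. Y k \<omega> \<in> A k}"
  have Em[measurable]: "?E \<in> sets M" using Am by measurable
  show ?case
  proof (cases "measure ?N (A k) = 0")
    case True
    have "measure M {\<omega> \<in> space M. \<forall>j\<in>insert k J. Y j \<omega> \<in> A j} \<le> measure M ?E"
      by (rule finite_measure_mono) auto
    hence "measure M {\<omega> \<in> space M. \<forall>j\<in>insert k J. Y j \<omega> \<in> A j} = 0"
      using mk True measure_nonneg[of M "{\<omega> \<in> space M. \<forall>j\<in>insert k J. Y j \<omega> \<in> A j}"] by linarith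
    thus ?thesis using True insert.hyps by simp
  next
    case False
    hence pos: "measure M ?E > 0" using mk by (simp add: zero_less_measure_iff)
    let ?U = "uniform_measure M ?E"
    have pU: "prob_space ?U" by (rule prob_space_uniform_measure) (use pos in \<open>auto simp: emeasure_eq_measure\<close>)
    have chU: "(CLINT \<omega>|?U. iexp (\<Sum>j\<in>J. t j * Y j \<omega>)) = of_real (exp (- (\<Sum>j\<in>J. (t j)\<^sup>2) / 2))" for t
    proof -
      have "?U = density M (\<lambda>\<omega>. ennreal (indicator ?E \<omega> / measure M ?E))"
        unfolding uniform_measure_def emeasure_eq_measure
        by (rule density_cong) (use pos in \<open>auto simp: indicator_def divide_ennreal simp flip: ennreal_1\<close>)
      hence "(CLINT \<omega>|?U. iexp (\<Sum>j\<in>J. t j * Y j \<omega>)) = (CLINT \<omega>|M. (indicator ?E \<omega> / measure M ?E) *\<^sub>R iexp (\<Sum>j\<in>J. t j * Y j \<omega>))"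
        by (simp only:) (rule integral_density; use pos in \<open>auto simp: AE_iff_null\<close>)
      also have "\<dots> = (CLINT \<omega>|M. indicator (A k) (Y k \<omega>) * iexp (\<Sum>j\<in>J. t j * Y j \<omega>) / of_real (measure M ?E))"
        by (rule Bochner_Integration.integral_cong) (auto simp: indicator_def scaleR_conv_of_real)
      also have "\<dots> = of_real (exp (- (\<Sum>j\<in>J. (t j)\<^sup>2) / 2))"
        using fac[of t] False by (simp add: mk)
      finally show ?thesis .
    qed
    have "measure ?U {\<omega>\<in>space ?U. \<forall>j\<in>J. Y j \<omega> \<in> A j} = (\<Prod>j\<in>J. measure ?N (A j))"
      by (rule insert.IH[OF pU _ chU Am(2)]) auto
    moreover have S: "{\<omega>\<in>space M. \<forall>j\<in>J. Y j \<omega> \<in> A j} \<in> sets M"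
      using insert.hyps Am by measurable
    moreover have "measure ?U {\<omega>\<in>space M. \<forall>j\<in>J. Y j \<omega> \<in> A j} = measure M (?E \<inter> {\<omega>\<in>space M. \<forall>j\<in>J. Y j \<omega> \<in> A j}) / measure M ?E"
      by (rule measure_uniform_measure) (use pos S in \<open>auto simp: emeasure_eq_measure\<close>)
    moreover have "?E \<inter> {\<omega>\<in>space M. \<forall>j\<in>J. Y j \<omega> \<in> A j} = {\<omega> \<in> space M. \<forall>j\<in>insert k J. Y j \<omega> \<in> A j}"
      by auto
    ultimately show ?thesis using False insert.hyps by (simp add: mk field_simps)
  qed
qed

text \<open>The index set is arbitrary because the coordinates will be orthonormal families in the
  Hilbert space, of varying size.\<close>

definition gauss :: "'i set \<Rightarrow> ('i \<Rightarrow> real) measure" where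
  "gauss I = PiM I (\<lambda>_. std_normal_distribution)"

lemma prob_space_std_normal: "prob_space std_normal_distribution"
  using real_dist_normal_dist by (rule real_distribution.axioms(1))

lemma prob_space_gauss: "prob_space (gauss I)"
  unfolding gauss_def by (rule prob_space_PiM) (rule prob_space_std_normal)

lemma sets_gauss[measurable_cong, simp]: "sets (gauss I) = sets (PiM I (\<lambda>_. borel))"
  unfolding gauss_def by (rule sets_PiM_cong) auto

lemma space_gauss: "space (gauss I) = PiE I (\<lambda>_. UNIV)"
  unfolding gauss_def by (simp add: space_PiM)

lemma measurable_gauss1[simp]: "measurable (gauss I) N = measurable (PiM I (\<lambda>_. borel)) N"
  by (rule measurable_cong_sets) auto

lemma measurable_gauss2[simp]: "measurable N (gauss I) = measurable N (PiM I (\<lambda>_. borel))"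
  by (rule measurable_cong_sets) auto

text \<open>Levy's theorem concerns laws on the line; the rectangle formula carries it over to
  vectors, since rectangles determine a product measure.\<close>

lemma distr_gaussian_family:
  assumes "finite J" "prob_space M" "\<And>j. j \<in> J \<Longrightarrow> Y j \<in> borel_measurable M"
    and "\<And>t. (CLINT \<omega>|M. iexp (\<Sum>j\<in>J. t j * Y j \<omega>)) = of_real (exp (- (\<Sum>j\<in>J. (t j)\<^sup>2) / 2))"
  shows "distr M (gauss J) (\<lambda>\<omega>. \<lambda>j\<in>J. Y j \<omega>) = gauss J"
proof -
  interpret prob_space M by fact
  have [measurable]: "\<And>j. j \<in> J \<Longrightarrow> Y j \<in> borel_measurable M" by fact
  interpret N: prob_space std_normal_distribution by (rule prob_space_std_normal)
  interpret P: product_sigma_finite "\<lambda>_. std_normal_distribution" ..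
  show ?thesis unfolding gauss_def
  proof (rule P.PiM_eqI[OF assms(1)])
    show "sets (distr M (Pi\<^sub>M J (\<lambda>_. std_normal_distribution)) (\<lambda>\<omega>. \<lambda>j\<in>J. Y j \<omega>)) = sets (Pi\<^sub>M J (\<lambda>_. std_normal_distribution))" by simp
    fix A assume A: "\<And>i. i \<in> J \<Longrightarrow> A i \<in> sets std_normal_distribution"
    have "emeasure (distr M (Pi\<^sub>M J (\<lambda>_. std_normal_distribution)) (\<lambda>\<omega>. \<lambda>j\<in>J. Y j \<omega>)) (Pi\<^sub>E J A)
       = emeasure M ((\<lambda>\<omega>. \<lambda>j\<in>J. Y j \<omega>) -` (Pi\<^sub>E J A) \<inter> space M)"
    proof (rule emeasure_distr)
      show "(\<lambda>\<omega>. \<lambda>j\<in>J. Y j \<omega>) \<in> M \<rightarrow>\<^sub>M Pi\<^sub>M J (\<lambda>_. std_normal_distribution)"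
        by (rule measurable_restrict) simp
      show "Pi\<^sub>E J A \<in> sets (Pi\<^sub>M J (\<lambda>_. std_normal_distribution))"
        by (rule sets_PiM_I_finite[OF assms(1)]) (use A in auto)
    qed
    also have "(\<lambda>\<omega>. \<lambda>j\<in>J. Y j \<omega>) -` (Pi\<^sub>E J A) \<inter> space M = {\<omega>\<in>space M. \<forall>j\<in>J. Y j \<omega> \<in> A j}"
      by (auto simp: PiE_def Pi_def)
    also have "emeasure M \<dots> = ennreal (\<Prod>j\<in>J. measure std_normal_distribution (A j))"
      unfolding emeasure_eq_measure
      by (subst gaussian_family_rectangle[OF assms]) (use A in auto)
    also have "\<dots> = (\<Prod>j\<in>J. emeasure std_normal_distribution (A j))"
      by (simp add: N.emeasure_eq_measure prod_ennreal)
    finally show "emeasure (distr M (Pi\<^sub>M J (\<lambda>_. std_normal_distribution)) (\<lambda>\<omega>. \<lambda>j\<in>J. Y j \<omega>)) (Pi\<^sub>E J A) = (\<Prod>j\<in>J. emeasure std_normal_distribution (A j))" .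
  qed
qed

lemma gauss_char:
  assumes "finite I"
  shows "(CLINT x|gauss I. iexp (\<Sum>i\<in>I. t i * x i)) = of_real (exp (- (\<Sum>i\<in>I. (t i)\<^sup>2) / 2))"
proof -
  interpret N: prob_space std_normal_distribution by (rule prob_space_std_normal)
  interpret P: product_sigma_finite "\<lambda>_. std_normal_distribution" ..
  have "(CLINT x|gauss I. iexp (\<Sum>i\<in>I. t i * x i)) = (CLINT x|gauss I. (\<Prod>i\<in>I. iexp (t i * x i)))"
    by (rule Bochner_Integration.integral_cong) (use assms in \<open>simp_all add: exp_sum sum_distrib_left\<close>)
  also have "\<dots> = (\<Prod>i\<in>I. char std_normal_distribution (t i))"
    unfolding gauss_def char_def
    by (rule P.product_integral_prod[OF assms]) (rule iexp_integrable[OF N.prob_space_axioms]; simp)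
  also have "\<dots> = of_real (\<Prod>i\<in>I. exp (- (t i)\<^sup>2 / 2))"
    by (simp add: char_std_normal_distribution)
  also have "(\<Prod>i\<in>I. exp (- (t i)\<^sup>2 / 2)) = exp (\<Sum>i\<in>I. - (t i)\<^sup>2 / 2)"
    using assms by (simp add: exp_sum)
  finally show ?thesis by (simp add: sum_negf sum_divide_distrib)
qed

section \<open>Independent pairs of Gaussian vectors and rotation invariance\<close>

definition gauss2 :: "'i set \<Rightarrow> (('i \<Rightarrow> real) \<times> ('i \<Rightarrow> real)) measure" where
  "gauss2 I = gauss I \<Otimes>\<^sub>M gauss I"

lemma prob_space_gauss2: "prob_space (gauss2 I)"
proof -
  interpret prob_space "gauss I" by (rule prob_space_gauss)
  interpret pair_prob_space "gauss I" "gauss I" ..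
  show ?thesis unfolding gauss2_def by (rule P.prob_space_axioms)
qed

lemma sets_gauss2[measurable_cong, simp]: "sets (gauss2 I) = sets (PiM I (\<lambda>_. borel) \<Otimes>\<^sub>M PiM I (\<lambda>_. borel))"
  unfolding gauss2_def by (rule sets_pair_measure_cong) auto

lemma space_gauss2: "space (gauss2 I) = PiE I (\<lambda>_. UNIV) \<times> PiE I (\<lambda>_. UNIV)"
  unfolding gauss2_def by (simp add: space_pair_measure space_gauss)

lemma measurable_gauss2_1[simp]: "measurable (gauss2 I) N = measurable (PiM I (\<lambda>_. borel) \<Otimes>\<^sub>M PiM I (\<lambda>_. borel)) N"
  by (rule measurable_cong_sets) auto

lemma measurable_gauss2_2[simp]: "measurable N (gauss2 I) = measurable N (PiM I (\<lambda>_. borel) \<Otimes>\<^sub>M PiM I (\<lambda>_. borel))"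
  by (rule measurable_cong_sets) auto

lemma gauss2_char:
  assumes "finite I"
  shows "(CLINT z|gauss2 I. iexp (\<Sum>i\<in>I. s i * fst z i + t i * snd z i)) = of_real (exp (- (\<Sum>i\<in>I. (s i)\<^sup>2 + (t i)\<^sup>2) / 2))"
proof -
  interpret G: prob_space "gauss I" by (rule prob_space_gauss)
  interpret pair_prob_space "gauss I" "gauss I" ..
  have [measurable]: "(\<lambda>x. \<Sum>i\<in>I. s i * x i) \<in> borel_measurable (gauss I)" for s
    by simp measurable
  have int: "integrable (gauss I \<Otimes>\<^sub>M gauss I) (\<lambda>z. iexp (\<Sum>i\<in>I. s i * fst z i + t i * snd z i))"
    by (rule iexp_integrable[OF P.prob_space_axioms]) (simp flip: gauss2_def)
  have "(CLINT z|gauss2 I. iexp (\<Sum>i\<in>I. s i * fst z i + t i * snd z i)) = 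
    (CLINT x|gauss I. CLINT y|gauss I. iexp (\<Sum>i\<in>I. s i * x i + t i * y i))"
    unfolding gauss2_def by (subst integral_fst'[symmetric, OF int]) simp
  also have "\<dots> = (CLINT x|gauss I. CLINT y|gauss I. iexp (\<Sum>i\<in>I. s i * x i) * iexp (\<Sum>i\<in>I. t i * y i))"
    by (intro Bochner_Integration.integral_cong refl) (simp add: sum.distrib flip: exp_add ring_distribs)
  also have "\<dots> = (CLINT x|gauss I. iexp (\<Sum>i\<in>I. s i * x i)) * (CLINT y|gauss I. iexp (\<Sum>i\<in>I. t i * y i))"
    by simp
  also have "\<dots> = of_real (exp (- (\<Sum>i\<in>I. (s i)\<^sup>2) / 2)) * of_real (exp (- (\<Sum>i\<in>I. (t i)\<^sup>2) / 2))"
    by (simp only: gauss_char[OF assms])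
  finally show ?thesis by (simp add: sum.distrib add_divide_distrib flip: of_real_mult exp_add)
qed

text \<open>The pair is read as a single Gaussian family with a Boolean as second index. Its law is
  thereby the image of a measure that does not depend on M, so any two pairs with this
  characteristic function have the same law; the two components of \<open>gauss2 I\<close> itself
  form such a pair.\<close>

lemma distr_gaussian_pair_aux:
  assumes "finite I" "prob_space M" "\<And>i. i \<in> I \<Longrightarrow> Y i \<in> borel_measurable M" "\<And>i. i \<in> I \<Longrightarrow> Z i \<in> borel_measurable M"
    and ch: "\<And>s t. (CLINT \<omega>|M. iexp (\<Sum>i\<in>I. s i * Y i \<omega> + t i * Z i \<omega>)) = of_real (exp (- (\<Sum>i\<in>I. (s i)\<^sup>2 + (t i)\<^sup>2) / 2))"
  shows "distr M (gauss2 I) (\<lambda>\<omega>. (\<lambda>i\<in>I. Y i \<omega>, \<lambda>i\<in>I. Z i \<omega>)) =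
    distr (gauss (I \<times> UNIV)) (gauss2 I) (\<lambda>z. (\<lambda>i\<in>I. z (i, False), \<lambda>i\<in>I. z (i, True)))"
proof -
  note [measurable] = assms(3,4)
  let ?W = "\<lambda>(i,b). if b then Z i else Y i"
  have sumW: "(\<Sum>j\<in>I \<times> UNIV. g j) = (\<Sum>i\<in>I. g (i, False) + g (i, True))" for g :: "_ \<Rightarrow> real"
    by (subst sum.cartesian_product[symmetric, of "\<lambda>i b. g (i,b)", simplified]) (simp add: UNIV_bool add.commute)
  have "distr M (gauss (I \<times> UNIV)) (\<lambda>\<omega>. \<lambda>j\<in>I \<times> UNIV. ?W j \<omega>) = gauss (I \<times> UNIV)"
  proof (rule distr_gaussian_family)
    fix t show "(CLINT \<omega>|M. iexp (\<Sum>j\<in>I \<times> UNIV. t j * ?W j \<omega>)) = of_real (exp (- (\<Sum>j\<in>I \<times> UNIV. (t j)\<^sup>2) / 2))"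
      unfolding sumW using ch[of "\<lambda>i. t (i, False)" "\<lambda>i. t (i, True)"] by simp
  qed (use assms in auto)
  hence "distr (gauss (I \<times> UNIV)) (gauss2 I) (\<lambda>z. (\<lambda>i\<in>I. z (i, False), \<lambda>i\<in>I. z (i, True))) =
     distr (distr M (gauss (I \<times> UNIV)) (\<lambda>\<omega>. \<lambda>j\<in>I \<times> UNIV. ?W j \<omega>)) (gauss2 I) (\<lambda>z. (\<lambda>i\<in>I. z (i, False), \<lambda>i\<in>I. z (i, True)))"
    by simp
  also have "\<dots> = distr M (gauss2 I) ((\<lambda>z. (\<lambda>i\<in>I. z (i, False), \<lambda>i\<in>I. z (i, True))) \<circ> (\<lambda>\<omega>. \<lambda>j\<in>I \<times> UNIV. ?W j \<omega>))"
  proof (rule distr_distr)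
    show "(\<lambda>z. (\<lambda>i\<in>I. z (i, False), \<lambda>i\<in>I. z (i, True))) \<in> gauss (I \<times> UNIV) \<rightarrow>\<^sub>M gauss2 I"
      by (simp only: measurable_gauss1 measurable_gauss2_2) (intro measurable_Pair measurable_restrict; simp)
    show "(\<lambda>\<omega>. \<lambda>j\<in>I \<times> UNIV. ?W j \<omega>) \<in> M \<rightarrow>\<^sub>M gauss (I \<times> UNIV)"
      by (simp only: measurable_gauss2) (rule measurable_restrict; auto)
  qed
  also have "\<dots> = distr M (gauss2 I) (\<lambda>\<omega>. (\<lambda>i\<in>I. Y i \<omega>, \<lambda>i\<in>I. Z i \<omega>))"
    by (rule distr_cong) (auto simp: o_def restrict_def)
  finally show ?thesis by simp
qed

lemma distr_gaussian_pair:
  assumes "finite I" "prob_space M" "\<And>i. i \<in> I \<Longrightarrow> Y i \<in> borel_measurable M" "\<And>i. i \<in> I \<Longrightarrow> Z i \<in> borel_measurable M"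
    and "\<And>s t. (CLINT \<omega>|M. iexp (\<Sum>i\<in>I. s i * Y i \<omega> + t i * Z i \<omega>)) = of_real (exp (- (\<Sum>i\<in>I. (s i)\<^sup>2 + (t i)\<^sup>2) / 2))"
  shows "distr M (gauss2 I) (\<lambda>\<omega>. (\<lambda>i\<in>I. Y i \<omega>, \<lambda>i\<in>I. Z i \<omega>)) = gauss2 I"
proof -
  have "distr (gauss2 I) (gauss2 I) (\<lambda>\<omega>. (\<lambda>i\<in>I. fst \<omega> i, \<lambda>i\<in>I. snd \<omega> i)) =
    distr (gauss (I \<times> UNIV)) (gauss2 I) (\<lambda>z. (\<lambda>i\<in>I. z (i, False), \<lambda>i\<in>I. z (i, True)))"
    by (rule distr_gaussian_pair_aux[OF assms(1) prob_space_gauss2 _ _ gauss2_char]) (use assms(1) in auto)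
  moreover have "distr (gauss2 I) (gauss2 I) (\<lambda>\<omega>. (\<lambda>i\<in>I. fst \<omega> i, \<lambda>i\<in>I. snd \<omega> i)) = distr (gauss2 I) (gauss2 I) (\<lambda>\<omega>. \<omega>)"
    by (rule distr_cong) (auto simp: space_gauss2 PiE_restrict)
  ultimately show ?thesis using distr_gaussian_pair_aux[OF assms] by (simp add: distr_id2)
qed

definition rot :: "'i set \<Rightarrow> real \<Rightarrow> ('i \<Rightarrow> real) \<times> ('i \<Rightarrow> real) \<Rightarrow> ('i \<Rightarrow> real) \<times> ('i \<Rightarrow> real)" where
  "rot I \<theta> z = (\<lambda>i\<in>I. cos \<theta> * fst z i + sin \<theta> * snd z i, \<lambda>i\<in>I. cos \<theta> * snd z i - sin \<theta> * fst z i)"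

lemma distr_rot:
  assumes "finite I"
  shows "distr (gauss2 I) (gauss2 I) (rot I \<theta>) = gauss2 I"
  unfolding rot_def[abs_def]
proof (rule distr_gaussian_pair[OF assms prob_space_gauss2])
  fix s t :: "'a \<Rightarrow> real"
  \<comment> \<open>The transposed rotation of the coefficients \<open>(s i, t i)\<close>, which
    keeps their sum of squares.\<close>
  let ?s = "\<lambda>i. s i * cos \<theta> - t i * sin \<theta>" and ?t = "\<lambda>i. s i * sin \<theta> + t i * cos \<theta>"
  have 1: "s i * (cos \<theta> * fst z i + sin \<theta> * snd z i) + t i * (cos \<theta> * snd z i - sin \<theta> * fst z i) 
     = ?s i * fst z i + ?t i * snd z i" for i and z :: "('a \<Rightarrow> real) \<times> ('a \<Rightarrow> real)"
    by (simp add: algebra_simps)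
  have "(?s i)\<^sup>2 + (?t i)\<^sup>2 = ((s i)\<^sup>2 + (t i)\<^sup>2) * ((sin \<theta>)\<^sup>2 + (cos \<theta>)\<^sup>2)" for i
    by algebra
  hence 2: "(?s i)\<^sup>2 + (?t i)\<^sup>2 = (s i)\<^sup>2 + (t i)\<^sup>2" for i by simp
  show "(CLINT \<omega>|gauss2 I. iexp (\<Sum>i\<in>I. s i * (cos \<theta> * fst \<omega> i + sin \<theta> * snd \<omega> i) + t i * (cos \<theta> * snd \<omega> i - sin \<theta> * fst \<omega> i)))
    = of_real (exp (- (\<Sum>i\<in>I. (s i)\<^sup>2 + (t i)\<^sup>2) / 2))"
    unfolding 1 gauss2_char[OF assms] 2 ..
qed (use assms in auto)

lemma measurable_rot[measurable]:
  "finite I \<Longrightarrow> rot I \<theta> \<in> PiM I (\<lambda>_. borel) \<Otimes>\<^sub>M PiM I (\<lambda>_. borel) \<rightarrow>\<^sub>M PiM I (\<lambda>_. borel) \<Otimes>\<^sub>M PiM I (\<lambda>_. borel)"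
  unfolding rot_def[abs_def] by (intro measurable_Pair measurable_restrict) auto

section \<open>Polynomials of a Gaussian vector and trigonometric polynomials\<close>

text \<open>Polynomials are mere functions and d is only an upper bound for the degree, so that each
  property takes one induction and no monomials or coefficients appear.\<close>

inductive gpoly :: "'i set \<Rightarrow> nat \<Rightarrow> (('i \<Rightarrow> real) \<Rightarrow> real) \<Rightarrow> bool" for I where
  const: "gpoly I d (\<lambda>x. c)"
| var: "gpoly I d f \<Longrightarrow> i \<in> I \<Longrightarrow> gpoly I (Suc d) (\<lambda>x. x i * f x)"
| add: "gpoly I d f \<Longrightarrow> gpoly I d g \<Longrightarrow> gpoly I d (\<lambda>x. f x + g x)"

lemma gpoly_mono: "gpoly I d f \<Longrightarrow> d \<le> e \<Longrightarrow> gpoly I e f"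
proof (induction arbitrary: e rule: gpoly.induct)
  case (var d f i)
  then obtain e' where "e = Suc e'" "d \<le> e'" by (cases e) auto
  with var show ?case by (auto intro: gpoly.var)
qed (auto intro: gpoly.intros)

lemma gpoly_cmult: "gpoly I d f \<Longrightarrow> gpoly I d (\<lambda>x. c * f x)"
proof (induction rule: gpoly.induct)
  case (var d f i)
  thus ?case using gpoly.var[of I d "\<lambda>x. c * f x" i] by (simp add: mult.left_commute)
qed (auto intro: gpoly.intros simp: ring_distribs)

lemma gpoly_mult: "gpoly I d f \<Longrightarrow> gpoly I e g \<Longrightarrow> gpoly I (d + e) (\<lambda>x. f x * g x)"
proof (induction rule: gpoly.induct)
  case (const d c)
  thus ?case by (auto intro: gpoly_cmult gpoly_mono)
next
  case (var d f i)
  thus ?case using gpoly.var[of I "d+e" "\<lambda>x. f x * g x" i] by (simp add: mult.assoc)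
qed (auto intro: gpoly.intros simp: ring_distribs)

lemma gpoly_power: "gpoly I d f \<Longrightarrow> gpoly I (n * d) (\<lambda>x. f x ^ n)"
  by (induction n) (auto intro: gpoly.intros gpoly_mult)

lemma gpoly_sum: "(\<And>j. j \<in> J \<Longrightarrow> gpoly I d (f j)) \<Longrightarrow> gpoly I d (\<lambda>x. \<Sum>j\<in>J. f j x)"
  by (induction J rule: infinite_finite_induct) (auto intro: gpoly.intros)

lemma gpoly_coord: "i \<in> I \<Longrightarrow> gpoly I 1 (\<lambda>x. x i)"
  using gpoly.var[OF gpoly.const[of I 0 1], of i] by simp

lemma gpoly_linear: "gpoly I 1 (\<lambda>x. \<Sum>i\<in>I. a i * x i)"
  by (intro gpoly_sum gpoly_cmult gpoly_coord)

lemma gpoly_poly: "gpoly I d f \<Longrightarrow> gpoly I (degree q * d) (\<lambda>x. poly q (f x))"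
  unfolding poly_altdef
  by (intro gpoly_sum gpoly_cmult gpoly_mono[OF gpoly_power]) auto

lemma gpoly_0D: "gpoly I d f \<Longrightarrow> d = 0 \<Longrightarrow> \<exists>c. f = (\<lambda>x. c)"
  by (induction rule: gpoly.induct) auto

lemma gpoly_measurable: "gpoly I d f \<Longrightarrow> f \<in> borel_measurable (PiM I (\<lambda>_. borel))"
proof (induction rule: gpoly.induct)
  case (var d f i)
  note [measurable] = var
  show ?case using var(2) by measurable
qed auto

text \<open>The gradient is characterised by the chain rule along curves, the form in which
  rotations use it. This avoids a topology on the function space and leaves the coordinates outside
  I alone.\<close>

definition has_grad :: "'i set \<Rightarrow> (('i \<Rightarrow> real) \<Rightarrow> real) \<Rightarrow> ('i \<Rightarrow> ('i \<Rightarrow> real) \<Rightarrow> real) \<Rightarrow> bool" where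
  "has_grad I f D \<longleftrightarrow> (\<forall>z z' t. (\<forall>i\<in>I. ((\<lambda>s. z s i) has_real_derivative z' i) (at t)) \<longrightarrow>
      ((\<lambda>s. f (z s)) has_real_derivative (\<Sum>i\<in>I. D i (z t) * z' i)) (at t))"

text \<open>The last clause is there for the induction: at d = 0 the natural number
  \<open>d - 1\<close> is again 0, and the product of a coordinate with \<open>D j\<close> has
  degree 0 only because \<open>D j\<close> vanishes.\<close>

lemma gpoly_has_grad:
  assumes "finite I" "gpoly I d f"
  shows "\<exists>D. has_grad I f D \<and> (\<forall>i\<in>I. gpoly I (d - 1) (D i)) \<and> (d = 0 \<longrightarrow> D = (\<lambda>i x. 0))"
  using assms(2)
proof (induction rule: gpoly.induct)
  case (const d c)
  show ?case by (intro exI[of _ "\<lambda>i x. 0"]) (auto simp: has_grad_def intro: gpoly.intros)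
next
  case (add d f g)
  then obtain D E where D: "has_grad I f D" "\<And>i. i\<in>I \<Longrightarrow> gpoly I (d - 1) (D i)" "d = 0 \<Longrightarrow> D = (\<lambda>i x. 0)"
    and E: "has_grad I g E" "\<And>i. i\<in>I \<Longrightarrow> gpoly I (d - 1) (E i)" "d = 0 \<Longrightarrow> E = (\<lambda>i x. 0)" by blast
  have "has_grad I (\<lambda>x. f x + g x) (\<lambda>i x. D i x + E i x)"
    using D(1) E(1) unfolding has_grad_def by (auto simp: ring_distribs sum.distrib intro!: DERIV_add)
  thus ?case by (intro exI[of _ "\<lambda>i x. D i x + E i x"]) (use D E in \<open>auto intro: gpoly.add\<close>)
next
  case (var d f i)
  then obtain D where D: "has_grad I f D" "\<And>i. i\<in>I \<Longrightarrow> gpoly I (d - 1) (D i)" "d = 0 \<Longrightarrow> D = (\<lambda>i x. 0)" by blast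
  let ?D = "\<lambda>j x. (if j = i then f x else 0) + x i * D j x"
  have "has_grad I (\<lambda>x. x i * f x) ?D"
    unfolding has_grad_def
  proof (intro allI impI)
    fix z :: "real \<Rightarrow> 'a \<Rightarrow> real" and z' t
    assume z: "\<forall>j\<in>I. ((\<lambda>s. z s j) has_real_derivative z' j) (at t)"
    have "((\<lambda>s. f (z s)) has_real_derivative (\<Sum>j\<in>I. D j (z t) * z' j)) (at t)"
      using D(1) z unfolding has_grad_def by blast
    from DERIV_mult[OF z[rule_format, OF var(2)] this]
    have "((\<lambda>s. z s i * f (z s)) has_real_derivative z' i * f (z t) + (\<Sum>j\<in>I. D j (z t) * z' j) * z t i) (at t)" .
    also have "z' i * f (z t) + (\<Sum>j\<in>I. D j (z t) * z' j) * z t i = (\<Sum>j\<in>I. ?D j (z t) * z' j)"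
    proof -
      have "(\<Sum>j\<in>I. (if j = i then f (z t) else 0) * z' j) = (\<Sum>j\<in>I. if j = i then f (z t) * z' j else 0)"
        by (rule sum.cong) auto
      thus ?thesis using assms(1) var(2) by (simp add: ring_distribs sum.distrib sum_distrib_left sum_distrib_right mult_ac)
    qed
    finally show "((\<lambda>s. z s i * f (z s)) has_real_derivative (\<Sum>j\<in>I. ?D j (z t) * z' j)) (at t)" .
  qed
  moreover have "gpoly I d (?D j)" if "j \<in> I" for j
  proof (rule gpoly.add)
    show "gpoly I d (\<lambda>x. if j = i then f x else 0)" using var(1) gpoly.const[of I d 0] by (cases "j = i") auto
    show "gpoly I d (\<lambda>x. x i * D j x)"
    proof (cases d)
      case 0
      thus ?thesis using D(3) gpoly.const[of I 0 0] by simp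
    next
      case (Suc e)
      thus ?thesis using D(2)[OF that] gpoly.var[of I e "D j" i] var(2) by simp
    qed
  qed
  ultimately show ?case by (intro exI[of _ ?D]) auto
qed

lemma has_grad_power:
  assumes "has_grad I f D"
  shows "has_grad I (\<lambda>x. f x ^ n) (\<lambda>i x. real n * f x ^ (n - 1) * D i x)"
  unfolding has_grad_def
proof (intro allI impI)
  fix z :: "real \<Rightarrow> 'a \<Rightarrow> real" and z' t
  assume z: "\<forall>j\<in>I. ((\<lambda>s. z s j) has_real_derivative z' j) (at t)"
  have "((\<lambda>s. f (z s)) has_real_derivative (\<Sum>j\<in>I. D j (z t) * z' j)) (at t)"
    using assms z unfolding has_grad_def by blast
  from DERIV_power[OF this, of n]
  show "((\<lambda>s. f (z s) ^ n) has_real_derivative (\<Sum>i\<in>I. real n * f (z t) ^ (n - 1) * D i (z t) * z' i)) (at t)"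
    by (simp add: sum_distrib_left sum_distrib_right mult_ac)
qed

lemma distr_gauss_coord:
  "finite I \<Longrightarrow> i \<in> I \<Longrightarrow> distr (gauss I) borel (\<lambda>x. x i) = std_normal_distribution"
proof -
  assume I: "finite I" "i \<in> I"
  interpret N: prob_space std_normal_distribution by (rule prob_space_std_normal)
  interpret product_prob_space "\<lambda>_. std_normal_distribution" I ..
  have "distr (gauss I) std_normal_distribution (\<lambda>x. x i) = std_normal_distribution"
    unfolding gauss_def using PiM_component[OF I(2)] .
  moreover have "distr (gauss I) std_normal_distribution (\<lambda>x. x i) = distr (gauss I) borel (\<lambda>x. x i)"
    by (rule distr_cong) auto
  ultimately show ?thesis by simp
qed

text \<open>All n are treated at once because the product with a coordinate doubles the exponent:
  its power is bounded by the sum of the squares of the two factors' powers.\<close>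

lemma gpoly_integrable_even:
  assumes I: "finite I" and "gpoly I d f"
  shows "integrable (gauss I) (\<lambda>x. f x ^ (2 * n))"
  using assms(2)
proof (induction arbitrary: n rule: gpoly.induct)
  interpret prob_space "gauss I" by (rule prob_space_gauss)
  {
    case (const d c)
    show ?case by simp
  next
    case (add d f g)
    note [measurable] = gpoly_measurable[OF add(1)] gpoly_measurable[OF add(2)]
    have b: "(a + b) ^ (2 * n) \<le> 2 ^ (2 * n) * (a ^ (2 * n) + b ^ (2 * n))" for a b :: real
    proof -
      have 1: "\<bar>a + b\<bar> \<le> 2 * max \<bar>a\<bar> \<bar>b\<bar>" by linarith
      have "(a + b) ^ (2 * n) = \<bar>a + b\<bar> ^ (2 * n)" by (simp add: power_even_abs)
      also have "\<dots> \<le> (2 * max \<bar>a\<bar> \<bar>b\<bar>) ^ (2 * n)" by (rule power_mono[OF 1]) simp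
      also have "\<dots> = 2 ^ (2 * n) * max \<bar>a\<bar> \<bar>b\<bar> ^ (2 * n)" by (simp add: power_mult_distrib)
      also have "max \<bar>a\<bar> \<bar>b\<bar> ^ (2 * n) \<le> a ^ (2 * n) + b ^ (2 * n)"
        by (auto simp: max_def power_even_abs)
      finally show ?thesis by simp
    qed
    show ?case
      by (rule Bochner_Integration.integrable_bound[where f="\<lambda>x. 2 ^ (2 * n) * (f x ^ (2 * n) + g x ^ (2 * n))"])
         (use add b in auto)
  next
    case (var d f i)
    note [measurable] = gpoly_measurable[OF var(1)] and i = var(2)
    have x: "integrable (gauss I) (\<lambda>x. x i ^ (2 * (2 * n)))"
    proof -
      have "integrable (distr (gauss I) borel (\<lambda>x. x i)) (\<lambda>x. x ^ (2 * (2 * n)))"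
        unfolding distr_gauss_coord[OF I i] by (rule integrable_std_normal_distribution_moment)
      thus ?thesis by (subst (asm) integrable_distr_eq) (use i in auto)
    qed
    have b: "(a * b) ^ (2 * n) \<le> a ^ (2 * (2 * n)) + b ^ (2 * (2 * n))" for a b :: real
    proof -
      have "2 * (a ^ (2 * n) * b ^ (2 * n)) \<le> (a ^ (2 * n))\<^sup>2 + (b ^ (2 * n))\<^sup>2"
        using sum_squares_bound[of "a ^ (2 * n)" "b ^ (2 * n)"] by (simp add: mult.assoc)
      moreover have "0 \<le> a ^ (2 * n) * b ^ (2 * n)" by (simp add: zero_le_even_power)
      ultimately show ?thesis by (simp add: power_mult_distrib mult.commute[of 2] flip: power_mult)
    qed
    show ?case
      by (rule Bochner_Integration.integrable_bound[where f="\<lambda>x. x i ^ (2 * (2 * n)) + f x ^ (2 * (2 * n))"])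
         (use x var.IH[of "2 * n"] b i in \<open>auto simp: abs_mult zero_le_even_power power_even_abs\<close>)
  }
qed

lemma gpoly_integrable:
  assumes "finite I" "gpoly I d f"
  shows "integrable (gauss I) f"
proof -
  interpret prob_space "gauss I" by (rule prob_space_gauss)
  note [measurable] = gpoly_measurable[OF assms(2)]
  show ?thesis
    by (rule square_integrable_imp_integrable) (use gpoly_integrable_even[OF assms, of 1] in auto)
qed

lemma real_distribution_distr_normal:
  "real_distribution (distr std_normal_distribution borel (\<lambda>x. \<sigma> * x))"
  by (rule prob_space.real_distribution_distr[OF prob_space_std_normal]) simp

text \<open>The law of a linear form depends on its coefficients only through their Euclidean norm;
  this is how the dimension disappears from the estimates along a random direction.\<close>

lemma distr_gauss_linear:
  assumes "finite I"
  shows "distr (gauss I) borel (\<lambda>x. \<Sum>i\<in>I. a i * x i) = distr std_normal_distribution borel (\<lambda>x. sqrt (\<Sum>i\<in>I. (a i)\<^sup>2) * x)"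
proof (rule Levy_uniqueness)
  have [measurable]: "(\<lambda>x. \<Sum>i\<in>I. a i * x i) \<in> borel_measurable (gauss I)" by simp measurable
  show "real_distribution (distr (gauss I) borel (\<lambda>x. \<Sum>i\<in>I. a i * x i))"
    by (rule prob_space.real_distribution_distr[OF prob_space_gauss]) measurable
  show "char (distr (gauss I) borel (\<lambda>x. \<Sum>i\<in>I. a i * x i)) = char (distr std_normal_distribution borel (\<lambda>x. sqrt (\<Sum>i\<in>I. (a i)\<^sup>2) * x))"
  proof
    fix t
    let ?\<sigma> = "sqrt (\<Sum>i\<in>I. (a i)\<^sup>2)"
    have "char (distr (gauss I) borel (\<lambda>x. \<Sum>i\<in>I. a i * x i)) t = (CLINT x|gauss I. iexp (t * (\<Sum>i\<in>I. a i * x i)))"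
      unfolding char_def by (rule integral_distr) auto
    also have "\<dots> = (CLINT x|gauss I. iexp (\<Sum>i\<in>I. (t * a i) * x i))"
      by (simp add: sum_distrib_left mult_ac)
    also have "\<dots> = of_real (exp (- (\<Sum>i\<in>I. (t * a i)\<^sup>2) / 2))" by (rule gauss_char[OF assms])
    also have "(\<Sum>i\<in>I. (t * a i)\<^sup>2) = (t * ?\<sigma>)\<^sup>2"
      by (simp add: power_mult_distrib sum_distrib_left sum_nonneg)
    also have "of_real (exp (- (t * ?\<sigma>)\<^sup>2 / 2)) = char std_normal_distribution (t * ?\<sigma>)"
      by (simp add: char_std_normal_distribution)
    also have "\<dots> = (CLINT x|std_normal_distribution. iexp (t * (?\<sigma> * x)))"
      unfolding char_def by (simp add: mult.assoc)
    also have "\<dots> = char (distr std_normal_distribution borel (\<lambda>x. ?\<sigma> * x)) t"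
      unfolding char_def by (rule integral_distr[symmetric]) auto
    finally show "char (distr (gauss I) borel (\<lambda>x. \<Sum>i\<in>I. a i * x i)) t = char (distr std_normal_distribution borel (\<lambda>x. ?\<sigma> * x)) t" .
  qed
qed (rule real_distribution_distr_normal)

lemma nn_integral_gauss_linear:
  assumes "finite I" and [measurable]: "h \<in> borel_measurable borel"
  shows "(\<integral>\<^sup>+ x. h (\<Sum>i\<in>I. a i * x i) \<partial>gauss I) = (\<integral>\<^sup>+ x. h (sqrt (\<Sum>i\<in>I. (a i)\<^sup>2) * x) \<partial>std_normal_distribution)"
proof -
  have m: "(\<lambda>x. \<Sum>i\<in>I. a i * x i) \<in> gauss I \<rightarrow>\<^sub>M borel" by simp measurable
  have "(\<integral>\<^sup>+ x. h (\<Sum>i\<in>I. a i * x i) \<partial>gauss I) = (\<integral>\<^sup>+ y. h y \<partial>distr (gauss I) borel (\<lambda>x. \<Sum>i\<in>I. a i * x i))"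
    by (rule nn_integral_distr[symmetric, OF m]) simp
  also have "\<dots> = (\<integral>\<^sup>+ x. h (sqrt (\<Sum>i\<in>I. (a i)\<^sup>2) * x) \<partial>std_normal_distribution)"
    unfolding distr_gauss_linear[OF assms(1)] by (rule nn_integral_distr) auto
  finally show ?thesis .
qed

section \<open>Trigonometric polynomials\<close>

inductive tpoly :: "nat \<Rightarrow> (real \<Rightarrow> real) \<Rightarrow> bool" where
  const: "tpoly d (\<lambda>\<theta>. c)"
| cos: "tpoly d T \<Longrightarrow> tpoly (Suc d) (\<lambda>\<theta>. cos \<theta> * T \<theta>)"
| sin: "tpoly d T \<Longrightarrow> tpoly (Suc d) (\<lambda>\<theta>. sin \<theta> * T \<theta>)"
| add: "tpoly d S \<Longrightarrow> tpoly d T \<Longrightarrow> tpoly d (\<lambda>\<theta>. S \<theta> + T \<theta>)"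

lemma tpoly_mono: "tpoly d f \<Longrightarrow> d \<le> e \<Longrightarrow> tpoly e f"
proof (induction arbitrary: e rule: tpoly.induct)
  case (cos d f)
  then obtain e' where "e = Suc e'" "d \<le> e'" by (cases e) auto
  with cos show ?case by (auto intro: tpoly.cos)
next
  case (sin d f)
  then obtain e' where "e = Suc e'" "d \<le> e'" by (cases e) auto
  with sin show ?case by (auto intro: tpoly.sin)
qed (auto intro: tpoly.intros)

lemma tpoly_cmult: "tpoly d f \<Longrightarrow> tpoly d (\<lambda>x. c * f x)"
proof (induction rule: tpoly.induct)
  case (cos d f)
  thus ?case using tpoly.cos[of d "\<lambda>x. c * f x"] by (simp add: mult.left_commute)
next
  case (sin d f)
  thus ?case using tpoly.sin[of d "\<lambda>x. c * f x"] by (simp add: mult.left_commute)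
qed (auto intro: tpoly.intros simp: ring_distribs)

lemma tpoly_mult: "tpoly d f \<Longrightarrow> tpoly e g \<Longrightarrow> tpoly (d + e) (\<lambda>x. f x * g x)"
proof (induction rule: tpoly.induct)
  case (const d c)
  thus ?case by (auto intro: tpoly_cmult tpoly_mono)
next
  case (cos d f)
  thus ?case using tpoly.cos[of "d+e" "\<lambda>x. f x * g x"] by (simp add: mult.assoc)
next
  case (sin d f)
  thus ?case using tpoly.sin[of "d+e" "\<lambda>x. f x * g x"] by (simp add: mult.assoc)
qed (auto intro: tpoly.intros simp: ring_distribs)

lemma tpoly_diff: "tpoly d f \<Longrightarrow> tpoly d g \<Longrightarrow> tpoly d (\<lambda>x. f x - g x)"
  using tpoly.add[of d f "\<lambda>x. (-1) * g x"] tpoly_cmult[of d g "-1"] by simp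

lemma tpoly_deriv: "tpoly d T \<Longrightarrow> \<exists>T'. tpoly d T' \<and> (\<forall>\<theta>. (T has_real_derivative T' \<theta>) (at \<theta>))"
proof (induction rule: tpoly.induct)
  case (const d c)
  show ?case by (intro exI[of _ "\<lambda>_. 0"]) (auto intro: tpoly.const)
next
  case (add d S T)
  then obtain S' T' where "tpoly d S'" "\<forall>\<theta>. (S has_real_derivative S' \<theta>) (at \<theta>)" "tpoly d T'" "\<forall>\<theta>. (T has_real_derivative T' \<theta>) (at \<theta>)" by auto
  thus ?case by (intro exI[of _ "\<lambda>\<theta>. S' \<theta> + T' \<theta>"]) (auto intro: tpoly.add DERIV_add)
next
  case (cos d T)
  then obtain T' where T: "tpoly d T'" "\<And>\<theta>. (T has_real_derivative T' \<theta>) (at \<theta>)" by auto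
  have "tpoly (Suc d) (\<lambda>\<theta>. cos \<theta> * T' \<theta> - sin \<theta> * T \<theta>)"
    by (intro tpoly_diff tpoly.intros T cos)
  thus ?case by (intro exI[of _ "\<lambda>\<theta>. cos \<theta> * T' \<theta> - sin \<theta> * T \<theta>"]) (auto intro!: derivative_eq_intros T)
next
  case (sin d T)
  then obtain T' where T: "tpoly d T'" "\<And>\<theta>. (T has_real_derivative T' \<theta>) (at \<theta>)" by auto
  have "tpoly (Suc d) (\<lambda>\<theta>. sin \<theta> * T' \<theta> + cos \<theta> * T \<theta>)"
    by (intro tpoly.intros T sin)
  thus ?case by (intro exI[of _ "\<lambda>\<theta>. sin \<theta> * T' \<theta> + cos \<theta> * T \<theta>"]) (auto intro!: derivative_eq_intros T)
qed

text \<open>With z on the unit circle, cos and sin are (z + 1/z)/2 and (z - 1/z)/(2i); each factor z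
  of \<open>cis \<theta> ^ d\<close> clears one denominator. Both the zero count and the Fourier
  expansion are read off this polynomial.\<close>

lemma tpoly_complex_poly:
  "tpoly d T \<Longrightarrow> \<exists>q::complex poly. degree q \<le> 2 * d \<and> (\<forall>\<theta>. poly q (cis \<theta>) = cis \<theta> ^ d * of_real (T \<theta>))"
proof (induction rule: tpoly.induct)
  case (const d c)
  show ?case
    by (intro exI[of _ "monom (of_real c) d"]) (auto simp: poly_monom intro: order.trans[OF degree_monom_le])
next
  case (add d S T)
  then obtain p q :: "complex poly" where
    "degree p \<le> 2 * d" "\<forall>\<theta>. poly p (cis \<theta>) = cis \<theta> ^ d * of_real (S \<theta>)"
    "degree q \<le> 2 * d" "\<forall>\<theta>. poly q (cis \<theta>) = cis \<theta> ^ d * of_real (T \<theta>)" by auto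
  thus ?case by (intro exI[of _ "p + q"]) (auto simp: ring_distribs intro: degree_add_le)
next
  case (cos d T)
  then obtain q :: "complex poly" where q: "degree q \<le> 2 * d" "\<And>\<theta>. poly q (cis \<theta>) = cis \<theta> ^ d * of_real (T \<theta>)" by auto
  have c: "of_real (cos \<theta>) * cis \<theta> = ((cis \<theta>)\<^sup>2 + 1) / 2" for \<theta>
    by (simp add: complex_eq_iff power2_eq_square) (use sin_cos_squared_add[of \<theta>] in \<open>simp add: power2_eq_square algebra_simps\<close>)
  have "degree ([:1/2, 0, 1/2:] * q) \<le> 2 * Suc d"
    by (rule order.trans[OF degree_mult_le]) (use q in auto)
  moreover have "poly ([:1/2, 0, 1/2:] * q) (cis \<theta>) = cis \<theta> ^ Suc d * of_real (cos \<theta> * T \<theta>)" for \<theta>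
  proof -
    have "poly ([:1/2, 0, 1/2:] * q) (cis \<theta>) = ((cis \<theta>)\<^sup>2 + 1) / 2 * (cis \<theta> ^ d * of_real (T \<theta>))"
      by (simp add: q(2) power2_eq_square field_simps)
    also have "\<dots> = cis \<theta> ^ Suc d * of_real (cos \<theta> * T \<theta>)" unfolding c[symmetric] by simp
    finally show ?thesis .
  qed
  ultimately show ?case by blast
next
  case (sin d T)
  then obtain q :: "complex poly" where q: "degree q \<le> 2 * d" "\<And>\<theta>. poly q (cis \<theta>) = cis \<theta> ^ d * of_real (T \<theta>)" by auto
  have c: "of_real (sin \<theta>) * cis \<theta> = (\<i>/2) * (1 - (cis \<theta>)\<^sup>2)" for \<theta>
    by (simp add: complex_eq_iff power2_eq_square) (use sin_cos_squared_add[of \<theta>] in \<open>simp add: power2_eq_square algebra_simps\<close>)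
  have "degree ([:\<i>/2, 0, -\<i>/2:] * q) \<le> 2 * Suc d"
    by (rule order.trans[OF degree_mult_le]) (use q in auto)
  moreover have "poly ([:\<i>/2, 0, -\<i>/2:] * q) (cis \<theta>) = cis \<theta> ^ Suc d * of_real (sin \<theta> * T \<theta>)" for \<theta>
  proof -
    have "poly ([:\<i>/2, 0, -\<i>/2:] * q) (cis \<theta>) = (\<i>/2) * (1 - (cis \<theta>)\<^sup>2) * (cis \<theta> ^ d * of_real (T \<theta>))"
      by (simp add: q(2) power2_eq_square algebra_simps)
    also have "\<dots> = cis \<theta> ^ Suc d * of_real (sin \<theta> * T \<theta>)" unfolding c[symmetric] by simp
    finally show ?thesis .
  qed
  ultimately show ?case by blast
qed

text \<open>Distinct zeros give distinct roots on the unit circle, since cos already separates the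
  points of an interval of length 1 < pi starting at 0.\<close>

lemma tpoly_zeros:
  assumes "tpoly d T"
  shows "(\<forall>\<theta>. T \<theta> = 0) \<or> (finite {\<theta>\<in>{0..1}. T \<theta> = 0} \<and> card {\<theta>\<in>{0..1}. T \<theta> = 0} \<le> 2 * d)"
proof -
  obtain q :: "complex poly" where q: "degree q \<le> 2 * d" "\<And>\<theta>. poly q (cis \<theta>) = cis \<theta> ^ d * of_real (T \<theta>)"
    using tpoly_complex_poly[OF assms] by auto
  show ?thesis
  proof (cases "q = 0")
    case True
    thus ?thesis using q(2) by simp
  next
    case False
    have inj: "inj_on cis {0..1}"
    proof (rule inj_onI)
      fix x y :: real assume xy: "x \<in> {0..1}" "y \<in> {0..1}" "cis x = cis y"
      have "cos x = cos y" using xy(3) by (metis cis.sel(1))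
      thus "x = y" using cos_inj_pi[of x y] xy pi_ge_two by auto
    qed
    let ?Z = "{\<theta>\<in>{0..1}. T \<theta> = 0}"
    have sub: "cis ` ?Z \<subseteq> {z. poly q z = 0}" using q(2) by auto
    have fin: "finite {z. poly q z = 0}" by (rule poly_roots_finite[OF False])
    have inj': "inj_on cis ?Z" by (rule inj_on_subset[OF inj]) auto
    have "card ?Z = card (cis ` ?Z)" using card_image[OF inj'] by simp
    also have "\<dots> \<le> card {z. poly q z = 0}" by (rule card_mono[OF fin sub])
    also have "\<dots> \<le> degree q" by (rule card_poly_roots_bound[OF False])
    finally have "card ?Z \<le> 2 * d" using q(1) by simp
    moreover have "finite ?Z" using finite_imageD[OF finite_subset[OF sub fin] inj'] .
    ultimately show ?thesis by blast
  qed
qed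

text \<open>Between consecutive zeros of \<open>w'\<close> the function w is monotone and its
  variation is at most \<open>2 * B\<close>, and n zeros leave n + 1 pieces. The induction splits
  the interval at an arbitrary interior zero, so no enumeration in order is called for.\<close>

lemma integral_abs_deriv_le:
  fixes w w' :: "real \<Rightarrow> real"
  assumes "a \<le> b" and d: "\<And>t. (w has_real_derivative w' t) (at t)" and c: "continuous_on UNIV w'"
    and B: "\<And>t. \<bar>w t\<bar> \<le> B" and "finite {t\<in>{a<..<b}. w' t = 0}" "card {t\<in>{a<..<b}. w' t = 0} \<le> n"
  shows "integral {a..b} (\<lambda>t. \<bar>w' t\<bar>) \<le> 2 * B * (n + 1)"
  using assms(1,5,6)
proof (induction n arbitrary: a b rule: less_induct)
  case (less n)
  let ?Z = "\<lambda>a b. {t\<in>{a<..<b}. w' t = 0}"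
  have cont: "continuous_on S w'" for S using c continuous_on_subset by blast
  have B0: "0 \<le> B" using B[of 0] by linarith
  show ?case
  proof (cases "?Z a b = {}")
    case True
    have ftc: "(w' has_integral (w b - w a)) {a..b}"
      by (rule fundamental_theorem_of_calculus[OF less.prems(1)])
        (use d in \<open>auto simp: has_real_derivative_iff_has_vector_derivative[symmetric] intro: has_field_derivative_at_within\<close>)
    have "(\<forall>t\<in>{a<..<b}. w' t > 0) \<or> (\<forall>t\<in>{a<..<b}. w' t < 0)"
    proof (rule ccontr)
      assume "\<not> ?thesis"
      then obtain s t where st: "s \<in> {a<..<b}" "t \<in> {a<..<b}" "w' s < 0" "w' t > 0"
        using True by (metis (mono_tags, lifting) empty_iff mem_Collect_eq linorder_neqE_linordered_idom)
      have "\<exists>x\<in>{a<..<b}. w' x = 0"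
      proof (cases "s \<le> t")
        case True
        from IVT'[of w' s 0 t, OF _ _ True cont] st obtain x where "s \<le> x" "x \<le> t" "w' x = 0" by auto
        thus ?thesis using st by auto
      next
        case False
        from IVT2'[of w' s 0 t, OF _ _ _ cont] st False obtain x where "t \<le> x" "x \<le> s" "w' x = 0" by auto
        thus ?thesis using st by auto
      qed
      thus False using True by auto
    qed
    hence "integral {a..b} (\<lambda>t. \<bar>w' t\<bar>) \<le> \<bar>w b - w a\<bar>"
    proof (elim disjE)
      assume pos: "\<forall>t\<in>{a<..<b}. w' t > 0"
      have *: "\<bar>w' t\<bar> = w' t" if "a \<le> t" "t \<le> b" "t \<noteq> a" "t \<noteq> b" for t
        using pos[rule_format, of t] that by auto
      have "integral {a..b} (\<lambda>t. \<bar>w' t\<bar>) = integral {a..b} w'"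
        by (rule integral_spike[of "{a,b}"]) (use pos in \<open>auto simp: * abs_of_pos\<close>)
      thus ?thesis using integral_unique[OF ftc] by simp
    next
      assume neg: "\<forall>t\<in>{a<..<b}. w' t < 0"
      have *: "\<bar>w' t\<bar> = - w' t" if "a \<le> t" "t \<le> b" "t \<noteq> a" "t \<noteq> b" for t
        using neg[rule_format, of t] that by auto
      have "integral {a..b} (\<lambda>t. \<bar>w' t\<bar>) = integral {a..b} (\<lambda>t. - w' t)"
        by (rule integral_spike[of "{a,b}"]) (use neg in \<open>auto simp: * abs_of_neg\<close>)
      thus ?thesis using integral_unique[OF ftc] by simp
    qed
    also have "\<dots> \<le> 2 * B" using B[of a] B[of b] by linarith
    also have "\<dots> \<le> 2 * B * (n + 1)" using B0 by (simp add: algebra_simps)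
    finally show ?thesis .
  next
    case False
    then obtain z where z: "a < z" "z < b" "w' z = 0" by auto
    have un: "?Z a b = insert z (?Z a z \<union> ?Z z b)" using z by auto
    have f1: "finite (?Z a z)" by (rule finite_subset[OF _ less.prems(2)]) (use un in auto)
    have f2: "finite (?Z z b)" by (rule finite_subset[OF _ less.prems(2)]) (use un in auto)
    have "card (?Z a b) = Suc (card (?Z a z \<union> ?Z z b))"
      unfolding un by (rule card_insert_disjoint) (use f1 f2 in auto)
    also have "card (?Z a z \<union> ?Z z b) = card (?Z a z) + card (?Z z b)"
      by (rule card_Un_disjoint) (use f1 f2 in auto)
    finally have cd: "Suc (card (?Z a z) + card (?Z z b)) \<le> n" using less.prems(3) by simp
    have "integral {a..b} (\<lambda>t. \<bar>w' t\<bar>) = integral {a..z} (\<lambda>t. \<bar>w' t\<bar>) + integral {z..b} (\<lambda>t. \<bar>w' t\<bar>)"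
      by (rule Henstock_Kurzweil_Integration.integral_combine[symmetric])
        (use z cont in \<open>auto intro!: integrable_continuous_interval continuous_intros\<close>)
    also have "\<dots> \<le> 2 * B * (card (?Z a z) + 1) + 2 * B * (card (?Z z b) + 1)"
      by (intro add_mono less.IH) (use cd f1 f2 z in auto)
    also have "\<dots> = 2 * B * (real (card (?Z a z) + card (?Z z b) + 1) + 1)" by (simp add: algebra_simps)
    also have "\<dots> \<le> 2 * B * (real n + 1)"
      using cd B0 by (intro mult_left_mono add_right_mono) (auto simp del: of_nat_add of_nat_Suc)
    finally show ?thesis by (simp add: add.commute)
  qed
qed

lemma has_vector_derivative_cis_mult:
  "((\<lambda>\<theta>. cis (c * \<theta>)) has_vector_derivative c *\<^sub>R (\<i> * cis (c * x))) (at x)"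
  unfolding has_vector_derivative_complex_iff by (auto intro!: derivative_eq_intros)

lemma integral_cis_power:
  "((\<lambda>\<theta>. cis (of_int m * \<theta>)) has_integral (if m = 0 then of_real (2 * pi) else 0)) {0..2*pi}"
proof (cases "m = 0")
  case True
  thus ?thesis using has_integral_const_real[of "1::complex" 0 "2*pi"] by (simp add: scaleR_conv_of_real)
next
  case False
  let ?F = "\<lambda>\<theta>. cis (of_int m * \<theta>) / (\<i> * of_int m)"
  have "((\<lambda>\<theta>. cis (of_int m * \<theta>)) has_integral (?F (2*pi) - ?F 0)) {0..2*pi}"
  proof (rule fundamental_theorem_of_calculus)
    fix x :: real
    have "((\<lambda>\<theta>. cis (of_int m * \<theta>) * (1 / (\<i> * of_int m))) has_vector_derivative (of_int m *\<^sub>R (\<i> * cis (of_int m * x))) * (1 / (\<i> * of_int m))) (at x)"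
      by (intro has_vector_derivative_mult_left has_vector_derivative_cis_mult)
    thus "(?F has_vector_derivative cis (of_int m * x)) (at x within {0..2*pi})"
      using False by (auto simp: scaleR_conv_of_real intro: has_vector_derivative_at_within)
  qed simp
  moreover have "cis (of_int m * (2*pi)) = 1" by (metis cis_multiple_2pi Ints_of_int mult.commute)
  ultimately show ?thesis using False by simp
qed

text \<open>The frequencies \<open>k - d\<close> match the indexing of
  \<open>tpoly_complex_poly\<close>; the shift by d cancels when a term is multiplied by a conjugate
  one.\<close>

lemma parseval_cis:
  fixes c :: "nat \<Rightarrow> complex"
  assumes h: "\<And>\<theta>. complex_of_real (T \<theta>) = (\<Sum>k\<le>n. c k * cis (of_int (int k - int d) * \<theta>))"
  shows "((\<lambda>\<theta>. (T \<theta>)\<^sup>2) has_integral (2 * pi * (\<Sum>k\<le>n. (cmod (c k))\<^sup>2))) {0..2*pi}"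
proof -
  have e: "complex_of_real ((T \<theta>)\<^sup>2) = (\<Sum>k\<le>n. \<Sum>l\<le>n. (c k * cnj (c l)) * cis (of_int (int k - int l) * \<theta>))" for \<theta>
  proof -
    have "complex_of_real ((T \<theta>)\<^sup>2) = complex_of_real (T \<theta>) * cnj (complex_of_real (T \<theta>))" by (simp add: power2_eq_square)
    also have "\<dots> = (\<Sum>k\<le>n. \<Sum>l\<le>n. (c k * cis (of_int (int k - int d) * \<theta>)) * (cnj (c l) * cis (- (of_int (int l - int d) * \<theta>))))"
      unfolding h by (simp add: sum_product cis_cnj)
    also have "\<dots> = (\<Sum>k\<le>n. \<Sum>l\<le>n. (c k * cnj (c l)) * (cis (of_int (int k - int d) * \<theta>) * cis (- (of_int (int l - int d) * \<theta>))))"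
      by (simp only: mult_ac)
    finally show ?thesis by (simp add: cis_mult algebra_simps)
  qed
  have "((\<lambda>\<theta>. complex_of_real ((T \<theta>)\<^sup>2)) has_integral
     (\<Sum>k\<le>n. \<Sum>l\<le>n. (c k * cnj (c l)) * (if int k - int l = 0 then of_real (2 * pi) else 0))) {0..2*pi}"
    unfolding e by (intro has_integral_sum has_integral_mult_right integral_cis_power) auto
  also have "(\<Sum>k\<le>n. \<Sum>l\<le>n. (c k * cnj (c l)) * (if int k - int l = 0 then of_real (2 * pi) else 0))
     = (\<Sum>k\<le>n. \<Sum>l\<le>n. (if k = l then (c k * cnj (c l)) * of_real (2 * pi) else 0))"
    by (intro sum.cong refl) auto
  also have "\<dots> = of_real (2 * pi * (\<Sum>k\<le>n. (cmod (c k))\<^sup>2))"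
    by (simp add: complex_norm_square sum_distrib_left mult_ac del: of_real_power)
  finally have "((\<lambda>\<theta>. complex_of_real ((T \<theta>)\<^sup>2)) has_integral of_real (2 * pi * (\<Sum>k\<le>n. (cmod (c k))\<^sup>2))) {0..2*pi}" .
  from has_integral_linear[OF this bounded_linear_Re] show ?thesis by (simp only: o_def Re_complex_of_real)
qed

text \<open>Bernstein's inequality in L2: all frequencies lie between -d and d, so differentiation
  multiplies each Fourier coefficient by a factor of modulus at most d.\<close>

lemma tpoly_bernstein:
  assumes "tpoly d T" and "\<And>\<theta>. (T has_real_derivative T' \<theta>) (at \<theta>)"
  shows "\<exists>S. ((\<lambda>\<theta>. (T \<theta>)\<^sup>2) has_integral S) {0..2*pi} \<and> (\<exists>S'\<le>(real d)\<^sup>2 * S. ((\<lambda>\<theta>. (T' \<theta>)\<^sup>2) has_integral S') {0..2*pi})"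
proof -
  obtain q :: "complex poly" where q: "degree q \<le> 2 * d" "\<And>\<theta>. poly q (cis \<theta>) = cis \<theta> ^ d * of_real (T \<theta>)"
    using tpoly_complex_poly[OF assms(1)] by auto
  let ?c = "coeff q"
  have T: "complex_of_real (T \<theta>) = (\<Sum>k\<le>2*d. ?c k * cis (of_int (int k - int d) * \<theta>))" for \<theta>
  proof -
    have "complex_of_real (T \<theta>) = cis (- (real d * \<theta>)) * (cis \<theta> ^ d * of_real (T \<theta>))"
    proof -
      have "cis (- (real d * \<theta>)) * cis \<theta> ^ d = 1" unfolding Complex.DeMoivre cis_mult by simp
      thus ?thesis by (simp flip: mult.assoc)
    qed
    \<comment> \<open>The coefficients beyond \<open>degree q\<close> vanish, so the sum may run up
      to \<open>2 * d\<close>.\<close>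
    also have "\<dots> = cis (- (real d * \<theta>)) * (\<Sum>k\<le>2*d. ?c k * cis \<theta> ^ k)"
      unfolding q(2)[symmetric] poly_altdef by (intro arg_cong2[where f="(*)"] refl sum.mono_neutral_left) (use q(1) in \<open>auto simp: coeff_eq_0\<close>)
    also have "\<dots> = (\<Sum>k\<le>2*d. ?c k * (cis (real k * \<theta>) * cis (- (real d * \<theta>))))"
      unfolding Complex.DeMoivre sum_distrib_left by (simp only: mult_ac)
    finally show ?thesis by (simp add: cis_mult algebra_simps)
  qed
  let ?c' = "\<lambda>k. \<i> * of_int (int k - int d) * ?c k"
  have T': "complex_of_real (T' \<theta>) = (\<Sum>k\<le>2*d. ?c' k * cis (of_int (int k - int d) * \<theta>))" for \<theta>
  proof -
    have "((\<lambda>\<theta>. \<Sum>k\<le>2*d. ?c k * cis (of_int (int k - int d) * \<theta>)) has_vector_derivative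
        (\<Sum>k\<le>2*d. ?c k * (of_int (int k - int d) *\<^sub>R (\<i> * cis (of_int (int k - int d) * \<theta>))))) (at \<theta>)"
      by (intro has_vector_derivative_sum has_vector_derivative_mult_right has_vector_derivative_cis_mult)
    moreover have "((\<lambda>\<theta>. complex_of_real (T \<theta>)) has_vector_derivative complex_of_real (T' \<theta>)) (at \<theta>)"
      unfolding has_vector_derivative_complex_iff using assms(2)[of \<theta>] by simp
    ultimately have "complex_of_real (T' \<theta>) = (\<Sum>k\<le>2*d. ?c k * (of_int (int k - int d) *\<^sub>R (\<i> * cis (of_int (int k - int d) * \<theta>))))"
      unfolding T by (rule vector_derivative_unique_at[symmetric])
    thus ?thesis by (simp add: scaleR_conv_of_real mult_ac)
  qed
  have "(\<Sum>k\<le>2*d. (cmod (?c' k))\<^sup>2) \<le> (\<Sum>k\<le>2*d. (real d)\<^sup>2 * (cmod (?c k))\<^sup>2)"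
  proof (rule sum_mono)
    fix k assume k: "k \<in> {..2*d}"
    have "\<bar>of_int (int k - int d)\<bar> \<le> real d" using k by auto
    hence "(cmod (of_int (int k - int d)))\<^sup>2 \<le> (real d)\<^sup>2" by (simp add: abs_le_square_iff[symmetric] del: of_int_diff)
    thus "(cmod (?c' k))\<^sup>2 \<le> (real d)\<^sup>2 * (cmod (?c k))\<^sup>2"
      by (simp add: norm_mult power_mult_distrib mult_right_mono del: of_int_diff)
  qed
  hence "2 * pi * (\<Sum>k\<le>2*d. (cmod (?c' k))\<^sup>2) \<le> (real d)\<^sup>2 * (2 * pi * (\<Sum>k\<le>2*d. (cmod (?c k))\<^sup>2))"
    by (simp add: sum_distrib_left[symmetric] mult.left_commute[of _ "2*pi"])
  with parseval_cis[of T, OF T] parseval_cis[of T', OF T'] show ?thesis by blast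
qed

section \<open>Poincare inequality and hypercontractivity\<close>

lemma measurable_rot_pair[measurable]:
  assumes "finite I"
  shows "(\<lambda>(\<theta>, z). rot I \<theta> z) \<in> borel \<Otimes>\<^sub>M (PiM I (\<lambda>_. borel) \<Otimes>\<^sub>M PiM I (\<lambda>_. borel)) \<rightarrow>\<^sub>M PiM I (\<lambda>_. borel) \<Otimes>\<^sub>M PiM I (\<lambda>_. borel)"
  unfolding rot_def split_beta'
  by (intro measurable_Pair measurable_restrict) measurable

lemma distr_gauss2_fst: "distr (gauss2 I) (gauss I) fst = gauss I"
proof -
  interpret G: prob_space "gauss I" by (rule prob_space_gauss)
  interpret pair_prob_space "gauss I" "gauss I" ..
  show ?thesis
  proof (rule measure_eqI)
    fix A assume "A \<in> sets (distr (gauss2 I) (gauss I) fst)"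
    hence A: "A \<in> sets (gauss I)" by simp
    have "emeasure (distr (gauss2 I) (gauss I) fst) A = emeasure (gauss2 I) (fst -` A \<inter> space (gauss2 I))"
      by (rule emeasure_distr) (use A in \<open>simp_all add: gauss2_def\<close>)
    also have "fst -` A \<inter> space (gauss2 I) = A \<times> space (gauss I)"
      using sets.sets_into_space[OF A] by (auto simp: gauss2_def space_pair_measure)
    also have "emeasure (gauss2 I) \<dots> = emeasure (gauss I) A"
      unfolding gauss2_def using A sets.top[of "gauss I"] by (subst G.emeasure_pair_measure_Times) (auto simp: G.emeasure_space_1)
    finally show "emeasure (distr (gauss2 I) (gauss I) fst) A = emeasure (gauss I) A" .
  qed simp
qed

lemma nn_integral_rot:
  assumes I: "finite I" and h[measurable]: "h \<in> borel_measurable (PiM I (\<lambda>_. borel) \<Otimes>\<^sub>M PiM I (\<lambda>_. borel))"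
  shows "(\<integral>\<^sup>+ z. h (rot I \<theta> z) \<partial>gauss2 I) = (\<integral>\<^sup>+ z. h z \<partial>gauss2 I)"
proof -
  have "(\<integral>\<^sup>+ z. h z \<partial>gauss2 I) = (\<integral>\<^sup>+ z. h z \<partial>distr (gauss2 I) (gauss2 I) (rot I \<theta>))"
    by (simp add: distr_rot[OF I])
  also have "\<dots> = (\<integral>\<^sup>+ z. h (rot I \<theta> z) \<partial>gauss2 I)"
    by (rule nn_integral_distr) (use measurable_rot[OF I] in \<open>auto simp: h\<close>)
  finally show ?thesis ..
qed

lemma nn_integral_gauss2_fst:
  assumes h[measurable]: "h \<in> borel_measurable (PiM I (\<lambda>_. borel))"
  shows "(\<integral>\<^sup>+ z. h (fst z) \<partial>gauss2 I) = (\<integral>\<^sup>+ x. h x \<partial>gauss I)"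
proof -
  have "(\<integral>\<^sup>+ x. h x \<partial>gauss I) = (\<integral>\<^sup>+ x. h x \<partial>distr (gauss2 I) (gauss I) fst)"
    by (simp add: distr_gauss2_fst)
  also have "\<dots> = (\<integral>\<^sup>+ z. h (fst z) \<partial>gauss2 I)"
    by (rule nn_integral_distr) auto
  finally show ?thesis ..
qed

text \<open>Fubini's theorem and rotation invariance. An estimate along every single curve,
  integrated over the angle, thus becomes an estimate of expectations with the same
  constants.\<close>

lemma nn_integral_rot_average:
  assumes I: "finite I" and h[measurable]: "h \<in> borel_measurable (PiM I (\<lambda>_. borel) \<Otimes>\<^sub>M PiM I (\<lambda>_. borel))"
    and S[measurable]: "S \<in> sets borel"
  shows "(\<integral>\<^sup>+ z. (\<integral>\<^sup>+ \<theta>. h (rot I \<theta> z) * indicator S \<theta> \<partial>lborel) \<partial>gauss2 I) = emeasure lborel S * (\<integral>\<^sup>+ z. h z \<partial>gauss2 I)"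
proof -
  interpret G: prob_space "gauss2 I" by (rule prob_space_gauss2)
  interpret pair_sigma_finite lborel "gauss2 I" ..
  have [measurable]: "(\<lambda>(\<theta>, z). rot I \<theta> z) \<in> borel \<Otimes>\<^sub>M gauss2 I \<rightarrow>\<^sub>M PiM I (\<lambda>_. borel) \<Otimes>\<^sub>M PiM I (\<lambda>_. borel)"
    using measurable_rot_pair[OF I] by (subst measurable_cong_sets[OF sets_pair_measure_cong[OF refl sets_gauss2] refl])
  have m: "(\<lambda>(\<theta>, z). h (rot I \<theta> z) * indicator S \<theta>) \<in> borel_measurable (lborel \<Otimes>\<^sub>M gauss2 I)"
    by measurable
  have "(\<integral>\<^sup>+ z. (\<integral>\<^sup>+ \<theta>. h (rot I \<theta> z) * indicator S \<theta> \<partial>lborel) \<partial>gauss2 I) = (\<integral>\<^sup>+ \<theta>. (\<integral>\<^sup>+ z. h (rot I \<theta> z) * indicator S \<theta> \<partial>gauss2 I) \<partial>lborel)"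
    by (rule Fubini'[OF m])
  also have "\<dots> = (\<integral>\<^sup>+ \<theta>. (\<integral>\<^sup>+ z. h z \<partial>gauss2 I) * indicator S \<theta> \<partial>lborel)"
  proof (rule nn_integral_cong)
    fix \<theta>
    have "(\<lambda>z. h (rot I \<theta> z)) \<in> borel_measurable (gauss2 I)" using measurable_rot[OF I, of \<theta>] by simp
    thus "(\<integral>\<^sup>+ z. h (rot I \<theta> z) * indicator S \<theta> \<partial>gauss2 I) = (\<integral>\<^sup>+ z. h z \<partial>gauss2 I) * indicator S \<theta>"
      by (simp add: nn_integral_multc nn_integral_rot[OF I h])
  qed
  also have "\<dots> = emeasure lborel S * (\<integral>\<^sup>+ z. h z \<partial>gauss2 I)"
    by (subst nn_integral_cmult_indicator) (auto simp: mult.commute)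
  finally show ?thesis .
qed

lemma measurable_rot_average:
  assumes I: "finite I" and h[measurable]: "h \<in> borel_measurable (PiM I (\<lambda>_. borel) \<Otimes>\<^sub>M PiM I (\<lambda>_. borel))"
    and S[measurable]: "S \<in> sets borel"
  shows "(\<lambda>z. \<integral>\<^sup>+ \<theta>. h (rot I \<theta> z) * indicator S \<theta> \<partial>lborel) \<in> borel_measurable (gauss2 I)"
proof -
  have rm[measurable]: "(\<lambda>(\<theta>, z). rot I \<theta> z) \<in> borel \<Otimes>\<^sub>M gauss2 I \<rightarrow>\<^sub>M PiM I (\<lambda>_. borel) \<Otimes>\<^sub>M PiM I (\<lambda>_. borel)"
    using measurable_rot_pair[OF I] by (subst measurable_cong_sets[OF sets_pair_measure_cong[OF refl sets_gauss2] refl])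
  have [measurable]: "(\<lambda>p. rot I (snd p) (fst p)) \<in> gauss2 I \<Otimes>\<^sub>M borel \<rightarrow>\<^sub>M PiM I (\<lambda>_. borel) \<Otimes>\<^sub>M PiM I (\<lambda>_. borel)"
    using measurable_compose[OF measurable_pair_swap'[of "gauss2 I" borel] rm] by (simp add: split_beta')
  have "(\<lambda>(z, \<theta>). h (rot I \<theta> z) * indicator S \<theta>) \<in> borel_measurable (gauss2 I \<Otimes>\<^sub>M lborel)"
    unfolding split_beta' by measurable
  thus ?thesis by (rule lborel.borel_measurable_nn_integral)
qed

section \<open>Gaussian polynomials along a rotation\<close>

definition dir_deriv :: "'i set \<Rightarrow> ('i \<Rightarrow> ('i \<Rightarrow> real) \<Rightarrow> real) \<Rightarrow> ('i \<Rightarrow> real) \<times> ('i \<Rightarrow> real) \<Rightarrow> real" where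
  "dir_deriv I D z = (\<Sum>i\<in>I. D i (fst z) * snd z i)"

lemma dir_deriv_measurable:
  assumes "\<And>i. i \<in> I \<Longrightarrow> D i \<in> borel_measurable (PiM I (\<lambda>_. borel))"
  shows "dir_deriv I D \<in> borel_measurable (PiM I (\<lambda>_. borel) \<Otimes>\<^sub>M PiM I (\<lambda>_. borel))"
  unfolding dir_deriv_def[abs_def]
proof (intro borel_measurable_sum borel_measurable_times)
  fix i assume i: "i \<in> I"
  show "(\<lambda>z. D i (fst z)) \<in> borel_measurable (PiM I (\<lambda>_. borel) \<Otimes>\<^sub>M PiM I (\<lambda>_. borel))"
    by (rule measurable_compose[OF measurable_fst assms[OF i]])
  show "(\<lambda>z. snd z i) \<in> borel_measurable (PiM I (\<lambda>_. borel) \<Otimes>\<^sub>M PiM I (\<lambda>_. borel))"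
    by (rule measurable_compose[OF measurable_snd measurable_component_singleton[OF i]])
qed

text \<open>The second component of \<open>rot I \<theta> z\<close> is the derivative of the first
  in \<open>\<theta>\<close>.\<close>

lemma rot_deriv:
  assumes "has_grad I f D"
  shows "((\<lambda>\<theta>. f (fst (rot I \<theta> z))) has_real_derivative dir_deriv I D (rot I \<theta> z)) (at \<theta>)"
  unfolding dir_deriv_def
proof -
  have "\<forall>i\<in>I. ((\<lambda>s. fst (rot I s z) i) has_real_derivative snd (rot I \<theta> z) i) (at \<theta>)"
    by (auto simp: rot_def intro!: derivative_eq_intros)
  from assms[unfolded has_grad_def, rule_format, of "\<lambda>s. fst (rot I s z)", OF this[rule_format]]
  show "((\<lambda>\<theta>. f (fst (rot I \<theta> z))) has_real_derivative (\<Sum>i\<in>I. D i (fst (rot I \<theta> z)) * snd (rot I \<theta> z) i)) (at \<theta>)" .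
qed

text \<open>The constructors of \<open>tpoly\<close> mirror those of \<open>gpoly\<close>: a
  coordinate of the rotated vector is a combination of cos and sin.\<close>

lemma rot_tpoly:
  assumes "gpoly I d f"
  shows "tpoly d (\<lambda>\<theta>. f (fst (rot I \<theta> z)))"
  using assms
proof (induction rule: gpoly.induct)
  case (var d f i)
  have "tpoly (Suc d) (\<lambda>\<theta>. fst z i * (cos \<theta> * f (fst (rot I \<theta> z))) + snd z i * (sin \<theta> * f (fst (rot I \<theta> z))))"
    by (intro tpoly.add tpoly_cmult tpoly.cos tpoly.sin var)
  moreover have "fst (rot I \<theta> z) i = cos \<theta> * fst z i + sin \<theta> * snd z i" for \<theta>
    using var(2) by (simp add: rot_def)
  ultimately show ?case by (simp add: algebra_simps)
qed (auto intro: tpoly.intros)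

lemma rot_tpoly_deriv:
  assumes "gpoly I d f" "has_grad I f D"
  shows "tpoly d (\<lambda>\<theta>. dir_deriv I D (rot I \<theta> z))"
proof -
  obtain T' where T': "tpoly d T'" "\<And>\<theta>. ((\<lambda>\<theta>. f (fst (rot I \<theta> z))) has_real_derivative T' \<theta>) (at \<theta>)"
    using tpoly_deriv[OF rot_tpoly[OF assms(1)]] by blast
  have "T' = (\<lambda>\<theta>. dir_deriv I D (rot I \<theta> z))"
    using DERIV_unique[OF T'(2) rot_deriv[OF assms(2)]] by auto
  thus ?thesis using T' by simp
qed

lemma tpoly_continuous: "tpoly d T \<Longrightarrow> continuous_on S T"
  by (induction rule: tpoly.induct) (auto intro!: continuous_intros)

text \<open>Given the first vector x, \<open>dir_deriv\<close> is a linear form in the independent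
  second vector, hence Gaussian with the norm of the gradient at x as standard deviation.\<close>

lemma nn_integral_dir_deriv:
  assumes I: "finite I" and D: "\<And>i. i \<in> I \<Longrightarrow> D i \<in> borel_measurable (PiM I (\<lambda>_. borel))" and h[measurable]: "h \<in> borel_measurable borel"
  shows "(\<integral>\<^sup>+ z. h (dir_deriv I D z) \<partial>gauss2 I) = (\<integral>\<^sup>+ x. (\<integral>\<^sup>+ g. h (sqrt (\<Sum>i\<in>I. (D i x)\<^sup>2) * g) \<partial>std_normal_distribution) \<partial>gauss I)"
proof -
  interpret G: prob_space "gauss I" by (rule prob_space_gauss)
  interpret pair_sigma_finite "gauss I" "gauss I" ..
  have "dir_deriv I D \<in> borel_measurable (gauss I \<Otimes>\<^sub>M gauss I)"
    using dir_deriv_measurable[OF D] measurable_gauss2_1[unfolded gauss2_def] by auto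
  hence "(\<lambda>z. h (dir_deriv I D z)) \<in> borel_measurable (gauss I \<Otimes>\<^sub>M gauss I)" by measurable
  from G.nn_integral_fst[OF this, symmetric]
  have "(\<integral>\<^sup>+ z. h (dir_deriv I D z) \<partial>gauss2 I) = (\<integral>\<^sup>+ x. \<integral>\<^sup>+ y. h (dir_deriv I D (x, y)) \<partial>gauss I \<partial>gauss I)"
    unfolding gauss2_def .
  also have "\<dots> = (\<integral>\<^sup>+ x. (\<integral>\<^sup>+ g. h (sqrt (\<Sum>i\<in>I. (D i x)\<^sup>2) * g) \<partial>std_normal_distribution) \<partial>gauss I)"
    unfolding dir_deriv_def by (simp add: nn_integral_gauss_linear[OF I h])
  finally show ?thesis .
qed

lemma nn_integral_dir_deriv_sq:
  assumes I: "finite I" and D: "\<And>i. i \<in> I \<Longrightarrow> gpoly I d (D i)"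
  shows "(\<integral>\<^sup>+ z. ennreal ((dir_deriv I D z)\<^sup>2) \<partial>gauss2 I) = ennreal (\<integral>x. (\<Sum>i\<in>I. (D i x)\<^sup>2) \<partial>gauss I)"
proof -
  have D': "\<And>i. i \<in> I \<Longrightarrow> D i \<in> borel_measurable (PiM I (\<lambda>_. borel))"
    using gpoly_measurable[OF D] by auto
  have m2: "(\<integral>\<^sup>+ g. ennreal (g\<^sup>2) \<partial>std_normal_distribution) = 1"
    using std_normal_distribution_even_moments[of 1] by (subst nn_integral_eq_integral) auto
  have "(\<integral>\<^sup>+ z. ennreal ((dir_deriv I D z)\<^sup>2) \<partial>gauss2 I) = (\<integral>\<^sup>+ x. (\<integral>\<^sup>+ g. ennreal ((sqrt (\<Sum>i\<in>I. (D i x)\<^sup>2) * g)\<^sup>2) \<partial>std_normal_distribution) \<partial>gauss I)"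
    by (rule nn_integral_dir_deriv[OF I D']) auto
  also have "\<dots> = (\<integral>\<^sup>+ x. ennreal (\<Sum>i\<in>I. (D i x)\<^sup>2) \<partial>gauss I)"
  proof (rule nn_integral_cong)
    fix x
    have "(\<integral>\<^sup>+ g. ennreal ((sqrt (\<Sum>i\<in>I. (D i x)\<^sup>2) * g)\<^sup>2) \<partial>std_normal_distribution) =
       (\<integral>\<^sup>+ g. ennreal (\<Sum>i\<in>I. (D i x)\<^sup>2) * ennreal (g\<^sup>2) \<partial>std_normal_distribution)"
      by (simp add: power_mult_distrib sum_nonneg ennreal_mult)
    also have "\<dots> = ennreal (\<Sum>i\<in>I. (D i x)\<^sup>2)" by (subst nn_integral_cmult) (auto simp: m2)
    finally show "(\<integral>\<^sup>+ g. ennreal ((sqrt (\<Sum>i\<in>I. (D i x)\<^sup>2) * g)\<^sup>2) \<partial>std_normal_distribution) = ennreal (\<Sum>i\<in>I. (D i x)\<^sup>2)" .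
  qed
  also have "\<dots> = ennreal (\<integral>x. (\<Sum>i\<in>I. (D i x)\<^sup>2) \<partial>gauss I)"
    by (rule nn_integral_eq_integral)
       (use gpoly_integrable_even[OF I D, of _ 1] in \<open>auto intro!: sum_nonneg\<close>)
  finally show ?thesis .
qed

lemma nn_integral_indicator_continuous:
  fixes g :: "real \<Rightarrow> real"
  assumes "continuous_on {a..b} g" "\<And>\<theta>. 0 \<le> g \<theta>"
  shows "(\<integral>\<^sup>+ \<theta>. ennreal (g \<theta>) * indicator {a..b} \<theta> \<partial>lborel) = ennreal (integral {a..b} g)"
proof -
  have "(\<integral>\<^sup>+ \<theta>. ennreal (g \<theta>) * indicator {a..b} \<theta> \<partial>lborel) = (\<integral>\<^sup>+ \<theta>. ennreal (indicator {a..b} \<theta> *\<^sub>R g \<theta>) \<partial>lborel)"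
    by (rule nn_integral_cong) (auto simp: indicator_def)
  also have "\<dots> = ennreal (LBINT \<theta>:{a..b}. g \<theta>)"
    unfolding set_lebesgue_integral_def
    by (rule nn_integral_eq_integral)
      (use borel_integrable_atLeastAtMost'[OF assms(1)] assms(2) in \<open>auto simp: set_integrable_def indicator_def\<close>)
  also have "(LBINT \<theta>:{a..b}. g \<theta>) = integral {a..b} g"
    by (rule set_borel_integral_eq_integral(2)[OF borel_integrable_atLeastAtMost'[OF assms(1)]])
  finally show ?thesis .
qed

text \<open>The squared deviation of g from its mean value over the interval has a nonnegative
  integral.\<close>

lemma integral_square_le:
  fixes g :: "real \<Rightarrow> real"
  assumes "0 < a" "continuous_on {0..a} g"
  shows "(integral {0..a} g)\<^sup>2 \<le> a * integral {0..a} (\<lambda>t. (g t)\<^sup>2)"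
proof -
  let ?m = "integral {0..a} g / a"
  have i: "g integrable_on {0..a}" "(\<lambda>t. (g t)\<^sup>2) integrable_on {0..a}"
    by (auto intro!: integrable_continuous_interval continuous_intros assms)
  have "0 \<le> integral {0..a} (\<lambda>t. (g t - ?m)\<^sup>2)"
    by (rule integral_nonneg) (auto intro!: integrable_continuous_interval continuous_intros assms)
  also have "\<dots> = integral {0..a} (\<lambda>t. ((g t)\<^sup>2 - 2 * ?m * g t) + ?m\<^sup>2)"
    by (rule integral_cong) (simp add: power2_diff algebra_simps)
  also have "\<dots> = integral {0..a} (\<lambda>t. (g t)\<^sup>2) - 2 * ?m * integral {0..a} g + a * ?m\<^sup>2"
    using i assms(1) by (subst integral_add integral_diff integral_mult_right, (auto intro!: integrable_diff integrable_on_mult_right)[2])+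
       simp
  also have "\<dots> = integral {0..a} (\<lambda>t. (g t)\<^sup>2) - (integral {0..a} g)\<^sup>2 / a"
    using assms(1) by (simp add: field_simps power2_eq_square)
  finally show ?thesis using assms(1) by (simp add: field_simps)
qed

text \<open>\<open>tpoly_bernstein\<close> averaged over all curves. The Gaussian direction turns
  the squared directional derivative into the squared norm of the gradient, and the length of the
  period cancels.\<close>

lemma gauss_bernstein:
  assumes I: "finite I" and f: "gpoly I d f" and D: "has_grad I f D" "\<And>i. i \<in> I \<Longrightarrow> gpoly I (d - 1) (D i)"
  shows "(\<integral>x. (\<Sum>i\<in>I. (D i x)\<^sup>2) \<partial>gauss I) \<le> (real d)\<^sup>2 * (\<integral>x. (f x)\<^sup>2 \<partial>gauss I)"
proof -
  note [measurable] = gpoly_measurable[OF f] 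
  have D': "\<And>i. i \<in> I \<Longrightarrow> D i \<in> borel_measurable (PiM I (\<lambda>_. borel))"
    using gpoly_measurable[OF D(2)] by auto
  note [measurable] = dir_deriv_measurable[OF D']
  have f2: "(\<integral>\<^sup>+ x. ennreal ((f x)\<^sup>2) \<partial>gauss I) = ennreal (\<integral>x. (f x)\<^sup>2 \<partial>gauss I)"
    by (rule nn_integral_eq_integral) (use gpoly_integrable_even[OF I f, of 1] in auto)
  let ?S = "{0..2*pi}"
  have "ennreal (2*pi) * ennreal (\<integral>x. (\<Sum>i\<in>I. (D i x)\<^sup>2) \<partial>gauss I) = emeasure lborel ?S * (\<integral>\<^sup>+ z. ennreal ((dir_deriv I D z)\<^sup>2) \<partial>gauss2 I)"
    by (simp add: nn_integral_dir_deriv_sq[OF I D(2)])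
  also have "\<dots> = (\<integral>\<^sup>+ z. (\<integral>\<^sup>+ \<theta>. ennreal ((dir_deriv I D (rot I \<theta> z))\<^sup>2) * indicator ?S \<theta> \<partial>lborel) \<partial>gauss2 I)"
    by (rule nn_integral_rot_average[OF I, symmetric]) measurable
  also have "\<dots> \<le> (\<integral>\<^sup>+ z. (ennreal ((real d)\<^sup>2) * (\<integral>\<^sup>+ \<theta>. ennreal ((f (fst (rot I \<theta> z)))\<^sup>2) * indicator ?S \<theta> \<partial>lborel)) \<partial>gauss2 I)"
  proof (rule nn_integral_mono)
    fix z
    note c = tpoly_continuous[OF rot_tpoly[OF f, of z]] tpoly_continuous[OF rot_tpoly_deriv[OF f D(1), of z]]
    obtain S S' where S: "((\<lambda>\<theta>. (f (fst (rot I \<theta> z)))\<^sup>2) has_integral S) ?S" "S' \<le> (real d)\<^sup>2 * S" "((\<lambda>\<theta>. (dir_deriv I D (rot I \<theta> z))\<^sup>2) has_integral S') ?S"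
      using tpoly_bernstein[OF rot_tpoly[OF f] rot_deriv[OF D(1)]] by blast
    have "(\<integral>\<^sup>+ \<theta>. ennreal ((dir_deriv I D (rot I \<theta> z))\<^sup>2) * indicator ?S \<theta> \<partial>lborel) = ennreal S'"
      by (subst nn_integral_indicator_continuous[OF continuous_on_power[OF c(2)]]) (auto simp: integral_unique[OF S(3)])
    moreover have "(\<integral>\<^sup>+ \<theta>. ennreal ((f (fst (rot I \<theta> z)))\<^sup>2) * indicator ?S \<theta> \<partial>lborel) = ennreal S"
      by (subst nn_integral_indicator_continuous[OF continuous_on_power[OF c(1)]]) (auto simp: integral_unique[OF S(1)])
    ultimately show "(\<integral>\<^sup>+ \<theta>. ennreal ((dir_deriv I D (rot I \<theta> z))\<^sup>2) * indicator ?S \<theta> \<partial>lborel) \<le> ennreal ((real d)\<^sup>2) * (\<integral>\<^sup>+ \<theta>. ennreal ((f (fst (rot I \<theta> z)))\<^sup>2) * indicator ?S \<theta> \<partial>lborel)"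
      using S(2) by (simp add: ennreal_mult'[symmetric] ennreal_leI)
  qed
  also have "\<dots> = ennreal ((real d)\<^sup>2) * (\<integral>\<^sup>+ z. (\<integral>\<^sup>+ \<theta>. ennreal ((f (fst (rot I \<theta> z)))\<^sup>2) * indicator ?S \<theta> \<partial>lborel) \<partial>gauss2 I)"
    by (rule nn_integral_cmult, rule measurable_rot_average[OF I]) measurable
  also have "(\<integral>\<^sup>+ z. (\<integral>\<^sup>+ \<theta>. ennreal ((f (fst (rot I \<theta> z)))\<^sup>2) * indicator ?S \<theta> \<partial>lborel) \<partial>gauss2 I) = emeasure lborel ?S * (\<integral>\<^sup>+ z. ennreal ((f (fst z))\<^sup>2) \<partial>gauss2 I)"
    by (rule nn_integral_rot_average[OF I]) measurable
  also have "\<dots> = ennreal (2 * pi) * ennreal (\<integral>x. (f x)\<^sup>2 \<partial>gauss I)"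
    using nn_integral_gauss2_fst[of "\<lambda>x. ennreal ((f x)\<^sup>2)" I] by (simp add: f2)
  finally have "2 * pi * (\<integral>x. (\<Sum>i\<in>I. (D i x)\<^sup>2) \<partial>gauss I) \<le> 2 * pi * ((real d)\<^sup>2 * (\<integral>x. (f x)\<^sup>2 \<partial>gauss I))"
    by (simp add: ennreal_mult'[symmetric] mult.left_commute)
  thus ?thesis by simp
qed

text \<open>Twice the variance is the mean square of \<open>f x - f y\<close> for independent x and
  y, and the rotation by pi/2 leads from one to the other. Cauchy-Schwarz on the curve and the
  average over the angle give a factor pi/2 each; the constant 2 is pi^2/8 rounded up.\<close>

lemma gauss_poincare:
  assumes I: "finite I" and f: "gpoly I d f" and D: "has_grad I f D" "\<And>i. i \<in> I \<Longrightarrow> gpoly I e (D i)"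
  shows "(\<integral>x. (f x)\<^sup>2 \<partial>gauss I) - (\<integral>x. f x \<partial>gauss I)\<^sup>2 \<le> 2 * (\<integral>x. (\<Sum>i\<in>I. (D i x)\<^sup>2) \<partial>gauss I)"
proof -
  interpret G: prob_space "gauss I" by (rule prob_space_gauss)
  interpret G2: pair_prob_space "gauss I" "gauss I" ..
  note [measurable] = gpoly_measurable[OF f] 
  have D': "\<And>i. i \<in> I \<Longrightarrow> D i \<in> borel_measurable (PiM I (\<lambda>_. borel))"
    using gpoly_measurable[OF D(2)] by auto
  note [measurable] = dir_deriv_measurable[OF D']
  let ?S = "{0..pi/2}" and ?m = "\<integral>x. f x \<partial>gauss I" and ?E = "\<integral>x. (\<Sum>i\<in>I. (D i x)\<^sup>2) \<partial>gauss I"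
  have i1: "integrable (gauss I) f" by (rule gpoly_integrable[OF I f])
  have i2: "integrable (gauss I) (\<lambda>x. (f x)\<^sup>2)" using gpoly_integrable_even[OF I f, of 1] by simp
  have inner: "(\<integral>\<^sup>+ y. ennreal ((f x - f y)\<^sup>2) \<partial>gauss I) = ennreal ((f x)\<^sup>2 - 2 * f x * ?m + (\<integral>y. (f y)\<^sup>2 \<partial>gauss I))" for x
  proof -
    have e: "(\<lambda>y. (f x - f y)\<^sup>2) = (\<lambda>y. (f x)\<^sup>2 - 2 * f x * f y + (f y)\<^sup>2)" by (simp add: power2_diff algebra_simps)
    have "(\<integral>\<^sup>+ y. ennreal ((f x - f y)\<^sup>2) \<partial>gauss I) = ennreal (\<integral>y. (f x - f y)\<^sup>2 \<partial>gauss I)"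
      by (rule nn_integral_eq_integral) (use i1 i2 in \<open>auto simp: e\<close>)
    thus ?thesis unfolding e using i1 i2 by (simp add: G.prob_space)
  qed
  have nn: "0 \<le> (f x)\<^sup>2 - 2 * f x * ?m + (\<integral>y. (f y)\<^sup>2 \<partial>gauss I)" for x
  proof -
    have "0 \<le> (\<integral>y. (f x)\<^sup>2 - 2 * f x * f y + (f y)\<^sup>2 \<partial>gauss I)"
    proof (rule integral_nonneg_AE, rule AE_I2)
      fix y
      have "(f x)\<^sup>2 - 2 * f x * f y + (f y)\<^sup>2 = (f x - f y)\<^sup>2" by (simp add: power2_diff algebra_simps)
      thus "0 \<le> (f x)\<^sup>2 - 2 * f x * f y + (f y)\<^sup>2" by simp
    qed
    thus ?thesis using i1 i2 by (simp add: G.prob_space)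
  qed
  have "ennreal (2 * ((\<integral>x. (f x)\<^sup>2 \<partial>gauss I) - ?m\<^sup>2)) = ennreal (\<integral>x. (f x)\<^sup>2 - 2 * f x * ?m + (\<integral>y. (f y)\<^sup>2 \<partial>gauss I) \<partial>gauss I)"
    using i1 i2 by (simp add: G.prob_space power2_eq_square mult.assoc)
  also have "\<dots> = (\<integral>\<^sup>+ x. (\<integral>\<^sup>+ y. ennreal ((f x - f y)\<^sup>2) \<partial>gauss I) \<partial>gauss I)"
    unfolding inner by (rule nn_integral_eq_integral[symmetric]) (use i1 i2 nn in auto)
  also have "\<dots> = (\<integral>\<^sup>+ z. ennreal ((f (fst z) - f (snd z))\<^sup>2) \<partial>gauss2 I)"
    unfolding gauss2_def by (subst G.nn_integral_fst[symmetric]) (simp_all flip: gauss2_def)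
  also have "\<dots> \<le> (\<integral>\<^sup>+ z. (\<integral>\<^sup>+ \<theta>. (ennreal (pi/2) * ennreal ((dir_deriv I D (rot I \<theta> z))\<^sup>2)) * indicator ?S \<theta> \<partial>lborel) \<partial>gauss2 I)"
  proof (rule nn_integral_mono)
    fix z assume z: "z \<in> space (gauss2 I)"
    note c = tpoly_continuous[OF rot_tpoly_deriv[OF f D(1), of z]]
    have "((\<lambda>\<theta>. dir_deriv I D (rot I \<theta> z)) has_integral (f (fst (rot I (pi/2) z)) - f (fst (rot I 0 z)))) ?S"
      by (rule fundamental_theorem_of_calculus)
         (auto simp: has_real_derivative_iff_has_vector_derivative[symmetric] intro: has_field_derivative_at_within rot_deriv[OF D(1)])
    moreover have "fst (rot I (pi/2) z) = snd z" "fst (rot I 0 z) = fst z"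
      using z by (auto simp: rot_def space_gauss2 PiE_restrict)
    ultimately have "(f (fst z) - f (snd z))\<^sup>2 = (integral ?S (\<lambda>\<theta>. dir_deriv I D (rot I \<theta> z)))\<^sup>2"
      by (simp add: integral_unique power2_commute)
    also have "\<dots> \<le> pi/2 * integral ?S (\<lambda>\<theta>. (dir_deriv I D (rot I \<theta> z))\<^sup>2)"
      by (rule integral_square_le) (use c in auto)
    also have "\<dots> = integral ?S (\<lambda>\<theta>. pi/2 * (dir_deriv I D (rot I \<theta> z))\<^sup>2)" by simp
    finally have "ennreal ((f (fst z) - f (snd z))\<^sup>2) \<le> ennreal (integral ?S (\<lambda>\<theta>. pi/2 * (dir_deriv I D (rot I \<theta> z))\<^sup>2))"
      by (rule ennreal_leI)
    also have "\<dots> = (\<integral>\<^sup>+ \<theta>. ennreal (pi/2 * (dir_deriv I D (rot I \<theta> z))\<^sup>2) * indicator ?S \<theta> \<partial>lborel)"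
      by (rule nn_integral_indicator_continuous[symmetric]) (use c in \<open>auto intro!: continuous_intros\<close>)
    also have "\<dots> = (\<integral>\<^sup>+ \<theta>. (ennreal (pi/2) * ennreal ((dir_deriv I D (rot I \<theta> z))\<^sup>2)) * indicator ?S \<theta> \<partial>lborel)"
      by (subst ennreal_mult) auto
    finally show "ennreal ((f (fst z) - f (snd z))\<^sup>2) \<le> \<dots>" .
  qed
  also have "\<dots> = emeasure lborel ?S * (\<integral>\<^sup>+ z. ennreal (pi/2) * ennreal ((dir_deriv I D z)\<^sup>2) \<partial>gauss2 I)"
    by (rule nn_integral_rot_average[OF I]) measurable
  also have "(\<integral>\<^sup>+ z. ennreal (pi/2) * ennreal ((dir_deriv I D z)\<^sup>2) \<partial>gauss2 I) = ennreal (pi/2) * ennreal ?E"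
    by (subst nn_integral_cmult) (auto simp: nn_integral_dir_deriv_sq[OF I D(2)])
  also have "emeasure lborel ?S * \<dots> = ennreal (pi/2 * (pi/2 * ?E))"
    by (simp add: ennreal_mult'[symmetric])
  finally have "2 * ((\<integral>x. (f x)\<^sup>2 \<partial>gauss I) - ?m\<^sup>2) \<le> pi/2 * (pi/2 * ?E)"
    by (subst (asm) ennreal_le_iff) (auto intro!: integral_nonneg_AE sum_nonneg mult_nonneg_nonneg)
  also have "\<dots> \<le> 2 * (2 * ?E)"
    using pi_less_4 by (intro mult_mono mult_nonneg_nonneg integral_nonneg_AE) (auto intro!: sum_nonneg)
  finally show ?thesis by simp
qed

section \<open>Hypercontractivity\<close>

lemma gauss_square_zero:
  assumes I: "finite I" and f: "gpoly I d f" and "(\<integral>x. (f x)\<^sup>2 \<partial>gauss I) = 0"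
  shows "AE x in gauss I. f x = 0"
proof -
  note [measurable] = gpoly_measurable[OF f]
  have "AE x in gauss I. (f x)\<^sup>2 = 0"
    using integral_nonneg_eq_0_iff_AE[of "gauss I" "\<lambda>x. (f x)\<^sup>2"] gpoly_integrable_even[OF I f, of 1] assms(3) by simp
  thus ?thesis by simp
qed

lemma gauss_normalize:
  assumes I: "finite I" and f: "gpoly I d f" and S: "(\<integral>x. (f x)\<^sup>2 \<partial>gauss I) = S" "S > 0"
  shows "gpoly I d (\<lambda>x. (1 / sqrt S) * f x)" "(\<integral>x. ((1 / sqrt S) * f x)\<^sup>2 \<partial>gauss I) = 1"
proof -
  show "gpoly I d (\<lambda>x. (1 / sqrt S) * f x)" by (rule gpoly_cmult[OF f])
  have "(\<integral>x. ((1 / sqrt S) * f x)\<^sup>2 \<partial>gauss I) = (\<integral>x. (1 / S) * (f x)\<^sup>2 \<partial>gauss I)"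
    using S(2) by (intro Bochner_Integration.integral_cong) (auto simp: power_divide)
  also have "\<dots> = 1" using S by simp
  finally show "(\<integral>x. ((1 / sqrt S) * f x)\<^sup>2 \<partial>gauss I) = 1" .
qed

text \<open>Comparing \<open>l * b\<close> with a decides which term on the right dominates. The
  parameter l makes the coefficient of \<open>a ^ q\<close> small enough to be absorbed
  later.\<close>

lemma power_young:
  fixes a b l :: real
  assumes "0 \<le> a" "0 \<le> b" "0 < l" "0 < q"
  shows "a ^ (q - 1) * b \<le> a ^ q / l + l ^ (q - 1) * b ^ q"
proof -
  obtain r where q: "q = Suc r" using assms(4) by (cases q) auto
  show ?thesis
  proof (cases "l * b \<le> a")
    case True
    hence "b \<le> a / l" using assms by (simp add: field_simps)
    hence "a ^ r * b \<le> a ^ r * (a / l)" using assms by (intro mult_left_mono) auto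
    moreover have "0 \<le> l ^ r * b ^ Suc r" using assms by simp
    ultimately show ?thesis unfolding q by (simp add: mult_ac)
  next
    case False
    hence "a ^ r * b \<le> (l * b) ^ r * b" using assms by (intro mult_right_mono power_mono) auto
    moreover have "0 \<le> a ^ Suc r / l" using assms by simp
    ultimately show ?thesis unfolding q by (simp add: power_mult_distrib mult_ac)
  qed
qed

text \<open>The inductions are nested. Poincare's inequality for \<open>f ^ q\<close>, with q a
  power of 2, bounds the moment of order 2q by the square of the moment of order q, known from the
  induction on j, and by the means of \<open>f ^ (2 * (q - 1))\<close> times the squared partial
  derivatives. Young's inequality separates the factors, and the induction on d bounds the moments
  of the partial derivatives.\<close>

theorem gauss_hypercontractive:
  "\<exists>C\<ge>0. \<forall>(I::'i set) f. finite I \<longrightarrow> gpoly I d f \<longrightarrow>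
     (\<integral>x. f x ^ (2 * 2 ^ j) \<partial>gauss I) \<le> C * (\<integral>x. (f x)\<^sup>2 \<partial>gauss I) ^ (2 ^ j)"
proof (induction d arbitrary: j)
  case 0
  show ?case
  proof (intro exI[of _ 1] conjI allI impI)
    fix I :: "'i set" and f assume "finite I" "gpoly I 0 f"
    interpret prob_space "gauss I" by (rule prob_space_gauss)
    from \<open>gpoly I 0 f\<close> obtain c where "f = (\<lambda>x. c)" using gpoly_0D by blast
    thus "(\<integral>x. f x ^ (2 * 2 ^ j) \<partial>gauss I) \<le> 1 * (\<integral>x. (f x)\<^sup>2 \<partial>gauss I) ^ (2 ^ j)"
      by (simp add: prob_space power_mult)
  qed simp
next
  case (Suc d)
  note Suc_d = Suc.IH
  show ?case
  proof (induction j)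
    case 0
    show ?case by (intro exI[of _ 1]) auto
  next
    case (Suc j)
    obtain C1 where C1: "C1 \<ge> 0" "\<And>(I::'i set) f. finite I \<Longrightarrow> gpoly I (Suc d) f \<Longrightarrow>
       (\<integral>x. f x ^ (2 * 2 ^ j) \<partial>gauss I) \<le> C1 * (\<integral>x. (f x)\<^sup>2 \<partial>gauss I) ^ (2 ^ j)" using Suc.IH by blast
    obtain C2 where C2: "C2 \<ge> 0" "\<And>(I::'i set) f. finite I \<Longrightarrow> gpoly I d f \<Longrightarrow>
       (\<integral>x. f x ^ (2 * 2 ^ Suc j) \<partial>gauss I) \<le> C2 * (\<integral>x. (f x)\<^sup>2 \<partial>gauss I) ^ (2 ^ Suc j)" using Suc_d by blast
    define q :: nat where "q = 2 ^ Suc j"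
    have q0: "q > 0" "even q" and q': "2 * 2 ^ j = q" by (auto simp: q_def)
    \<comment> \<open>Poincare's inequality contributes a factor 2, the derivative of the power
      \<open>q^2\<close>, and the converse inequality \<open>(Suc d)^2\<close>; with this L the
      moment reappears on the right with coefficient 1/2. Solving for it gives the constant C
      below.\<close>
    define L where "L = 4 * (real q)\<^sup>2 * (real (Suc d))\<^sup>2"
    have L0: "L > 0" unfolding L_def using q0 by simp
    define C where "C = 2 * C1\<^sup>2 + L * L ^ (q - 1) * C2"
    have C0: "C \<ge> 0" unfolding C_def using C1(1) C2(1) L0 by simp
    have main: "(\<integral>x. f x ^ (2 * q) \<partial>gauss I) \<le> C" if I: "finite (I::'i set)" and f: "gpoly I (Suc d) f" and n: "(\<integral>x. (f x)\<^sup>2 \<partial>gauss I) = 1" for I f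
    proof -
      obtain D where D: "has_grad I f D" "\<And>i. i\<in>I \<Longrightarrow> gpoly I d (D i)" using gpoly_has_grad[OF I f] by auto
      let ?Q = "\<integral>x. f x ^ (2 * q) \<partial>gauss I"
      define b where "b i = (\<integral>x. (D i x)\<^sup>2 \<partial>gauss I)" for i
      have b0: "b i \<ge> 0" for i unfolding b_def by (rule integral_nonneg_AE) auto
      have iD: "integrable (gauss I) (\<lambda>x. (D i x) ^ (2 * k))" if "i \<in> I" for i k by (rule gpoly_integrable_even[OF I D(2)[OF that]])
      have sb: "(\<Sum>i\<in>I. b i) \<le> (real (Suc d))\<^sup>2"
        using gauss_bernstein[OF I f D(1)] D(2) iD[of _ 1] by (simp add: b_def n)
      have igp: "gpoly I e g \<Longrightarrow> integrable (gauss I) g" for e g by (rule gpoly_integrable[OF I])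
      have ifk: "integrable (gauss I) (\<lambda>x. f x ^ k)" for k by (rule igp[OF gpoly_power[OF f]])
      \<comment> \<open>Young's inequality is applied to \<open>(D i)^2 / b i\<close>, so that the
        bound carries the weight \<open>b i\<close>. The weights have a bounded sum, however many
        coordinates there are. Where \<open>b i = 0\<close> the partial derivative vanishes almost
        surely.\<close>
      have bound: "(\<integral>x. f x ^ (2 * (q - 1)) * (D i x)\<^sup>2 \<partial>gauss I) \<le> b i * (?Q / L + L ^ (q - 1) * C2)" if i: "i \<in> I" for i
      proof (cases "b i = 0")
        case True
        have "AE x in gauss I. D i x = 0" by (rule gauss_square_zero[OF I D(2)[OF i]]) (use True in \<open>simp add: b_def\<close>)
        hence "(\<integral>x. f x ^ (2 * (q - 1)) * (D i x)\<^sup>2 \<partial>gauss I) = (\<integral>x. 0 \<partial>gauss I)"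
          using gpoly_measurable[OF f] gpoly_measurable[OF D(2)[OF i]] by (intro integral_cong_AE) auto
        thus ?thesis using True by simp
      next
        case False
        hence bp: "b i > 0" using b0[of i] by simp
        have "(\<integral>x. f x ^ (2 * (q - 1)) * (D i x)\<^sup>2 \<partial>gauss I) \<le> (\<integral>x. b i * (f x ^ (2 * q) / L + L ^ (q - 1) * (D i x ^ (2 * q) / b i ^ q)) \<partial>gauss I)"
        proof (rule integral_mono)
          show "integrable (gauss I) (\<lambda>x. f x ^ (2 * (q - 1)) * (D i x)\<^sup>2)"
            by (rule igp[OF gpoly_mult[OF gpoly_power[OF f] gpoly_power[OF D(2)[OF i]]]])
          show "integrable (gauss I) (\<lambda>x. b i * (f x ^ (2 * q) / L + L ^ (q - 1) * (D i x ^ (2 * q) / b i ^ q)))"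
            using ifk iD[OF i] by auto
          fix x
          have "((f x)\<^sup>2) ^ (q - 1) * ((D i x)\<^sup>2 / b i) \<le> ((f x)\<^sup>2) ^ q / L + L ^ (q - 1) * ((D i x)\<^sup>2 / b i) ^ q"
            by (rule power_young) (use L0 q0 b0 in auto)
          hence "b i * (((f x)\<^sup>2) ^ (q - 1) * ((D i x)\<^sup>2 / b i)) \<le> b i * (((f x)\<^sup>2) ^ q / L + L ^ (q - 1) * ((D i x)\<^sup>2 / b i) ^ q)"
            using b0 by (intro mult_left_mono) auto
          moreover have "b i * (((f x)\<^sup>2) ^ (q - 1) * ((D i x)\<^sup>2 / b i)) = f x ^ (2 * (q - 1)) * (D i x)\<^sup>2"
            using bp by (simp add: power_mult)
          ultimately show "f x ^ (2 * (q - 1)) * (D i x)\<^sup>2 \<le> b i * (f x ^ (2 * q) / L + L ^ (q - 1) * (D i x ^ (2 * q) / b i ^ q))"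
            by (simp add: power_mult power_divide)
        qed
        also have "\<dots> = b i * (?Q / L + L ^ (q - 1) * ((\<integral>x. D i x ^ (2 * q) \<partial>gauss I) / b i ^ q))"
          using ifk iD[OF i] by simp
        also have "\<dots> \<le> b i * (?Q / L + L ^ (q - 1) * C2)"
        proof -
          have "(\<integral>x. D i x ^ (2 * q) \<partial>gauss I) \<le> C2 * b i ^ q"
            using C2(2)[OF I D(2)[OF i]] by (simp add: q_def b_def)
          hence "(\<integral>x. D i x ^ (2 * q) \<partial>gauss I) / b i ^ q \<le> C2" using bp by (simp add: field_simps)
          thus ?thesis using b0 L0 by (intro mult_left_mono add_left_mono) auto
        qed
        finally show ?thesis .
      qed
      have "?Q - (\<integral>x. f x ^ q \<partial>gauss I)\<^sup>2 = (\<integral>x. (f x ^ q)\<^sup>2 \<partial>gauss I) - (\<integral>x. f x ^ q \<partial>gauss I)\<^sup>2"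
        by (simp add: power_mult[symmetric] mult.commute)
      also have "\<dots> \<le> 2 * (\<integral>x. (\<Sum>i\<in>I. (real q * f x ^ (q - 1) * D i x)\<^sup>2) \<partial>gauss I)"
        by (rule gauss_poincare[OF I gpoly_power[OF f] has_grad_power[OF D(1)]])
           (rule gpoly_mult[OF gpoly_cmult[OF gpoly_power[OF f]] D(2)])
      also have "(\<integral>x. (\<Sum>i\<in>I. (real q * f x ^ (q - 1) * D i x)\<^sup>2) \<partial>gauss I) = (\<Sum>i\<in>I. (real q)\<^sup>2 * (\<integral>x. f x ^ (2 * (q - 1)) * (D i x)\<^sup>2 \<partial>gauss I))"
      proof -
        have e: "(real q * f x ^ (q - 1) * D i x)\<^sup>2 = (real q)\<^sup>2 * (f x ^ (2 * (q - 1)) * (D i x)\<^sup>2)" for i x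
          by (simp add: power_mult_distrib mult.commute[of 2] power_mult)
        show ?thesis unfolding e
          by (subst Bochner_Integration.integral_sum)
            (auto intro!: igp[OF gpoly_mult[OF gpoly_power[OF f] gpoly_power[OF D(2)]]])
      qed
      also have "\<dots> \<le> (\<Sum>i\<in>I. (real q)\<^sup>2 * (b i * (?Q / L + L ^ (q - 1) * C2)))"
        by (intro sum_mono mult_left_mono bound) auto
      also have "\<dots> = (real q)\<^sup>2 * ((\<Sum>i\<in>I. b i) * (?Q / L + L ^ (q - 1) * C2))"
        by (simp add: sum_distrib_left sum_distrib_right)
      also have "\<dots> \<le> (real q)\<^sup>2 * ((real (Suc d))\<^sup>2 * (?Q / L + L ^ (q - 1) * C2))"
      proof -
        have "?Q \<ge> 0" by (rule integral_nonneg_AE) (auto simp: zero_le_even_power)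
        thus ?thesis using sb L0 C2(1) by (intro mult_left_mono mult_right_mono) auto
      qed
      also have "\<dots> = L / 4 * (?Q / L + L ^ (q - 1) * C2)" by (simp add: L_def)
      also have "\<dots> = ?Q / 4 + L * L ^ (q - 1) * C2 / 4" using L0 by (simp add: field_simps)
      finally have 1: "?Q \<le> (\<integral>x. f x ^ q \<partial>gauss I)\<^sup>2 + 2 * (?Q / 4 + L * L ^ (q - 1) * C2 / 4)" by simp
      have "(\<integral>x. f x ^ q \<partial>gauss I) \<le> C1" using C1(2)[OF I f] by (simp only: q' n power_one mult_1_right)
      moreover have "0 \<le> (\<integral>x. f x ^ q \<partial>gauss I)" by (rule integral_nonneg_AE) (use q0 in \<open>auto simp: zero_le_even_power\<close>)
      ultimately have "(\<integral>x. f x ^ q \<partial>gauss I)\<^sup>2 \<le> C1\<^sup>2" by (intro power_mono)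
      with 1 show "?Q \<le> C" unfolding C_def by (simp add: mult_ac)
    qed
    show ?case
    proof (intro exI[of _ C] conjI allI impI C0)
      fix I :: "'i set" and f assume I: "finite I" and f: "gpoly I (Suc d) f"
      let ?S = "\<integral>x. (f x)\<^sup>2 \<partial>gauss I"
      show "(\<integral>x. f x ^ (2 * 2 ^ Suc j) \<partial>gauss I) \<le> C * ?S ^ (2 ^ Suc j)"
      proof (cases "?S = 0")
        case True
        have "AE x in gauss I. f x = 0" by (rule gauss_square_zero[OF I f True])
        hence "(\<integral>x. f x ^ (2 * 2 ^ Suc j) \<partial>gauss I) = (\<integral>x. 0 \<partial>gauss I)"
          using gpoly_measurable[OF f] by (intro integral_cong_AE) auto
        thus ?thesis using C0 True by simp
      next
        case False
        moreover have "?S \<ge> 0" by (rule integral_nonneg_AE) auto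
        ultimately have Sp: "?S > 0" by linarith
        have e: "(1 / sqrt ?S * f x) ^ (2 * q) = f x ^ (2 * q) / ?S ^ q" for x
          using Sp by (simp add: power_mult power_divide)
        have "(\<integral>x. (1 / sqrt ?S * f x) ^ (2 * q) \<partial>gauss I) \<le> C"
          by (rule main[OF I gauss_normalize[OF I f refl Sp]])
        hence "(\<integral>x. f x ^ (2 * q) \<partial>gauss I) / ?S ^ q \<le> C" unfolding e by simp
        thus ?thesis using Sp by (simp add: field_simps q_def)
      qed
    qed
  qed
qed

section \<open>Integration by parts along rotations\<close>

text \<open>The boundary terms amount to at most \<open>B / \<eta>\<close>, because w is bounded by
  \<open>1 / (2 * \<eta>)\<close>. The zeros of \<open>w'\<close> are those of
  \<open>T2 * (\<eta>^2 - T1^2)\<close>, a trigonometric polynomial of degree 3d with at most 6d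
  zeros in the unit interval, so w has total variation at most \<open>(6 * d + 1) / \<eta>\<close>.
  Together these make the factor 6d + 2.\<close>

lemma trig_smooth:
  fixes T T1 \<phi> \<phi>' :: "real \<Rightarrow> real"
  assumes T: "\<And>\<theta>. (T has_real_derivative T1 \<theta>) (at \<theta>)" and T1: "tpoly d T1"
    and \<phi>: "\<And>x. (\<phi> has_real_derivative \<phi>' x) (at x)" and c\<phi>: "continuous_on UNIV \<phi>'"
    and B: "\<And>x. \<bar>\<phi> x\<bar> \<le> B" and L: "\<And>x. \<bar>\<phi>' x\<bar> \<le> L" and \<eta>: "\<eta> > 0"
  shows "integral {0..1} (\<lambda>\<theta>. \<phi>' (T \<theta>)) \<le> (6 * real d + 2) * B / \<eta> + integral {0..1} (\<lambda>\<theta>. L * (\<eta>\<^sup>2 / (\<eta>\<^sup>2 + (T1 \<theta>)\<^sup>2)))"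
proof -
  obtain T2 where T2: "tpoly d T2" "\<And>\<theta>. (T1 has_real_derivative T2 \<theta>) (at \<theta>)"
    using tpoly_deriv[OF T1] by blast
  define w where "w = (\<lambda>\<theta>. T1 \<theta> / ((T1 \<theta>)\<^sup>2 + \<eta>\<^sup>2))"
  define w' where "w' = (\<lambda>\<theta>. T2 \<theta> * (\<eta>\<^sup>2 - (T1 \<theta>)\<^sup>2) / ((T1 \<theta>)\<^sup>2 + \<eta>\<^sup>2)\<^sup>2)"
  have pos: "(T1 \<theta>)\<^sup>2 + \<eta>\<^sup>2 > 0" for \<theta> using \<eta> by (simp add: add_nonneg_pos)
  have pos': "(T1 \<theta>)\<^sup>2 + \<eta>\<^sup>2 \<noteq> 0" for \<theta> using pos[of \<theta>] by linarith
  have B0: "B \<ge> 0" using B[of 0] by linarith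
  have c1: "continuous_on S T1" for S by (rule tpoly_continuous[OF T1])
  have c2: "continuous_on S T2" for S by (rule tpoly_continuous[OF T2(1)])
  have cT: "continuous_on S T" for S by (rule DERIV_continuous_on) (use T in \<open>auto intro: has_field_derivative_at_within\<close>)
  have cphi: "continuous_on S \<phi>" for S by (rule DERIV_continuous_on) (use \<phi> in \<open>auto intro: has_field_derivative_at_within\<close>)
  have cphi': "continuous_on S (\<lambda>\<theta>. \<phi>' (T \<theta>))" for S
    by (rule continuous_on_compose2[OF c\<phi> cT]) auto
  have cphiT: "continuous_on S (\<lambda>\<theta>. \<phi> (T \<theta>))" for S
    by (rule continuous_on_compose2[OF cphi[of UNIV] cT]) auto
  have cw: "continuous_on S w" for S unfolding w_def by (intro continuous_intros c1) (use pos' in auto)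
  have cw': "continuous_on S w'" for S unfolding w'_def by (intro continuous_intros c1 c2) (use pos' in auto)
  have dw: "(w has_real_derivative w' \<theta>) (at \<theta>)" for \<theta>
  proof -
    have "(w has_real_derivative (T2 \<theta> * ((T1 \<theta>)\<^sup>2 + \<eta>\<^sup>2) - T1 \<theta> * (2 * T1 \<theta> * T2 \<theta>)) / (((T1 \<theta>)\<^sup>2 + \<eta>\<^sup>2) * ((T1 \<theta>)\<^sup>2 + \<eta>\<^sup>2))) (at \<theta>)"
      unfolding w_def by (rule DERIV_divide) (use pos' in \<open>auto intro!: derivative_eq_intros T2\<close>)
    moreover have "T2 \<theta> * ((T1 \<theta>)\<^sup>2 + \<eta>\<^sup>2) - T1 \<theta> * (2 * T1 \<theta> * T2 \<theta>) = T2 \<theta> * (\<eta>\<^sup>2 - (T1 \<theta>)\<^sup>2)"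
      by (simp add: algebra_simps power2_eq_square)
    ultimately show ?thesis unfolding w'_def by (simp add: power2_eq_square)
  qed
  have wB: "\<bar>w \<theta>\<bar> \<le> 1 / (2 * \<eta>)" for \<theta>
  proof -
    have "2 * \<bar>T1 \<theta>\<bar> * \<eta> \<le> (T1 \<theta>)\<^sup>2 + \<eta>\<^sup>2" using sum_squares_bound[of "\<bar>T1 \<theta>\<bar>" \<eta>] by simp
    thus ?thesis unfolding w_def using pos[of \<theta>] \<eta> by (simp add: field_simps)
  qed
  have zeros: "integral {0..1} (\<lambda>\<theta>. \<bar>w' \<theta>\<bar>) \<le> 2 * (1 / (2 * \<eta>)) * (6 * real d + 1)"
  proof -
    have tp: "tpoly (d + (d + d)) (\<lambda>\<theta>. T2 \<theta> * (\<eta>\<^sup>2 - T1 \<theta> * T1 \<theta>))"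
      by (intro tpoly_mult tpoly_diff T2(1) T1 tpoly.const)
    have eq: "w' \<theta> = 0 \<longleftrightarrow> T2 \<theta> * (\<eta>\<^sup>2 - T1 \<theta> * T1 \<theta>) = 0" for \<theta>
      using pos'[of \<theta>] by (auto simp: w'_def power2_eq_square)
    from tpoly_zeros[OF tp] show ?thesis
    proof
      assume "\<forall>\<theta>. T2 \<theta> * (\<eta>\<^sup>2 - T1 \<theta> * T1 \<theta>) = 0"
      hence "w' = (\<lambda>_. 0)" using eq by auto
      thus ?thesis using \<eta> by simp
    next
      assume *: "finite {\<theta> \<in> {0..1}. T2 \<theta> * (\<eta>\<^sup>2 - T1 \<theta> * T1 \<theta>) = 0} \<and>
         card {\<theta> \<in> {0..1}. T2 \<theta> * (\<eta>\<^sup>2 - T1 \<theta> * T1 \<theta>) = 0} \<le> 2 * (d + (d + d))"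
      have sub: "{t\<in>{0<..<1}. w' t = 0} \<subseteq> {\<theta> \<in> {0..1}. T2 \<theta> * (\<eta>\<^sup>2 - T1 \<theta> * T1 \<theta>) = 0}" using eq by auto
      have "integral {0..1} (\<lambda>\<theta>. \<bar>w' \<theta>\<bar>) \<le> 2 * (1 / (2 * \<eta>)) * (real (6 * d) + 1)"
        using integral_abs_deriv_le[of 0 1 w w' "1 / (2 * \<eta>)" "6 * d", OF _ dw cw' wB finite_subset[OF sub]] card_mono[OF _ sub] * by (auto simp: add.commute)
      thus ?thesis by (simp add: add.commute)
    qed
  qed
  let ?G = "\<lambda>\<theta>. \<phi> (T \<theta>) * w \<theta>" and ?g1 = "\<lambda>\<theta>. \<phi>' (T \<theta>) * T1 \<theta> * w \<theta>" and ?g2 = "\<lambda>\<theta>. \<phi> (T \<theta>) * w' \<theta>"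
  have dG: "(?G has_real_derivative ?g1 \<theta> + ?g2 \<theta>) (at \<theta>)" for \<theta>
    using DERIV_mult[OF DERIV_chain2[OF \<phi> T] dw, of \<theta>] by (simp add: algebra_simps)
  have ftc: "((\<lambda>\<theta>. ?g1 \<theta> + ?g2 \<theta>) has_integral (?G 1 - ?G 0)) {0..1}"
    by (rule fundamental_theorem_of_calculus)
      (auto simp: has_real_derivative_iff_has_vector_derivative[symmetric] intro: has_field_derivative_at_within dG)
  have i1: "?g1 integrable_on {0..1}" and i2: "?g2 integrable_on {0..1}"
    by (auto intro!: integrable_continuous_interval continuous_intros cphi' cphiT c1 cw cw')
  have "integral {0..1} ?g1 + integral {0..1} ?g2 = ?G 1 - ?G 0"
    using integral_unique[OF ftc] integral_add[OF i1 i2] by simp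
  moreover have "\<bar>?G \<theta>\<bar> \<le> B * (1 / (2 * \<eta>))" for \<theta>
    unfolding abs_mult by (intro mult_mono B wB B0) auto
  hence "?G 1 - ?G 0 \<le> 2 * (B * (1 / (2 * \<eta>)))" using abs_le_D1[of "?G 1"] abs_le_D2[of "?G 0"] by smt
  moreover have "- integral {0..1} ?g2 \<le> B * (2 * (1 / (2 * \<eta>)) * (6 * real d + 1))"
  proof -
    have "- integral {0..1} ?g2 \<le> norm (integral {0..1} ?g2)" by simp
    also have "\<dots> \<le> integral {0..1} (\<lambda>\<theta>. B * \<bar>w' \<theta>\<bar>)"
      by (rule integral_norm_bound_integral[OF i2])
         (auto intro!: integrable_continuous_interval continuous_intros cw' simp: abs_mult intro: mult_right_mono B)
    also have "\<dots> = B * integral {0..1} (\<lambda>\<theta>. \<bar>w' \<theta>\<bar>)" by simp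
    also have "\<dots> \<le> B * (2 * (1 / (2 * \<eta>)) * (6 * real d + 1))" by (rule mult_left_mono[OF zeros B0])
    finally show ?thesis .
  qed
  moreover have "(6 * real d + 2) * B / \<eta> = 2 * (B * (1 / (2 * \<eta>))) + B * (2 * (1 / (2 * \<eta>)) * (6 * real d + 1))"
    using \<eta> by (simp add: field_simps)
  ultimately have g1: "integral {0..1} ?g1 \<le> (6 * real d + 2) * B / \<eta>"
    by linarith
  \<comment> \<open>w is a regularised reciprocal of \<open>T1\<close>: the product
    \<open>T1 * w\<close> misses 1 exactly by the ratio that remains in the conclusion.\<close>
  have split: "\<phi>' (T \<theta>) = ?g1 \<theta> + \<phi>' (T \<theta>) * (\<eta>\<^sup>2 / (\<eta>\<^sup>2 + (T1 \<theta>)\<^sup>2))" for \<theta>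
  proof -
    have "T1 \<theta> * w \<theta> + \<eta>\<^sup>2 / (\<eta>\<^sup>2 + (T1 \<theta>)\<^sup>2) = ((T1 \<theta>)\<^sup>2 + \<eta>\<^sup>2) / ((T1 \<theta>)\<^sup>2 + \<eta>\<^sup>2)"
      by (simp only: w_def times_divide_eq_right power2_eq_square add_divide_distrib add.commute)
    also have "\<dots> = 1" by (rule divide_self[OF pos'])
    finally show ?thesis by (simp only: mult.assoc distrib_left[symmetric] mult_1_right)
  qed
  have i3: "(\<lambda>\<theta>. \<phi>' (T \<theta>) * (\<eta>\<^sup>2 / (\<eta>\<^sup>2 + (T1 \<theta>)\<^sup>2))) integrable_on {0..1}"
    "(\<lambda>\<theta>. L * (\<eta>\<^sup>2 / (\<eta>\<^sup>2 + (T1 \<theta>)\<^sup>2))) integrable_on {0..1}"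
    using pos' by (auto intro!: integrable_continuous_interval continuous_intros cphi' c1 simp: add.commute)
  have "integral {0..1} (\<lambda>\<theta>. \<phi>' (T \<theta>)) = integral {0..1} ?g1 + integral {0..1} (\<lambda>\<theta>. \<phi>' (T \<theta>) * (\<eta>\<^sup>2 / (\<eta>\<^sup>2 + (T1 \<theta>)\<^sup>2)))"
    using integral_add[OF i1 i3(1)] split by (metis (no_types, lifting) ext)
  moreover have "integral {0..1} (\<lambda>\<theta>. \<phi>' (T \<theta>) * (\<eta>\<^sup>2 / (\<eta>\<^sup>2 + (T1 \<theta>)\<^sup>2))) \<le> integral {0..1} (\<lambda>\<theta>. L * (\<eta>\<^sup>2 / (\<eta>\<^sup>2 + (T1 \<theta>)\<^sup>2)))"
    by (rule integral_le[OF i3]) (intro mult_right_mono abs_le_D1[OF L], simp)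
  ultimately show ?thesis using g1 by linarith
qed

text \<open>A smooth substitute for the minimum of 1 and \<open>\<eta> / |grad f|\<close>. The
  argument y is the squared norm, because as a function of y it is convex, and y is a sum over the
  coordinates.\<close>

definition damp :: "real \<Rightarrow> real \<Rightarrow> real" where
  "damp \<eta> y = \<eta> / sqrt (\<eta>\<^sup>2 + y)"

lemma damp_measurable[measurable]: "damp \<eta> \<in> borel_measurable borel"
  unfolding damp_def by measurable

lemma damp_nonneg: "\<eta> > 0 \<Longrightarrow> y \<ge> 0 \<Longrightarrow> damp \<eta> y \<ge> 0"
  by (simp add: damp_def)

lemma damp_le_1: "\<eta> > 0 \<Longrightarrow> y \<ge> 0 \<Longrightarrow> damp \<eta> y \<le> 1"
proof -
  assume "\<eta> > 0" "y \<ge> 0"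
  hence "\<eta> \<le> sqrt (\<eta>\<^sup>2 + y)" by (intro real_le_rsqrt) simp
  moreover from this have "0 < sqrt (\<eta>\<^sup>2 + y)" using \<open>\<eta> > 0\<close> by linarith
  ultimately show ?thesis by (simp only: damp_def divide_le_eq_1_pos)
qed

lemma damp_antimono: "\<eta> > 0 \<Longrightarrow> 0 \<le> x \<Longrightarrow> x \<le> y \<Longrightarrow> damp \<eta> y \<le> damp \<eta> x"
  unfolding damp_def by (intro divide_left_mono) (auto intro!: mult_pos_pos add_pos_nonneg)

lemma damp_square_le: "\<eta> > 0 \<Longrightarrow> a > 0 \<Longrightarrow> a \<le> \<bar>x\<bar> \<Longrightarrow> damp \<eta> (x\<^sup>2) \<le> \<eta> / a"
proof -
  assume h: "\<eta> > 0" "a > 0" "a \<le> \<bar>x\<bar>"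
  have "a\<^sup>2 \<le> x\<^sup>2" using h power_mono[of a "\<bar>x\<bar>" 2] by simp
  hence "a \<le> sqrt (\<eta>\<^sup>2 + x\<^sup>2)" by (intro real_le_rsqrt) (simp add: add_increasing)
  moreover from this have "0 < sqrt (\<eta>\<^sup>2 + x\<^sup>2) * a" using h by (intro mult_pos_pos) linarith+
  ultimately show ?thesis unfolding damp_def using h by (intro divide_left_mono) auto
qed

lemma damp_convex: "\<eta> > 0 \<Longrightarrow> convex_on {0..} (damp \<eta>)"
proof -
  assume \<eta>: "\<eta> > 0"
  have "convex_on {0..} (\<lambda>y. \<eta> * (\<eta>\<^sup>2 + y) powr (-1/2))"
  proof (rule f''_ge0_imp_convex)
    fix x :: real assume x: "x \<in> {0..}"
    hence p: "\<eta>\<^sup>2 + x > 0" using \<eta> by (simp add: add_pos_nonneg)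
    show "((\<lambda>y. \<eta> * (\<eta>\<^sup>2 + y) powr (-1/2)) has_real_derivative \<eta> * ((-1/2) * (\<eta>\<^sup>2 + x) powr (-3/2))) (at x)"
      using p by (auto intro!: derivative_eq_intros)
    show "((\<lambda>x. \<eta> * ((-1/2) * (\<eta>\<^sup>2 + x) powr (-3/2))) has_real_derivative \<eta> * (3/4 * (\<eta>\<^sup>2 + x) powr (-5/2))) (at x)"
      using p by (auto intro!: derivative_eq_intros)
    show "0 \<le> \<eta> * (3/4 * (\<eta>\<^sup>2 + x) powr (-5/2))" using \<eta> by simp
  qed simp
  moreover have "\<eta> * (\<eta>\<^sup>2 + y) powr (-1/2) = damp \<eta> y" if "y \<in> {0..}" for y
  proof -
    have "\<eta>\<^sup>2 + y > 0" using that \<eta> by (simp add: add_pos_nonneg)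
    thus ?thesis by (simp add: damp_def powr_minus_divide powr_half_sqrt)
  qed
  ultimately show ?thesis unfolding convex_on_def by simp
qed

lemma nn_integral_cauchy: "(\<integral>\<^sup>+ x. ennreal (1 / (1 + x\<^sup>2)) \<partial>lborel) = ennreal pi"
proof -
  have "(\<integral>\<^sup>+ x. ennreal (1 / (1 + x\<^sup>2)) \<partial>lborel) = ennreal (LBINT x. 1 / (1 + x\<^sup>2))"
    by (rule nn_integral_eq_integral)
      (use integrable_inverse_1_plus_square in \<open>auto simp: set_integrable_def inverse_eq_divide\<close>)
  also have "(LBINT x. 1 / (1 + x\<^sup>2)) = pi"
    using LBINT_inverse_1_plus_square
    by (simp add: interval_lebesgue_integral_def set_lebesgue_integral_def inverse_eq_divide)
  finally show ?thesis .
qed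

text \<open>The integrand is at most 1, and since the normal density is bounded and 1/(1 + x^2) has
  integral pi, its mean is also at most a multiple of \<open>\<eta> / \<sigma>\<close>;
  \<open>damp\<close> unites the two bounds. Only the first power of the ratio survives because
  directions with small g, almost orthogonal to the gradient, are that frequent.\<close>

lemma normal_small_ball:
  assumes "\<eta> > 0" "\<sigma> \<ge> 0"
  shows "(\<integral>\<^sup>+ g. ennreal (\<eta>\<^sup>2 / (\<eta>\<^sup>2 + (\<sigma> * g)\<^sup>2)) \<partial>std_normal_distribution) \<le> ennreal (2 * damp \<eta> (\<sigma>\<^sup>2))"
proof (cases "\<sigma> \<le> \<eta>")
  case True
  interpret N: prob_space std_normal_distribution by (rule prob_space_std_normal)
  have "(\<integral>\<^sup>+ g. ennreal (\<eta>\<^sup>2 / (\<eta>\<^sup>2 + (\<sigma> * g)\<^sup>2)) \<partial>std_normal_distribution) \<le> (\<integral>\<^sup>+ g. 1 \<partial>std_normal_distribution)"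
  proof (rule nn_integral_mono)
    fix g
    have "\<eta>\<^sup>2 + (\<sigma> * g)\<^sup>2 > 0" using assms by (simp add: add_pos_nonneg)
    thus "ennreal (\<eta>\<^sup>2 / (\<eta>\<^sup>2 + (\<sigma> * g)\<^sup>2)) \<le> 1" by simp
  qed
  also have "\<dots> = ennreal 1" using N.emeasure_space_1 by simp
  also have "\<dots> \<le> ennreal (2 * damp \<eta> (\<sigma>\<^sup>2))"
  proof (rule ennreal_leI)
    have "\<sigma>\<^sup>2 \<le> \<eta>\<^sup>2" using True assms by (intro power_mono)
    moreover have "(2 * \<eta>)\<^sup>2 = 4 * \<eta>\<^sup>2" by simp
    ultimately have "\<eta>\<^sup>2 + \<sigma>\<^sup>2 \<le> (2 * \<eta>)\<^sup>2" using zero_le_power2[of \<eta>] by linarith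
    hence "sqrt (\<eta>\<^sup>2 + \<sigma>\<^sup>2) \<le> 2 * \<eta>" using assms by (intro real_le_lsqrt) auto
    moreover have "sqrt (\<eta>\<^sup>2 + \<sigma>\<^sup>2) > 0" using assms by (simp add: add_pos_nonneg)
    ultimately show "1 \<le> 2 * damp \<eta> (\<sigma>\<^sup>2)" unfolding damp_def by (simp add: field_simps)
  qed
  finally show ?thesis .
next
  case False
  hence \<sigma>: "\<sigma> > 0" "\<eta> < \<sigma>" using assms by auto
  have dens: "std_normal_density x \<le> 1 / sqrt (2 * pi)" for x
    unfolding std_normal_density_def by (simp add: divide_right_mono)
  have "(\<integral>\<^sup>+ g. ennreal (\<eta>\<^sup>2 / (\<eta>\<^sup>2 + (\<sigma> * g)\<^sup>2)) \<partial>std_normal_distribution) =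
     (\<integral>\<^sup>+ g. ennreal (std_normal_density g) * ennreal (\<eta>\<^sup>2 / (\<eta>\<^sup>2 + (\<sigma> * g)\<^sup>2)) \<partial>lborel)"
    by (rule nn_integral_density) auto
  also have "\<dots> \<le> (\<integral>\<^sup>+ g. ennreal (1 / sqrt (2 * pi)) * ennreal (\<eta>\<^sup>2 / (\<eta>\<^sup>2 + (\<sigma> * g)\<^sup>2)) \<partial>lborel)"
    by (intro nn_integral_mono mult_right_mono ennreal_leI dens) auto
  also have "\<dots> = ennreal (1 / sqrt (2 * pi)) * (\<integral>\<^sup>+ g. ennreal (\<eta>\<^sup>2 / (\<eta>\<^sup>2 + (\<sigma> * g)\<^sup>2)) \<partial>lborel)"
    by (rule nn_integral_cmult) auto
  also have "(\<integral>\<^sup>+ g. ennreal (\<eta>\<^sup>2 / (\<eta>\<^sup>2 + (\<sigma> * g)\<^sup>2)) \<partial>lborel) = ennreal \<bar>\<eta> / \<sigma>\<bar> * (\<integral>\<^sup>+ x. ennreal (\<eta>\<^sup>2 / (\<eta>\<^sup>2 + (\<sigma> * (0 + \<eta> / \<sigma> * x))\<^sup>2)) \<partial>lborel)"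
    by (rule nn_integral_real_affine) (use assms \<sigma> in auto)
  also have "(\<lambda>x. \<eta>\<^sup>2 / (\<eta>\<^sup>2 + (\<sigma> * (0 + \<eta> / \<sigma> * x))\<^sup>2)) = (\<lambda>x. 1 / (1 + x\<^sup>2))"
  proof
    fix x :: real
    have "\<eta>\<^sup>2 + (\<sigma> * (0 + \<eta> / \<sigma> * x))\<^sup>2 = \<eta>\<^sup>2 * (1 + x\<^sup>2)" using \<sigma> by (simp add: power_mult_distrib ring_distribs)
    thus "\<eta>\<^sup>2 / (\<eta>\<^sup>2 + (\<sigma> * (0 + \<eta> / \<sigma> * x))\<^sup>2) = 1 / (1 + x\<^sup>2)" using assms by simp
  qed
  also have "ennreal (1 / sqrt (2 * pi)) * (ennreal \<bar>\<eta> / \<sigma>\<bar> * (\<integral>\<^sup>+ x. ennreal (1 / (1 + x\<^sup>2)) \<partial>lborel)) = ennreal (1 / sqrt (2 * pi) * (\<eta> / \<sigma> * pi))"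
    unfolding nn_integral_cauchy using assms \<sigma> by (simp add: ennreal_mult'[symmetric])
  also have "\<dots> \<le> ennreal (2 * damp \<eta> (\<sigma>\<^sup>2))"
  proof (rule ennreal_leI)
    have "\<eta>\<^sup>2 \<le> \<sigma>\<^sup>2" using \<sigma> assms by (intro power_mono) auto
    hence "sqrt (\<eta>\<^sup>2 + \<sigma>\<^sup>2) \<le> sqrt (2 * \<sigma>\<^sup>2)" by (intro real_sqrt_le_mono) simp
    also have "\<dots> = sqrt 2 * \<sigma>" using \<sigma> by (simp add: real_sqrt_mult)
    finally have 1: "sqrt (\<eta>\<^sup>2 + \<sigma>\<^sup>2) \<le> sqrt 2 * \<sigma>" .
    have 0: "sqrt (\<eta>\<^sup>2 + \<sigma>\<^sup>2) > 0" using assms by (simp add: add_pos_nonneg)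
    have sp: "pi / sqrt (2 * pi) = sqrt pi / sqrt 2" by (simp add: real_sqrt_mult field_simps)
    have "sqrt pi / sqrt 2 \<le> 2 / sqrt 2"
      using pi_less_4 by (intro divide_right_mono real_le_lsqrt) auto
    hence "1 / sqrt (2 * pi) * (\<eta> / \<sigma> * pi) \<le> \<eta> / \<sigma> * (2 / sqrt 2)"
      using assms \<sigma> mult_left_mono[of "sqrt pi / sqrt 2" "2 / sqrt 2" "\<eta> / \<sigma>"] sp by (simp add: field_simps)
    also have "\<dots> = 2 * (\<eta> / (sqrt 2 * \<sigma>))" by (simp add: mult.commute)
    also have "\<dots> \<le> 2 * damp \<eta> (\<sigma>\<^sup>2)" unfolding damp_def
      using 0 1 assms \<sigma> by (intro mult_left_mono divide_left_mono) auto
    finally show "1 / sqrt (2 * pi) * (\<eta> / \<sigma> * pi) \<le> 2 * damp \<eta> (\<sigma>\<^sup>2)" .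
  qed
  finally show ?thesis .
qed

text \<open>\<open>trig_smooth\<close> averaged over all curves. The constant L is added to
  \<open>\<phi>'\<close> on both sides so that nonnegative integrals can be used, and cancels at the
  end.\<close>

lemma gauss_smooth:
  assumes I: "finite I" and f: "gpoly I d f" and D: "has_grad I f D" "\<And>i. i \<in> I \<Longrightarrow> gpoly I e (D i)"
    and \<phi>: "\<And>x. (\<phi> has_real_derivative \<phi>' x) (at x)" and c\<phi>: "continuous_on UNIV \<phi>'"
    and B: "\<And>x. \<bar>\<phi> x\<bar> \<le> B" and L: "\<And>x. \<bar>\<phi>' x\<bar> \<le> L" and \<eta>: "\<eta> > 0"
  shows "(\<integral>x. \<phi>' (f x) \<partial>gauss I) \<le> (6 * real d + 2) * B / \<eta> + 2 * L * (\<integral>x. damp \<eta> (\<Sum>i\<in>I. (D i x)\<^sup>2) \<partial>gauss I)"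
proof -
  interpret G: prob_space "gauss I" by (rule prob_space_gauss)
  interpret G2: prob_space "gauss2 I" by (rule prob_space_gauss2)
  have D': "\<And>i. i \<in> I \<Longrightarrow> D i \<in> borel_measurable (PiM I (\<lambda>_. borel))" using gpoly_measurable[OF D(2)] by auto
  note [measurable] = gpoly_measurable[OF f] dir_deriv_measurable[OF D'] borel_measurable_continuous_onI[OF c\<phi>] D'
  have B0: "B \<ge> 0" using B[of 0] by linarith
  have L0: "L \<ge> 0" using L[of 0] by linarith
  let ?K = "(6 * real d + 2) * B / \<eta>" and ?S = "{0..1::real}"
  have K0: "?K \<ge> 0" using B0 \<eta> by simp
  have i1: "integrable (gauss I) (\<lambda>x. \<phi>' (f x))"
    by (rule G.integrable_const_bound[where B=L]) (use L in auto)
  have Lp: "0 \<le> \<phi>' x + L" for x using L[of x] by linarith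
  let ?h = "\<lambda>z. ennreal (\<eta>\<^sup>2 / (\<eta>\<^sup>2 + (dir_deriv I D z)\<^sup>2))"
  have "(\<integral>\<^sup>+ z. ?h z \<partial>gauss2 I) = (\<integral>\<^sup>+ x. (\<integral>\<^sup>+ g. ennreal (\<eta>\<^sup>2 / (\<eta>\<^sup>2 + (sqrt (\<Sum>i\<in>I. (D i x)\<^sup>2) * g)\<^sup>2)) \<partial>std_normal_distribution) \<partial>gauss I)"
    by (rule nn_integral_dir_deriv[OF I D']) auto
  also have "\<dots> \<le> (\<integral>\<^sup>+ x. ennreal (2 * damp \<eta> (\<Sum>i\<in>I. (D i x)\<^sup>2)) \<partial>gauss I)"
  proof (rule nn_integral_mono)
    fix x
    show "(\<integral>\<^sup>+ g. ennreal (\<eta>\<^sup>2 / (\<eta>\<^sup>2 + (sqrt (\<Sum>i\<in>I. (D i x)\<^sup>2) * g)\<^sup>2)) \<partial>std_normal_distribution) \<le> ennreal (2 * damp \<eta> (\<Sum>i\<in>I. (D i x)\<^sup>2))"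
      using normal_small_ball[OF \<eta>, of "sqrt (\<Sum>i\<in>I. (D i x)\<^sup>2)"] by (simp add: sum_nonneg)
  qed
  also have "\<dots> = ennreal (\<integral>x. 2 * damp \<eta> (\<Sum>i\<in>I. (D i x)\<^sup>2) \<partial>gauss I)"
    by (rule nn_integral_eq_integral)
       (use \<eta> in \<open>auto intro!: G.integrable_const_bound[where B=2] damp_nonneg sum_nonneg AE_I2 order.trans[OF damp_le_1] simp: abs_mult abs_of_nonneg damp_nonneg damp_le_1 sum_nonneg\<close>)
  finally have U: "(\<integral>\<^sup>+ z. ?h z \<partial>gauss2 I) \<le> ennreal (\<integral>x. 2 * damp \<eta> (\<Sum>i\<in>I. (D i x)\<^sup>2) \<partial>gauss I)" .
  have "ennreal ((\<integral>x. \<phi>' (f x) \<partial>gauss I) + L) = ennreal (\<integral>x. \<phi>' (f x) + L \<partial>gauss I)"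
    using i1 by (simp add: G.prob_space)
  also have "\<dots> = (\<integral>\<^sup>+ x. ennreal (\<phi>' (f x) + L) \<partial>gauss I)"
    by (rule nn_integral_eq_integral[symmetric]) (use i1 Lp in auto)
  also have "\<dots> = (\<integral>\<^sup>+ z. ennreal (\<phi>' (f (fst z)) + L) \<partial>gauss2 I)"
    by (rule nn_integral_gauss2_fst[symmetric]) measurable
  also have "\<dots> = (\<integral>\<^sup>+ z. (\<integral>\<^sup>+ \<theta>. ennreal (\<phi>' (f (fst (rot I \<theta> z))) + L) * indicator ?S \<theta> \<partial>lborel) \<partial>gauss2 I)"
    by (subst nn_integral_rot_average[OF I]) simp_all
  also have "\<dots> \<le> (\<integral>\<^sup>+ z. (ennreal (?K + L) + (\<integral>\<^sup>+ \<theta>. (ennreal L * ?h (rot I \<theta> z)) * indicator ?S \<theta> \<partial>lborel)) \<partial>gauss2 I)"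
  proof (rule nn_integral_mono)
    fix z
    let ?T = "\<lambda>\<theta>. f (fst (rot I \<theta> z))" and ?T1 = "\<lambda>\<theta>. dir_deriv I D (rot I \<theta> z)"
    have cT: "continuous_on S ?T" for S by (rule tpoly_continuous[OF rot_tpoly[OF f]])
    have cT1: "continuous_on S ?T1" for S by (rule tpoly_continuous[OF rot_tpoly_deriv[OF f D(1)]])
    have cphi': "continuous_on S (\<lambda>\<theta>. \<phi>' (?T \<theta>))" for S
      by (rule continuous_on_compose2[OF c\<phi> cT]) auto
    have pos: "\<eta>\<^sup>2 + y\<^sup>2 > 0" for y using \<eta> by (simp add: add_pos_nonneg)
    hence ne: "\<eta>\<^sup>2 + y\<^sup>2 \<noteq> 0" for y by (metis less_irrefl)
    have c3: "continuous_on ?S (\<lambda>\<theta>. L * (\<eta>\<^sup>2 / (\<eta>\<^sup>2 + (?T1 \<theta>)\<^sup>2)))"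
      by (intro continuous_intros cT1) (use ne in auto)
    have "(\<integral>\<^sup>+ \<theta>. ennreal (\<phi>' (?T \<theta>) + L) * indicator ?S \<theta> \<partial>lborel) = ennreal (integral ?S (\<lambda>\<theta>. \<phi>' (?T \<theta>) + L))"
      by (rule nn_integral_indicator_continuous) (auto intro!: continuous_intros cphi' Lp)
    also have "integral ?S (\<lambda>\<theta>. \<phi>' (?T \<theta>) + L) = integral ?S (\<lambda>\<theta>. \<phi>' (?T \<theta>)) + L"
      by (subst integral_add) (auto intro!: integrable_continuous_interval cphi')
    also have "ennreal (integral ?S (\<lambda>\<theta>. \<phi>' (?T \<theta>)) + L) \<le> ennreal (?K + L + integral ?S (\<lambda>\<theta>. L * (\<eta>\<^sup>2 / (\<eta>\<^sup>2 + (?T1 \<theta>)\<^sup>2))))"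
      using trig_smooth[OF rot_deriv[OF D(1)] rot_tpoly_deriv[OF f D(1)] \<phi> c\<phi> B L \<eta>, of z] by (intro ennreal_leI) (simp add: add.commute)
    also have "\<dots> = ennreal (?K + L) + ennreal (integral ?S (\<lambda>\<theta>. L * (\<eta>\<^sup>2 / (\<eta>\<^sup>2 + (?T1 \<theta>)\<^sup>2))))"
      by (rule ennreal_plus) (use K0 L0 c3 pos in \<open>auto intro!: integral_nonneg integrable_continuous_interval divide_nonneg_pos mult_nonneg_nonneg\<close>)
    also have "ennreal (integral ?S (\<lambda>\<theta>. L * (\<eta>\<^sup>2 / (\<eta>\<^sup>2 + (?T1 \<theta>)\<^sup>2)))) = (\<integral>\<^sup>+ \<theta>. ennreal (L * (\<eta>\<^sup>2 / (\<eta>\<^sup>2 + (?T1 \<theta>)\<^sup>2))) * indicator ?S \<theta> \<partial>lborel)"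
      by (rule nn_integral_indicator_continuous[symmetric, OF c3]) (use L0 in auto)
    also have "\<dots> = (\<integral>\<^sup>+ \<theta>. (ennreal L * ?h (rot I \<theta> z)) * indicator ?S \<theta> \<partial>lborel)"
      using L0 by (subst ennreal_mult) auto
    finally show "(\<integral>\<^sup>+ \<theta>. ennreal (\<phi>' (?T \<theta>) + L) * indicator ?S \<theta> \<partial>lborel) \<le> ennreal (?K + L) + (\<integral>\<^sup>+ \<theta>. (ennreal L * ?h (rot I \<theta> z)) * indicator ?S \<theta> \<partial>lborel)" .
  qed
  also have "\<dots> = ennreal (?K + L) + (\<integral>\<^sup>+ z. (\<integral>\<^sup>+ \<theta>. (ennreal L * ?h (rot I \<theta> z)) * indicator ?S \<theta> \<partial>lborel) \<partial>gauss2 I)"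
  proof (subst nn_integral_add)
    show "(\<lambda>z. \<integral>\<^sup>+ \<theta>. (ennreal L * ?h (rot I \<theta> z)) * indicator ?S \<theta> \<partial>lborel) \<in> borel_measurable (gauss2 I)"
      by (rule measurable_rot_average[OF I, where h="\<lambda>z. ennreal L * ?h z"]) measurable
  qed (auto simp: G2.emeasure_space_1)
  also have "(\<integral>\<^sup>+ z. (\<integral>\<^sup>+ \<theta>. (ennreal L * ?h (rot I \<theta> z)) * indicator ?S \<theta> \<partial>lborel) \<partial>gauss2 I) = (\<integral>\<^sup>+ z. ennreal L * ?h z \<partial>gauss2 I)"
    by (subst nn_integral_rot_average[OF I]) simp_all
  also have "\<dots> = ennreal L * (\<integral>\<^sup>+ z. ?h z \<partial>gauss2 I)"
    by (rule nn_integral_cmult) simp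
  also have "ennreal (?K + L) + ennreal L * (\<integral>\<^sup>+ z. ?h z \<partial>gauss2 I) \<le> ennreal (?K + L) + ennreal L * ennreal (\<integral>x. 2 * damp \<eta> (\<Sum>i\<in>I. (D i x)\<^sup>2) \<partial>gauss I)"
    by (intro add_left_mono mult_left_mono U) simp
  also have "\<dots> = ennreal (?K + L + L * (\<integral>x. 2 * damp \<eta> (\<Sum>i\<in>I. (D i x)\<^sup>2) \<partial>gauss I))"
    using K0 L0 \<eta> by (subst ennreal_mult'[symmetric], simp, subst ennreal_plus[symmetric])
      (auto intro!: mult_nonneg_nonneg integral_nonneg_AE damp_nonneg sum_nonneg)
  finally have "(\<integral>x. \<phi>' (f x) \<partial>gauss I) + L \<le> ?K + L + L * (\<integral>x. 2 * damp \<eta> (\<Sum>i\<in>I. (D i x)\<^sup>2) \<partial>gauss I)"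
    using K0 L0 \<eta> by (subst (asm) ennreal_le_iff) (auto intro!: add_nonneg_nonneg mult_nonneg_nonneg integral_nonneg_AE damp_nonneg sum_nonneg)
  thus ?thesis by (simp add: add.commute mult.left_commute mult.assoc)
qed

section \<open>Small ball estimates\<close>

text \<open>The type argument only fixes the index type of the Gaussian vectors, over which the constants are
  uniform. The exponent \<open>1 / (2 * d + 1)\<close> is not sharp; it is the one that the induction over the
  degree closes with.\<close>

definition damp_bound :: "'i itself \<Rightarrow> nat \<Rightarrow> real \<Rightarrow> bool" where
  "damp_bound _ d C \<longleftrightarrow> C > 0 \<and> (\<forall>(I::'i set) f. finite I \<longrightarrow> gpoly I d f \<longrightarrow> (\<integral>x. (f x)\<^sup>2 \<partial>gauss I) = 1 \<longrightarrow>
     (\<forall>\<eta>>0. (\<integral>x. damp \<eta> ((f x)\<^sup>2) \<partial>gauss I) \<le> C * \<eta> powr (1 / (2 * real d + 1))))"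

text \<open>The exponent is that of \<open>damp_bound\<close> in degree d - 1, the degree of the
  gradient. Dividing \<open>\<eta>\<close> by the standard deviation makes the bound scale correctly
  with f.\<close>

definition smooth_bound :: "'i itself \<Rightarrow> nat \<Rightarrow> real \<Rightarrow> bool" where
  "smooth_bound _ d K \<longleftrightarrow> K > 0 \<and> (\<forall>(I::'i set) f v \<phi> \<phi>' B L \<eta>. finite I \<longrightarrow> gpoly I d f \<longrightarrow> 
     v = (\<integral>x. (f x)\<^sup>2 \<partial>gauss I) - (\<integral>x. f x \<partial>gauss I)\<^sup>2 \<longrightarrow> v > 0 \<longrightarrow>
     (\<forall>x. (\<phi> has_real_derivative \<phi>' x) (at x)) \<longrightarrow> continuous_on UNIV \<phi>' \<longrightarrow>
     (\<forall>x. \<bar>\<phi> x\<bar> \<le> B) \<longrightarrow> (\<forall>x. \<bar>\<phi>' x\<bar> \<le> L) \<longrightarrow> \<eta> > 0 \<longrightarrow>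
     (\<integral>x. \<phi>' (f x) \<partial>gauss I) \<le> K * (B / \<eta> + L * (\<eta> / sqrt v) powr (1 / (2 * real d - 1))))"

lemma damp_scale: "b > 0 \<Longrightarrow> damp \<eta> (b * y) = damp (\<eta> / sqrt b) y"
proof -
  assume b: "b > 0"
  have "sqrt (\<eta>\<^sup>2 + b * y) = sqrt (b * ((\<eta> / sqrt b)\<^sup>2 + y))" using b by (simp add: power_divide ring_distribs)
  also have "\<dots> = sqrt b * sqrt ((\<eta> / sqrt b)\<^sup>2 + y)" by (simp add: real_sqrt_mult)
  finally show ?thesis by (simp add: damp_def)
qed

text \<open>The sum of squares is at least a convex combination, with weights
  \<open>c i / b\<close>, of b times the squares of the normalised partial derivatives. As
  \<open>damp\<close> is decreasing and convex, Jensen's inequality leaves single polynomials of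
  unit norm, and the weights add up to 1 whatever the dimension.\<close>

lemma gauss_damped_gradient:
  assumes C: "damp_bound TYPE('i) d C" and I: "finite (I::'i set)" and D: "\<And>i. i \<in> I \<Longrightarrow> gpoly I d (D i)"
    and b: "b = (\<integral>x. (\<Sum>i\<in>I. (D i x)\<^sup>2) \<partial>gauss I)" "b > 0" and \<eta>: "\<eta> > 0"
  shows "(\<integral>x. damp \<eta> (\<Sum>i\<in>I. (D i x)\<^sup>2) \<partial>gauss I) \<le> C * (\<eta> / sqrt b) powr (1 / (2 * real d + 1))"
proof -
  interpret G: prob_space "gauss I" by (rule prob_space_gauss)
  define c where "c i = (\<integral>x. (D i x)\<^sup>2 \<partial>gauss I)" for i
  \<comment> \<open>Partial derivatives with \<open>c i = 0\<close> cannot be normalised; dropping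
    them only increases \<open>damp\<close>.\<close>
  define J where "J = {i\<in>I. c i > 0}"
  have JI: "J \<subseteq> I" "finite J" using I by (auto simp: J_def)
  have D'[measurable]: "\<And>i. i \<in> I \<Longrightarrow> D i \<in> borel_measurable (PiM I (\<lambda>_. borel))" using gpoly_measurable[OF D] by auto
  have i2: "i \<in> I \<Longrightarrow> integrable (gauss I) (\<lambda>x. (D i x)\<^sup>2)" for i using gpoly_integrable_even[OF I D, of i 1] by simp
  have c0: "c i \<ge> 0" for i unfolding c_def by (rule integral_nonneg_AE) auto
  have "b = (\<Sum>i\<in>I. c i)" unfolding b(1) c_def by (rule Bochner_Integration.integral_sum) (use i2 in auto)
  also have "\<dots> = (\<Sum>i\<in>J. c i)" using JI I c0 by (intro sum.mono_neutral_right) (auto simp: J_def less_le)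
  finally have bs: "b = (\<Sum>i\<in>J. c i)" .
  have J0: "J \<noteq> {}" using bs b(2) by auto
  have w1: "(\<Sum>i\<in>J. c i / b) = 1" using bs b(2) by (simp flip: sum_divide_distrib)
  let ?y = "\<lambda>i x. b * (1 / sqrt (c i) * D i x)\<^sup>2"
  have y: "c i / b * ?y i x = (D i x)\<^sup>2" if "i \<in> J" for i x
    using that b(2) by (auto simp: J_def power_mult_distrib power_divide)
  have pw: "damp \<eta> (\<Sum>i\<in>I. (D i x)\<^sup>2) \<le> (\<Sum>i\<in>J. c i / b * damp \<eta> (?y i x))" for x
  proof -
    have "(\<Sum>i\<in>J. c i / b * ?y i x) = (\<Sum>i\<in>J. (D i x)\<^sup>2)" by (rule sum.cong) (use y in auto)
    also have "\<dots> \<le> (\<Sum>i\<in>I. (D i x)\<^sup>2)" by (rule sum_mono2) (use I JI in auto)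
    finally have "damp \<eta> (\<Sum>i\<in>I. (D i x)\<^sup>2) \<le> damp \<eta> (\<Sum>i\<in>J. (c i / b) *\<^sub>R ?y i x)"
      using b(2) c0 by (intro damp_antimono \<eta>) (auto intro!: sum_nonneg mult_nonneg_nonneg)
    also have "\<dots> \<le> (\<Sum>i\<in>J. c i / b * damp \<eta> (?y i x))"
      by (rule convex_on_sum[OF JI(2) J0 damp_convex[OF \<eta>] w1]) (use b c0 in auto)
    finally show ?thesis .
  qed
  have id: "integrable (gauss I) (\<lambda>x. damp \<eta> (g x))" if [measurable]: "g \<in> borel_measurable (PiM I (\<lambda>_. borel))" and "\<And>x. g x \<ge> 0" for g
    by (rule G.integrable_const_bound[where B=1]) (use \<eta> that(2) in \<open>auto simp: abs_of_nonneg damp_nonneg damp_le_1\<close>)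
  have idy: "integrable (gauss I) (\<lambda>x. c i / b * damp \<eta> (?y i x))" if "i \<in> J" for i
    using that JI b(2) by (intro integrable_mult_right id) auto
  have "(\<integral>x. damp \<eta> (\<Sum>i\<in>I. (D i x)\<^sup>2) \<partial>gauss I) \<le> (\<integral>x. (\<Sum>i\<in>J. c i / b * damp \<eta> (?y i x)) \<partial>gauss I)"
    by (intro integral_mono id pw Bochner_Integration.integrable_sum idy) (auto intro!: sum_nonneg)
  also have "\<dots> = (\<Sum>i\<in>J. c i / b * (\<integral>x. damp \<eta> (?y i x) \<partial>gauss I))"
    by (subst Bochner_Integration.integral_sum[OF idy]) auto
  also have "\<dots> \<le> (\<Sum>i\<in>J. c i / b * (C * (\<eta> / sqrt b) powr (1 / (2 * real d + 1))))"
  proof (intro sum_mono mult_left_mono)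
    fix i assume i: "i \<in> J"
    hence iI: "i \<in> I" and ci: "c i > 0" by (auto simp: J_def)
    note n = gauss_normalize[OF I D[OF iI] c_def[symmetric] ci]
    have "(\<integral>x. damp (\<eta> / sqrt b) ((1 / sqrt (c i) * D i x)\<^sup>2) \<partial>gauss I) \<le> C * (\<eta> / sqrt b) powr (1 / (2 * real d + 1))"
      using C n I \<eta> b(2) unfolding damp_bound_def by (metis divide_pos_pos real_sqrt_gt_zero)
    thus "(\<integral>x. damp \<eta> (?y i x) \<partial>gauss I) \<le> C * (\<eta> / sqrt b) powr (1 / (2 * real d + 1))"
      by (simp only: damp_scale[OF b(2)])
    show "0 \<le> c i / b" using ci b by simp
  qed
  also have "\<dots> = C * (\<eta> / sqrt b) powr (1 / (2 * real d + 1))"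
    unfolding sum_distrib_right[symmetric] w1 by simp
  finally show ?thesis .
qed

text \<open>By Poincare's inequality the mean squared gradient b is at least v/2, so that
  \<open>\<eta> / sqrt b\<close> is at most twice \<open>\<eta> / sqrt v\<close>; this factor goes
  into the constant. The degree rises by one because \<open>damp_bound\<close> is applied to the
  partial derivatives.\<close>

lemma smooth_of_damp:
  assumes C: "damp_bound TYPE('i) d C"
  shows "\<exists>K. smooth_bound TYPE('i) (Suc d) K"
proof -
  have C0: "C > 0" using C by (simp add: damp_bound_def)
  define K where "K = (6 * real (Suc d) + 2) + 4 * C"
  have "smooth_bound TYPE('i) (Suc d) K"
    unfolding smooth_bound_def
  proof (intro conjI allI impI)
    show "K > 0" using C0 by (simp add: K_def add_pos_pos)
    fix I :: "'i set" and f v \<phi> \<phi>' B L \<eta>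
    assume I: "finite I" and f: "gpoly I (Suc d) f" and v: "v = (\<integral>x. (f x)\<^sup>2 \<partial>gauss I) - (\<integral>x. f x \<partial>gauss I)\<^sup>2" "v > 0"
      and \<phi>: "\<forall>x. (\<phi> has_real_derivative \<phi>' x) (at x)" "continuous_on UNIV \<phi>'" "\<forall>x. \<bar>\<phi> x\<bar> \<le> B" "\<forall>x. \<bar>\<phi>' x\<bar> \<le> L" and \<eta>: "\<eta> > (0::real)"
    have B0: "B \<ge> 0" and L0: "L \<ge> 0" using \<phi>(3,4) abs_ge_zero order.trans by blast+
    obtain D where D: "has_grad I f D" "\<And>i. i \<in> I \<Longrightarrow> gpoly I d (D i)" using gpoly_has_grad[OF I f] by auto
    define b where "b = (\<integral>x. (\<Sum>i\<in>I. (D i x)\<^sup>2) \<partial>gauss I)"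
    have vb: "v \<le> 2 * b" unfolding v(1) b_def by (rule gauss_poincare[OF I f D])
    hence b0: "b > 0" using v(2) by linarith
    let ?s = "1 / (2 * real d + 1)"
    have s: "0 < ?s" "?s \<le> 1" by auto
    have "(\<integral>x. \<phi>' (f x) \<partial>gauss I) \<le> (6 * real (Suc d) + 2) * B / \<eta> + 2 * L * (\<integral>x. damp \<eta> (\<Sum>i\<in>I. (D i x)\<^sup>2) \<partial>gauss I)"
      using \<phi> by (intro gauss_smooth[OF I f D _ \<phi>(2) _ _ \<eta>]) auto
    also have "\<dots> \<le> (6 * real (Suc d) + 2) * B / \<eta> + 2 * L * (C * (\<eta> / sqrt b) powr ?s)"
      using L0 by (intro add_left_mono mult_left_mono gauss_damped_gradient[OF C I D(2) b_def b0 \<eta>]) auto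
    also have "\<dots> \<le> (6 * real (Suc d) + 2) * B / \<eta> + 2 * L * (C * (2 * (\<eta> / sqrt v) powr ?s))"
    proof -
      have "sqrt v \<le> sqrt (2 * b)" using vb by simp
      also have "\<dots> = sqrt 2 * sqrt b" by (simp add: real_sqrt_mult)
      also have "\<dots> \<le> 2 * sqrt b" using b0 by (intro mult_right_mono real_le_lsqrt) auto
      finally have "\<eta> / sqrt b \<le> 2 * (\<eta> / sqrt v)" using b0 v(2) \<eta> by (simp add: field_simps)
      hence "(\<eta> / sqrt b) powr ?s \<le> (2 * (\<eta> / sqrt v)) powr ?s" using \<eta> b0 by (intro powr_mono2) auto
      also have "\<dots> = 2 powr ?s * (\<eta> / sqrt v) powr ?s" by (rule powr_mult)
      also have "\<dots> \<le> 2 * (\<eta> / sqrt v) powr ?s" using powr_mono[of ?s 1 2] s by (intro mult_right_mono) auto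
      finally show ?thesis using L0 C0 by (intro add_left_mono mult_left_mono) auto
    qed
    also have "\<dots> = (6 * real (Suc d) + 2) * (B / \<eta>) + 4 * C * (L * (\<eta> / sqrt v) powr ?s)" by (simp add: algebra_simps add_divide_distrib)
    also have "\<dots> \<le> K * (B / \<eta>) + K * (L * (\<eta> / sqrt v) powr ?s)"
    proof (rule add_mono)
      have "6 * real (Suc d) + 2 \<le> K" "4 * C \<le> K" using C0 by (auto simp: K_def)
      thus "(6 * real (Suc d) + 2) * (B / \<eta>) \<le> K * (B / \<eta>)" "4 * C * (L * (\<eta> / sqrt v) powr ?s) \<le> K * (L * (\<eta> / sqrt v) powr ?s)"
        using B0 \<eta> L0 by (auto intro!: mult_right_mono divide_right_mono)
    qed
    finally show "(\<integral>x. \<phi>' (f x) \<partial>gauss I) \<le> K * (B / \<eta> + L * (\<eta> / sqrt v) powr (1 / (2 * real (Suc d) - 1)))"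
      by (simp add: ring_distribs add.commute)
  qed
  thus ?thesis ..
qed

text \<open>If the variance is at most \<open>\<delta> powr w\<close>, then \<open>f\<close> concentrates around its mean, which is not small,
  and Chebyshev's inequality suffices; otherwise \<open>smooth_bound\<close> is applied to the arctangent.\<close>

lemma small_ball_of_smooth:
  assumes K: "smooth_bound TYPE('i) d K" and d: "d \<ge> 1" and I: "finite (I::'i set)" and f: "gpoly I d f"
    and n: "(\<integral>x. (f x)\<^sup>2 \<partial>gauss I) = 1" and \<delta>: "\<delta> > 0"
  shows "measure (gauss I) {x \<in> space (gauss I). \<bar>f x\<bar> \<le> \<delta>} \<le> (25 + 6 * K) * \<delta> powr (1 / (2 * real d + 1/2))"
proof -
  interpret G: prob_space "gauss I" by (rule prob_space_gauss)
  note [measurable] = gpoly_measurable[OF f]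
  \<comment> \<open>w solves \<open>(1 - w - w / 2) / (2 * d - 1) = w\<close>: with
    \<open>\<eta> = \<delta> powr (1 - w)\<close> and a variance above
    \<open>\<delta> powr w\<close>, both terms of \<open>smooth_bound\<close> are of order
    \<open>\<delta> powr w\<close>.\<close>
  define w where "w = 1 / (2 * real d + 1/2)"
  have w: "0 < w" "w \<le> 1" using d by (auto simp: w_def)
  have K0: "K > 0" using K by (simp add: smooth_bound_def)
  let ?P = "measure (gauss I) {x \<in> space (gauss I). \<bar>f x\<bar> \<le> \<delta>}"
  define c where "c = (\<integral>x. f x \<partial>gauss I)"
  define v where "v = (\<integral>x. (f x)\<^sup>2 \<partial>gauss I) - c\<^sup>2"
  have v1: "v = 1 - c\<^sup>2" by (simp add: v_def n)
  have if1: "integrable (gauss I) f" by (rule gpoly_integrable[OF I f])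
  have if2: "integrable (gauss I) (\<lambda>x. (f x)\<^sup>2)" using gpoly_integrable_even[OF I f, of 1] by simp
  have goal: "?P \<le> (25 + 6 * K) * \<delta> powr w" if "?P \<le> a * \<delta> powr w" "a \<le> 25 + 6 * K" for a
    using order.trans[OF that(1) mult_right_mono[OF that(2)]] by simp
  have "?P \<le> (25 + 6 * K) * \<delta> powr w"
  proof (cases "\<delta> powr w > 1/2")
    case True
    have "?P \<le> 2 * \<delta> powr w" using True G.prob_le_1[of "{x \<in> space (gauss I). \<bar>f x\<bar> \<le> \<delta>}"] by linarith
    thus ?thesis using goal[of 2] K0 by simp
  next
    case False
    have \<delta>1: "\<delta> < 1"
    proof (rule ccontr)
      assume "\<not> \<delta> < 1"
      hence "\<delta> powr w \<ge> 1" using ge_one_powr_ge_zero[of \<delta> w] w by simp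
      thus False using False by simp
    qed
    have \<delta>w: "\<delta> \<le> \<delta> powr w" using powr_mono'[of w 1 \<delta>] w \<delta> \<delta>1 by simp
    show ?thesis
    proof (cases "v \<le> \<delta> powr w")
      case True
      have "v = (\<integral>x. (f x - c)\<^sup>2 \<partial>gauss I)"
        using G.variance_eq[OF if1 if2] by (simp add: v_def c_def)
      have "c\<^sup>2 \<ge> 1/2" using True False v1 by linarith
      \<comment> \<open>The mean is at least 0.7 in modulus while f is at most
        \<open>\<delta> \<le> 1/2\<close> on the small ball, so f deviates there from its mean by at
        least 0.2. The factor 25 is 1/0.2^2.\<close>
      hence c7: "\<bar>c\<bar> \<ge> 0.7" using power2_le_imp_le[of "0.7" "\<bar>c\<bar>"] by (simp add: power2_eq_square)
      have "?P \<le> measure (gauss I) {x \<in> space (gauss I). 0.2 \<le> \<bar>f x - c\<bar>}"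
      proof (rule G.finite_measure_mono)
        show "{x \<in> space (gauss I). \<bar>f x\<bar> \<le> \<delta>} \<subseteq> {x \<in> space (gauss I). 0.2 \<le> \<bar>f x - c\<bar>}"
        proof
          fix x assume x: "x \<in> {x \<in> space (gauss I). \<bar>f x\<bar> \<le> \<delta>}"
          hence "\<bar>f x\<bar> \<le> 0.5" using \<delta>w False by auto
          hence "0.2 \<le> \<bar>f x - c\<bar>" using c7 by linarith
          thus "x \<in> {x \<in> space (gauss I). 0.2 \<le> \<bar>f x - c\<bar>}" using x by auto
        qed
        have "(\<lambda>x. \<bar>f x - c\<bar>) \<in> borel_measurable (gauss I)" by simp
        thus "{x \<in> space (gauss I). 0.2 \<le> \<bar>f x - c\<bar>} \<in> G.events" by (rule borel_measurable_le[OF borel_measurable_const])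
      qed
      also have "\<dots> \<le> v / 0.2\<^sup>2"
        using G.Chebyshev_inequality[of f "0.2"] if2 G.variance_eq[OF if1 if2] by (simp add: v_def c_def)
      also have "\<dots> \<le> 25 * \<delta> powr w" using True by (simp add: power2_eq_square)
      finally show ?thesis using goal[of 25] K0 by simp
    next
      case False
      hence vd: "v > \<delta> powr w" by simp
      hence v0: "v > 0" using powr_ge_zero[of \<delta> w] by linarith
      define \<eta> where "\<eta> = \<delta> powr (1 - w)"
      have \<eta>0: "\<eta> > 0" using \<delta> by (simp add: \<eta>_def)
      \<comment> \<open>\<open>?\<phi>'\<close> is at least 1/2 on the small ball, so that twice its
        mean bounds the probability, and its antiderivative is of size
        \<open>\<delta>\<close>.\<close>
      let ?\<phi> = "\<lambda>x. \<delta> * arctan (x / \<delta>)" and ?\<phi>' = "\<lambda>x. \<delta>\<^sup>2 / (\<delta>\<^sup>2 + x\<^sup>2)"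
      have pos: "\<delta>\<^sup>2 + x\<^sup>2 > 0" for x using \<delta> by (simp add: add_pos_nonneg)
      hence ne: "\<delta>\<^sup>2 + x\<^sup>2 \<noteq> 0" for x by (metis less_irrefl)
      have 1: "\<forall>x. (?\<phi> has_real_derivative ?\<phi>' x) (at x)"
      proof
        fix x
        have "(?\<phi> has_real_derivative \<delta> * (inverse (1 + (x / \<delta>)\<^sup>2) * (1 / \<delta>))) (at x)"
          using \<delta> by (auto intro!: derivative_eq_intros)
        moreover have "\<delta> * (inverse (1 + (x / \<delta>)\<^sup>2) * (1 / \<delta>)) = ?\<phi>' x"
          using \<delta> ne[of x] by (simp add: field_simps power2_eq_square)
        ultimately show "(?\<phi> has_real_derivative ?\<phi>' x) (at x)" by simp
      qed
      have 2: "continuous_on UNIV ?\<phi>'" by (intro continuous_intros) (use ne in auto)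
      have 3: "\<forall>x. \<bar>?\<phi> x\<bar> \<le> 2 * \<delta>"
      proof
        fix x
        have "\<bar>arctan (x / \<delta>)\<bar> \<le> 2" using arctan_bounded[of "x / \<delta>"] pi_less_4 by linarith
        thus "\<bar>?\<phi> x\<bar> \<le> 2 * \<delta>" using \<delta> by (simp add: abs_mult)
      qed
      have 4: "\<forall>x. \<bar>?\<phi>' x\<bar> \<le> 1" using pos by (auto simp: divide_le_eq_1 less_imp_le abs_of_nonneg)
      have "(\<integral>x. ?\<phi>' (f x) \<partial>gauss I) \<le> K * (2 * \<delta> / \<eta> + 1 * (\<eta> / sqrt v) powr (1 / (2 * real d - 1)))"
        using K[unfolded smooth_bound_def, THEN conjunct2, rule_format, OF I f v_def[unfolded c_def] v0 1[rule_format] 2 3[rule_format] 4[rule_format] \<eta>0] .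
      also have "2 * \<delta> / \<eta> = 2 * \<delta> powr w"
        using \<delta> by (simp add: \<eta>_def powr_diff field_simps)
      also have "(\<eta> / sqrt v) powr (1 / (2 * real d - 1)) \<le> \<delta> powr w"
      proof -
        have "sqrt v \<ge> \<delta> powr (w / 2)" using vd by (intro real_le_rsqrt) (simp add: power2_eq_square flip: powr_add)
        hence "\<eta> / sqrt v \<le> \<eta> / \<delta> powr (w / 2)" using \<eta>0 \<delta> v0 by (intro divide_left_mono) auto
        also have "\<dots> = \<delta> powr (1 - w - w / 2)" unfolding \<eta>_def by (rule powr_diff[symmetric])
        finally have "(\<eta> / sqrt v) powr (1 / (2 * real d - 1)) \<le> (\<delta> powr (1 - w - w / 2)) powr (1 / (2 * real d - 1))"
          using d \<eta>0 v0 by (intro powr_mono2) auto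
        also have "\<dots> = \<delta> powr ((1 - w - w / 2) * (1 / (2 * real d - 1)))" by (simp add: powr_powr)
        also have "(1 - w - w / 2) * (1 / (2 * real d - 1)) = w"
          using d by (simp add: w_def divide_simps) (simp add: algebra_simps)
        finally show ?thesis .
      qed
      finally have m: "(\<integral>x. ?\<phi>' (f x) \<partial>gauss I) \<le> K * (3 * \<delta> powr w)"
        using K0 by (simp add: ring_distribs mult_left_mono)
      have ip: "integrable (gauss I) (\<lambda>x. ?\<phi>' (f x))"
        by (rule G.integrable_const_bound[where B=1]) (use 4 in auto)
      have "?P = (\<integral>x. indicator {x \<in> space (gauss I). \<bar>f x\<bar> \<le> \<delta>} x \<partial>gauss I)"
      proof -
        have "{x \<in> space (gauss I). \<bar>f x\<bar> \<le> \<delta>} \<inter> space (gauss I) = {x \<in> space (gauss I). \<bar>f x\<bar> \<le> \<delta>}" by auto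
        thus ?thesis by simp
      qed
      also have "\<dots> \<le> (\<integral>x. 2 * ?\<phi>' (f x) \<partial>gauss I)"
      proof (rule integral_mono)
        show "integrable (gauss I) (\<lambda>x. indicator {x \<in> space (gauss I). \<bar>f x\<bar> \<le> \<delta>} x :: real)"
          by (rule G.integrable_const_bound[where B=1]) (auto simp: indicator_def)
        show "integrable (gauss I) (\<lambda>x. 2 * ?\<phi>' (f x))" by (rule integrable_mult_right[OF ip])
        fix x
        show "indicator {x \<in> space (gauss I). \<bar>f x\<bar> \<le> \<delta>} x \<le> 2 * ?\<phi>' (f x)"
        proof (cases "\<bar>f x\<bar> \<le> \<delta>")
          case True
          have "(f x)\<^sup>2 \<le> \<delta>\<^sup>2" using True power_mono[of "\<bar>f x\<bar>" \<delta> 2] by simp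
          hence "1 \<le> 2 * ?\<phi>' (f x)" using pos[of "f x"] by (simp add: field_simps)
          thus ?thesis by (auto simp: indicator_def)
        next
          case False
          thus ?thesis using pos[of "f x"] by (simp add: indicator_def less_imp_le)
        qed
      qed
      also have "\<dots> \<le> 6 * K * \<delta> powr w" unfolding integral_mult_right_zero using m by simp
      finally show ?thesis using goal[of "6 * K"] by simp
    qed
  qed
  thus ?thesis by (simp add: w_def)
qed

text \<open>The mean of \<open>damp\<close> is split at two levels of f: it is at most 1 below d1,
  at most \<open>\<eta> / d1\<close> between d1 and d2, and at most \<open>\<eta> / d2\<close> above
  d2. One level alone would balance at the exponent 1/(2d + 3/2); the second level reaches 1/(2d +
  1).\<close>

lemma damp_of_smooth:
  assumes K: "smooth_bound TYPE('i) d K" and d: "d \<ge> 1"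
  shows "\<exists>C. damp_bound TYPE('i) d C"
proof -
  have K0: "K > 0" using K by (simp add: smooth_bound_def)
  define C' where "C' = 25 + 6 * K"
  have C'0: "C' > 0" using K0 by (simp add: C'_def)
  define w where "w = 1 / (2 * real d + 1/2)"
  define e where "e = 1 / (2 * real d + 1)"
  have w0: "w > 0" and e0: "e > 0" "e \<le> 1" using d by (auto simp: w_def e_def)
  have "damp_bound TYPE('i) d (2 * C' + 1)"
    unfolding damp_bound_def
  proof (intro conjI allI impI)
    show "2 * C' + 1 > 0" using C'0 by simp
    fix I :: "'i set" and f and \<eta> :: real
    assume I: "finite I" and f: "gpoly I d f" and n: "(\<integral>x. (f x)\<^sup>2 \<partial>gauss I) = 1" and \<eta>: "\<eta> > 0"
    interpret G: prob_space "gauss I" by (rule prob_space_gauss)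
    note [measurable] = gpoly_measurable[OF f]
    have idamp: "integrable (gauss I) (\<lambda>x. damp \<eta> ((f x)\<^sup>2))"
      by (rule G.integrable_const_bound[where B=1]) (use \<eta> in \<open>auto simp: abs_of_nonneg damp_nonneg damp_le_1\<close>)
    have "(\<integral>x. damp \<eta> ((f x)\<^sup>2) \<partial>gauss I) \<le> (2 * C' + 1) * \<eta> powr e"
    proof (cases "\<eta> \<ge> 1")
      case True
      have "(\<integral>x. damp \<eta> ((f x)\<^sup>2) \<partial>gauss I) \<le> (\<integral>x. 1 \<partial>gauss I)"
        by (rule integral_mono) (use idamp \<eta> in \<open>auto simp: damp_le_1\<close>)
      also have "\<dots> = 1" by (simp add: G.prob_space)
      also have "\<dots> \<le> 1 * \<eta> powr e" using True e0 ge_one_powr_ge_zero[of \<eta> e] by simp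
      also have "\<dots> \<le> (2 * C' + 1) * \<eta> powr e" using C'0 by (intro mult_right_mono) auto
      finally show ?thesis .
    next
      case False
      \<comment> \<open>With these levels the first and the last part are of order
        \<open>\<eta> powr e\<close>. The middle part gets the exponent
        \<open>e / 2 + (1 - e) * w\<close>, which is at least e because d is at least 1.\<close>
      define d1 where "d1 = \<eta> powr (e / w)"
      define d2 where "d2 = \<eta> powr (1 - e)"
      have d0: "d1 > 0" "d2 > 0" using \<eta> by (auto simp: d1_def d2_def)
      let ?A = "\<lambda>\<delta>. {x \<in> space (gauss I). \<bar>f x\<bar> \<le> \<delta>}"
      have sb: "measure (gauss I) (?A \<delta>) \<le> C' * \<delta> powr w" if "\<delta> > 0" for \<delta>
        using small_ball_of_smooth[OF K d I f n that] by (simp add: C'_def w_def)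
      have iA: "integrable (gauss I) (\<lambda>x. indicator (?A \<delta>) x :: real)" for \<delta>
        by (rule G.integrable_const_bound[where B=1]) (auto simp: indicator_def)
      have "(\<integral>x. damp \<eta> ((f x)\<^sup>2) \<partial>gauss I) \<le> (\<integral>x. indicator (?A d1) x + \<eta> / d1 * indicator (?A d2) x + \<eta> / d2 \<partial>gauss I)"
      proof (rule integral_mono[OF idamp])
        show "integrable (gauss I) (\<lambda>x. indicator (?A d1) x + \<eta> / d1 * indicator (?A d2) x + \<eta> / d2)"
          using iA by auto
        fix x assume x: "x \<in> space (gauss I)"
        consider "\<bar>f x\<bar> \<le> d1" | "d1 < \<bar>f x\<bar>" "\<bar>f x\<bar> \<le> d2" | "d1 < \<bar>f x\<bar>" "d2 < \<bar>f x\<bar>" by linarith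
        thus "damp \<eta> ((f x)\<^sup>2) \<le> indicator (?A d1) x + \<eta> / d1 * indicator (?A d2) x + \<eta> / d2"
        proof cases
          case 1
          have "damp \<eta> ((f x)\<^sup>2) \<le> 1" by (rule damp_le_1[OF \<eta>]) simp
          thus ?thesis using 1 x d0 \<eta> by (simp add: indicator_def add_increasing2)
        next
          case 2
          have "damp \<eta> ((f x)\<^sup>2) \<le> \<eta> / d1" by (rule damp_square_le[OF \<eta> d0(1)]) (use 2 in simp)
          thus ?thesis using 2 x d0 \<eta> by (simp add: indicator_def add_increasing2)
        next
          case 3
          have "damp \<eta> ((f x)\<^sup>2) \<le> \<eta> / d2" by (rule damp_square_le[OF \<eta> d0(2)]) (use 3 in simp)
          thus ?thesis using 3 x d0 \<eta> by (simp add: indicator_def)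
        qed
      qed
      also have "\<dots> = measure (gauss I) (?A d1) + \<eta> / d1 * measure (gauss I) (?A d2) + \<eta> / d2"
      proof -
        have "?A \<delta> \<inter> space (gauss I) = ?A \<delta>" for \<delta> by auto
        thus ?thesis using iA by (simp add: G.prob_space)
      qed
      also have "\<dots> \<le> C' * d1 powr w + \<eta> / d1 * (C' * d2 powr w) + \<eta> / d2"
        using d0 \<eta> by (intro add_mono mult_left_mono sb) auto
      also have "d1 powr w = \<eta> powr e" using w0 by (simp add: d1_def powr_powr)
      also have "\<eta> / d2 = \<eta> powr e" using \<eta> by (simp add: d2_def powr_diff field_simps)
      also have "\<eta> / d1 * (C' * d2 powr w) = C' * \<eta> powr (1 - e / w + (1 - e) * w)"
      proof -
        have "\<eta> / d1 = \<eta> powr (1 - e / w)" using \<eta> by (simp add: d1_def powr_diff)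
        moreover have "d2 powr w = \<eta> powr ((1 - e) * w)" by (simp only: d2_def powr_powr)
        ultimately show ?thesis by (simp only: powr_add mult_ac)
      qed
      also have "\<eta> powr (1 - e / w + (1 - e) * w) \<le> \<eta> powr e"
      proof (rule powr_mono')
        have "1 - e / w = e / 2" by (simp add: e_def w_def field_simps)
        moreover have "(1 - e) * w \<ge> e / 2"
        proof -
          have e1: "1 - e = 2 * real d * e" by (simp add: e_def field_simps)
          have "2 * real d * w \<ge> 1 / 2" using d by (simp add: w_def field_simps)
          hence "e * (1/2) \<le> e * (2 * real d * w)" using e0 by (intro mult_left_mono) auto
          thus ?thesis unfolding e1 by (simp add: mult_ac)
        qed
        ultimately show "e \<le> 1 - e / w + (1 - e) * w" by linarith
      qed (use \<eta> False in auto)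
      finally show ?thesis using C'0 by (simp add: ring_distribs mult_left_mono)
    qed
    thus "(\<integral>x. damp \<eta> ((f x)\<^sup>2) \<partial>gauss I) \<le> (2 * C' + 1) * \<eta> powr (1 / (2 * real d + 1))" by (simp add: e_def)
  qed
  thus ?thesis ..
qed

text \<open>\<open>smooth_of_damp\<close> raises the degree through the gradient, and
  \<open>damp_of_smooth\<close> returns to the small values of the polynomial itself. In degree 0,
  unit norm means a constant with square 1, where \<open>damp\<close> is at most
  \<open>\<eta>\<close>.\<close>

theorem gauss_damp_bound: "\<exists>C. damp_bound TYPE('i) d C"
proof (induction d)
  case 0
  have "damp_bound TYPE('i) 0 1"
    unfolding damp_bound_def
  proof (intro conjI allI impI)
    fix I :: "'i set" and f and \<eta> :: real
    assume I: "finite I" and f: "gpoly I 0 f" and n: "(\<integral>x. (f x)\<^sup>2 \<partial>gauss I) = 1" and \<eta>: "\<eta> > 0"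
    interpret G: prob_space "gauss I" by (rule prob_space_gauss)
    obtain c where c: "f = (\<lambda>x. c)" using gpoly_0D[OF f] by auto
    hence c2: "c\<^sup>2 = 1" using n by (simp add: G.prob_space)
    have "damp \<eta> (1\<^sup>2) \<le> \<eta> / 1" by (rule damp_square_le) (use \<eta> in auto)
    thus "(\<integral>x. damp \<eta> ((f x)\<^sup>2) \<partial>gauss I) \<le> 1 * \<eta> powr (1 / (2 * real 0 + 1))"
      using \<eta> by (simp add: c c2 G.prob_space)
  qed simp
  thus ?case ..
next
  case (Suc d)
  thus ?case using smooth_of_damp damp_of_smooth[of "Suc d"] by (metis le_add1 plus_1_eq_Suc)
qed

corollary gauss_smooth_bound: "d \<ge> 1 \<Longrightarrow> \<exists>K. smooth_bound TYPE('i) d K"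
  using smooth_of_damp gauss_damp_bound[of "d - 1"] by (cases d) auto

section \<open>Wiener chaos elements as limits of Gaussian polynomials\<close>

lemma hermite_poly: "\<exists>q::real poly. degree q \<le> k \<and> (\<forall>x. hermite k x = poly q x)"
proof -
  have "\<exists>q::real poly. degree q \<le> k \<and> (deriv ^^ k) (\<lambda>y::real. exp (- (y\<^sup>2 / 2))) = (\<lambda>x. poly q x * exp (- (x\<^sup>2 / 2)))"
  proof (induction k)
    case 0
    show ?case by (intro exI[of _ 1]) auto
  next
    case (Suc k)
    then obtain q :: "real poly" where q: "degree q \<le> k" "(deriv ^^ k) (\<lambda>y::real. exp (- (y\<^sup>2 / 2))) = (\<lambda>x. poly q x * exp (- (x\<^sup>2 / 2)))" by auto
    let ?q = "pderiv q - pCons 0 q"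
    have "((\<lambda>x. poly q x * exp (- (x\<^sup>2 / 2))) has_real_derivative (poly ?q x * exp (- (x\<^sup>2 / 2)))) (at x)" for x
      by (auto intro!: derivative_eq_intros simp: algebra_simps)
    hence "deriv (\<lambda>x. poly q x * exp (- (x\<^sup>2 / 2))) = (\<lambda>x. poly ?q x * exp (- (x\<^sup>2 / 2)))"
      by (auto intro!: DERIV_imp_deriv)
    moreover have "degree ?q \<le> Suc k"
      by (rule degree_diff_le) (use q(1) in \<open>auto simp: degree_pderiv degree_pCons_eq_if\<close>)
    ultimately show ?case using q(2) by (intro exI[of _ ?q]) auto
  qed
  then obtain q :: "real poly" where q: "degree q \<le> k" "(deriv ^^ k) (\<lambda>y::real. exp (- (y\<^sup>2 / 2))) = (\<lambda>x. poly q x * exp (- (x\<^sup>2 / 2)))" by auto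
  have "hermite k x = poly (smult ((-1) ^ k) q) x" for x
    unfolding hermite_def q(2) by (simp add: exp_minus_inverse mult_ac)
  thus ?thesis using q(1) by (intro exI[of _ "smult ((-1) ^ k) q"]) auto
qed

text \<open>Gram-Schmidt. It serves to express finitely many correlated variables \<open>X h\<close>
  by independent standard ones.\<close>

lemma orthonormal_span_finite:
  fixes S :: "'h::real_inner set"
  assumes "finite S"
  shows "\<exists>B. finite B \<and> (\<forall>b\<in>B. \<forall>c\<in>B. inner b c = (if b = c then 1 else 0)) \<and> (\<forall>h\<in>S. h = (\<Sum>b\<in>B. inner h b *\<^sub>R b))"
  using assms
proof (induction S rule: finite_induct)
  case empty
  show ?case by (intro exI[of _ "{}"]) auto
next
  case (insert h S)
  then obtain B where B: "finite B" "\<And>b c. b\<in>B \<Longrightarrow> c\<in>B \<Longrightarrow> inner b c = (if b = c then 1 else 0)" "\<And>h. h\<in>S \<Longrightarrow> h = (\<Sum>b\<in>B. inner h b *\<^sub>R b)" by blast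
  define r where "r = h - (\<Sum>b\<in>B. inner h b *\<^sub>R b)"
  show ?case
  proof (cases "r = 0")
    case True
    thus ?thesis using B by (intro exI[of _ B]) (auto simp: r_def)
  next
    case False
    define e where "e = (1 / norm r) *\<^sub>R r"
    have ee: "inner e e = 1" using False by (simp add: e_def dot_square_norm power2_eq_square)
    have rb: "inner r b = 0" if "b \<in> B" for b
    proof -
      have "inner (\<Sum>c\<in>B. inner h c *\<^sub>R c) b = (\<Sum>c\<in>B. if c = b then inner h c else 0)"
        unfolding inner_sum_left by (rule sum.cong) (use B(2) that in auto)
      thus ?thesis using B(1) that by (simp add: r_def inner_diff_left)
    qed
    have eb: "inner e b = 0" "inner b e = 0" if "b \<in> B" for b using rb[OF that] by (auto simp: e_def inner_commute)
    have eB: "e \<notin> B" using eb ee by force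
    have se: "inner (\<Sum>b\<in>B. a b *\<^sub>R b) e = 0" for a unfolding inner_sum_left by (rule sum.neutral) (use eb in auto)
    have he: "inner h e *\<^sub>R e = r"
    proof -
      have "inner h e = inner r e" using se[of "inner h"] by (simp add: r_def inner_diff_left)
      also have "\<dots> = norm r" using False by (simp add: e_def dot_square_norm power2_eq_square)
      finally show ?thesis using False by (simp add: e_def)
    qed
    show ?thesis
    proof (intro exI[of _ "insert e B"] conjI ballI)
      show "finite (insert e B)" using B(1) by simp
      show "inner b c = (if b = c then 1 else 0)" if "b \<in> insert e B" "c \<in> insert e B" for b c
        using that B(2) eb ee eB by auto
      fix g assume "g \<in> insert h S"
      thus "g = (\<Sum>b\<in>insert e B. inner g b *\<^sub>R b)"
      proof
        assume "g = h"
        thus ?thesis using B(1) eB he by (simp add: r_def)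
      next
        assume g: "g \<in> S"
        have "inner g e = 0" using se[of "inner g"] B(3)[OF g] by metis
        thus ?thesis using B(1) eB B(3)[OF g] by simp
      qed
    qed
  qed
qed

text \<open>The point mass and the laws with density become one case, namely a scaled standard
  normal variable with a scale that may be 0.\<close>

lemma (in prob_space) centered_gaussian_distr:
  assumes "centered_gaussian M Y"
  shows "\<exists>\<sigma>. distr M borel Y = distr std_normal_distribution borel (\<lambda>x. \<sigma> * x)"
proof -
  interpret N: prob_space std_normal_distribution by (rule prob_space_std_normal)
  have Y[measurable]: "Y \<in> borel_measurable M" using assms by (simp add: centered_gaussian_def)
  from assms consider "AE \<omega> in M. Y \<omega> = 0" | \<sigma> where "\<sigma> > 0" "distributed M lborel Y (normal_density 0 \<sigma>)"
    unfolding centered_gaussian_def by blast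
  thus ?thesis
  proof cases
    case 1
    have "distr M borel Y = distr M borel (\<lambda>_. 0)" by (rule distr_cong_AE) (use 1 in auto)
    also have "\<dots> = distr std_normal_distribution borel (\<lambda>x. 0 * x)"
      by (rule measure_eqI) (auto simp: emeasure_distr emeasure_space_1 N.emeasure_space_1[simplified])
    finally show ?thesis ..
  next
    case 2
    have "distributed M lborel (\<lambda>x. Y x / \<sigma>) std_normal_density"
      using normal_standard_normal_convert[OF 2(1), of Y 0] 2(2) by simp
    hence d: "distr M lborel (\<lambda>x. Y x / \<sigma>) = std_normal_distribution" by (simp add: distributed_def)
    have "distr std_normal_distribution borel (\<lambda>x. \<sigma> * x) = distr M borel ((\<lambda>x. \<sigma> * x) \<circ> (\<lambda>x. Y x / \<sigma>))"
      unfolding d[symmetric] by (rule distr_distr) auto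
    also have "\<dots> = distr M borel Y" using 2(1) by (simp add: o_def)
    finally show ?thesis by metis
  qed
qed

lemma (in prob_space) centered_gaussian_props:
  assumes "centered_gaussian M Y"
  shows "integrable M (\<lambda>\<omega>. (Y \<omega>)\<^sup>2)" and "(CLINT \<omega>|M. iexp (Y \<omega>)) = of_real (exp (- (expectation (\<lambda>\<omega>. (Y \<omega>)\<^sup>2)) / 2))"
proof -
  have Y[measurable]: "Y \<in> borel_measurable M" using assms by (simp add: centered_gaussian_def)
  obtain \<sigma> where d: "distr M borel Y = distr std_normal_distribution borel (\<lambda>x. \<sigma> * x)"
    using centered_gaussian_distr[OF assms] by blast
  have i: "integrable std_normal_distribution (\<lambda>x. x\<^sup>2)" by (rule integrable_std_normal_distribution_moment)
  have "integrable (distr M borel Y) (\<lambda>y. y\<^sup>2)"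
    unfolding d by (subst integrable_distr_eq) (use i in \<open>auto simp: power_mult_distrib\<close>)
  thus "integrable M (\<lambda>\<omega>. (Y \<omega>)\<^sup>2)" by (subst (asm) integrable_distr_eq) auto
  have "expectation (\<lambda>\<omega>. (Y \<omega>)\<^sup>2) = (LINT y|distr M borel Y. y\<^sup>2)" by (rule integral_distr[symmetric]) auto
  also have "\<dots> = (LINT x|std_normal_distribution. (\<sigma> * x)\<^sup>2)" unfolding d by (rule integral_distr) auto
  also have "\<dots> = \<sigma>\<^sup>2" using std_normal_distribution_even_moments(1)[of 1] by (simp add: power_mult_distrib)
  finally have e: "expectation (\<lambda>\<omega>. (Y \<omega>)\<^sup>2) = \<sigma>\<^sup>2" .
  have "(CLINT \<omega>|M. iexp (Y \<omega>)) = (CLINT y|distr M borel Y. iexp y)" by (rule integral_distr[symmetric]) auto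
  also have "\<dots> = (CLINT x|std_normal_distribution. iexp (\<sigma> * x))" unfolding d by (rule integral_distr) auto
  also have "\<dots> = of_real (exp (- \<sigma>\<^sup>2 / 2))" using fun_cong[OF char_std_normal_distribution, of \<sigma>] by (simp add: char_def)
  finally show "(CLINT \<omega>|M. iexp (Y \<omega>)) = of_real (exp (- (expectation (\<lambda>\<omega>. (Y \<omega>)\<^sup>2)) / 2))" unfolding e .
qed

section \<open>Finite orthonormal coordinates for the isonormal process\<close>

context isonormal_gaussian_process
begin

lemma X_gaussian: "centered_gaussian M (X h)"
  using gaussian[of "{h}" "\<lambda>_. 1"] by simp

lemma X_measurable[measurable]: "X h \<in> borel_measurable M"
  using X_gaussian by (simp add: centered_gaussian_def)

lemma X_integrable_mult: "integrable M (\<lambda>\<omega>. X h \<omega> * X g \<omega>)"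
proof (rule Bochner_Integration.integrable_bound)
  show "integrable M (\<lambda>\<omega>. (X h \<omega>)\<^sup>2 + (X g \<omega>)\<^sup>2)" using centered_gaussian_props(1)[OF X_gaussian] by auto
  have "\<bar>a * b\<bar> \<le> a\<^sup>2 + b\<^sup>2" for a b :: real
  proof -
    have "2 * \<bar>a\<bar> * \<bar>b\<bar> \<le> \<bar>a\<bar>\<^sup>2 + \<bar>b\<bar>\<^sup>2" by (rule sum_squares_bound)
    moreover have "0 \<le> \<bar>a\<bar> * \<bar>b\<bar>" by simp
    ultimately show ?thesis unfolding abs_mult power2_abs by linarith
  qed
  thus "AE \<omega> in M. norm (X h \<omega> * X g \<omega>) \<le> norm ((X h \<omega>)\<^sup>2 + (X g \<omega>)\<^sup>2)" by auto
qed auto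

lemma X_second_moment:
  assumes "finite S"
  shows "expectation (\<lambda>\<omega>. (\<Sum>h\<in>S. c h * X h \<omega>)\<^sup>2) = (norm (\<Sum>h\<in>S. c h *\<^sub>R h))\<^sup>2"
proof -
  have "(\<lambda>\<omega>. (\<Sum>h\<in>S. c h * X h \<omega>)\<^sup>2) = (\<lambda>\<omega>. \<Sum>h\<in>S. \<Sum>g\<in>S. (c h * c g) * (X h \<omega> * X g \<omega>))"
    by (simp add: power2_eq_square sum_product mult_ac)
  hence "expectation (\<lambda>\<omega>. (\<Sum>h\<in>S. c h * X h \<omega>)\<^sup>2) = (\<Sum>h\<in>S. \<Sum>g\<in>S. (c h * c g) * inner h g)"
    using X_integrable_mult by (simp add: Bochner_Integration.integral_sum covariance)
  also have "\<dots> = (norm (\<Sum>h\<in>S. c h *\<^sub>R h))\<^sup>2"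
    by (simp add: dot_square_norm[symmetric] inner_sum_left inner_sum_right sum_distrib_left inner_commute mult_ac)
  finally show ?thesis .
qed

text \<open>X is linear up to null sets only: the second moment of the difference is the squared
  norm of the corresponding difference of vectors, which is 0. The case \<open>h \<in> B\<close> is
  separate because a finite combination over a set can give h only one coefficient.\<close>

lemma X_expand:
  assumes B: "finite B" "\<And>b c. b\<in>B \<Longrightarrow> c\<in>B \<Longrightarrow> inner b c = (if b = c then 1 else 0)" and h: "h = (\<Sum>b\<in>B. inner h b *\<^sub>R b)"
  shows "AE \<omega> in M. X h \<omega> = (\<Sum>b\<in>B. inner h b * X b \<omega>)"
proof (cases "h \<in> B")
  case True
  have "(\<Sum>b\<in>B. inner h b * X b \<omega>) = (\<Sum>b\<in>B. if b = h then X b \<omega> else 0)" for \<omega>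
    by (rule sum.cong) (use B(2) True in auto)
  thus ?thesis using B(1) True by simp
next
  case False
  let ?c = "\<lambda>b. if b = h then -1 else inner h b"
  have e: "(\<Sum>b\<in>insert h B. ?c b * X b \<omega>) = (\<Sum>b\<in>B. inner h b * X b \<omega>) - X h \<omega>" for \<omega>
  proof -
    have "(\<Sum>b\<in>B. ?c b * X b \<omega>) = (\<Sum>b\<in>B. inner h b * X b \<omega>)" by (rule sum.cong) (use False in auto)
    thus ?thesis using False B(1) by simp
  qed
  have "(\<Sum>b\<in>insert h B. ?c b *\<^sub>R b) = (\<Sum>b\<in>B. inner h b *\<^sub>R b) - h"
  proof -
    have "(\<Sum>b\<in>B. ?c b *\<^sub>R b) = (\<Sum>b\<in>B. inner h b *\<^sub>R b)" by (rule sum.cong) (use False in auto)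
    thus ?thesis using False B(1) by simp
  qed
  hence "expectation (\<lambda>\<omega>. ((\<Sum>b\<in>B. inner h b * X b \<omega>) - X h \<omega>)\<^sup>2) = 0"
    using X_second_moment[of "insert h B" ?c] h B(1) unfolding e by simp
  moreover have "integrable M (\<lambda>\<omega>. ((\<Sum>b\<in>B. inner h b * X b \<omega>) - X h \<omega>)\<^sup>2)"
    using centered_gaussian_props(1)[OF gaussian[of "insert h B" ?c]] B(1) unfolding e by simp
  ultimately have "AE \<omega> in M. ((\<Sum>b\<in>B. inner h b * X b \<omega>) - X h \<omega>)\<^sup>2 = 0"
    by (subst (asm) integral_nonneg_eq_0_iff_AE) auto
  thus ?thesis by eventually_elim auto
qed

lemma X_law:
  assumes B: "finite B" "\<And>b c. b\<in>B \<Longrightarrow> c\<in>B \<Longrightarrow> inner b c = (if b = c then 1 else 0)"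
  shows "distr M (gauss B) (\<lambda>\<omega>. \<lambda>b\<in>B. X b \<omega>) = gauss B"
proof (rule distr_gaussian_family[OF B(1) prob_space_axioms])
  fix t
  have "(norm (\<Sum>b\<in>B. t b *\<^sub>R b))\<^sup>2 = (\<Sum>b\<in>B. \<Sum>c\<in>B. t b * (t c * inner b c))"
    by (simp add: dot_square_norm[symmetric] inner_sum_left inner_sum_right sum_distrib_left inner_commute mult.left_commute)
  also have "\<dots> = (\<Sum>b\<in>B. \<Sum>c\<in>B. if c = b then (t b)\<^sup>2 else 0)"
    by (intro sum.cong refl) (auto simp: B(2) power2_eq_square)
  also have "\<dots> = (\<Sum>b\<in>B. (t b)\<^sup>2)" using B(1) by simp
  finally show "(CLINT \<omega>|M. iexp (\<Sum>b\<in>B. t b * X b \<omega>)) = of_real (exp (- (\<Sum>b\<in>B. (t b)\<^sup>2) / 2))"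
    using centered_gaussian_props(2)[OF gaussian[OF B(1)], of t] X_second_moment[OF B(1), of t] by simp
qed auto

text \<open>Only finitely many h occur, so one null set serves for all their expansions, and a
  Hermite polynomial of a linear form is a polynomial of degree at most k.\<close>

lemma hermite_span_gpoly:
  assumes B: "finite B" "\<And>b c. b\<in>B \<Longrightarrow> c\<in>B \<Longrightarrow> inner b c = (if b = c then 1 else 0)"
    and S: "finite S" "\<And>h. h \<in> S \<Longrightarrow> h = (\<Sum>b\<in>B. inner h b *\<^sub>R b)"
  shows "\<exists>f. gpoly B k f \<and> (AE \<omega> in M. (\<Sum>h\<in>S. c h * hermite k (X h \<omega>)) = f (\<lambda>b\<in>B. X b \<omega>))"
proof -
  obtain q :: "real poly" where q: "degree q \<le> k" "\<And>x. hermite k x = poly q x" using hermite_poly[of k] by auto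
  let ?f = "\<lambda>x. \<Sum>h\<in>S. c h * poly q (\<Sum>b\<in>B. inner h b * x b)"
  have "gpoly B (degree q * 1) ?f"
    by (intro gpoly_sum gpoly_cmult gpoly_poly gpoly_linear)
  hence "gpoly B k ?f" by (rule gpoly_mono) (use q(1) in simp)
  moreover have "AE \<omega> in M. \<forall>h\<in>S. X h \<omega> = (\<Sum>b\<in>B. inner h b * X b \<omega>)"
    by (rule AE_finite_allI[OF S(1) X_expand[OF B S(2)]])
  hence "AE \<omega> in M. (\<Sum>h\<in>S. c h * hermite k (X h \<omega>)) = ?f (\<lambda>b\<in>B. X b \<omega>)"
    by eventually_elim (auto simp: q(2) intro!: sum.cong)
  ultimately show ?thesis by blast
qed

text \<open>Each component is approximated in its own chaos, and one orthonormal family is chosen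
  for all the vectors that occur, so that the sum of the approximants is a polynomial in a single
  Gaussian vector.\<close>

lemma wiener_chaos_sum_approx:
  assumes F: "F \<in> wiener_chaos_sum M X p" and \<epsilon>: "\<epsilon> > 0"
  shows "\<exists>B f. finite B \<and> gpoly B p f \<and> distr M (gauss B) (\<lambda>\<omega>. \<lambda>b\<in>B. X b \<omega>) = gauss B \<and>
     (\<integral>\<^sup>+ \<omega>. ennreal ((F \<omega> - f (\<lambda>b\<in>B. X b \<omega>))\<^sup>2) \<partial>M) < ennreal \<epsilon>"
proof -
  obtain G where G: "\<And>k. k \<le> p \<Longrightarrow> G k \<in> wiener_chaos M X k" "AE \<omega> in M. F \<omega> = (\<Sum>k\<le>p. G k \<omega>)" and Fm[measurable]: "F \<in> borel_measurable M"
    using F unfolding wiener_chaos_sum_def by blast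
  have Gm: "G k \<in> borel_measurable M" if "k \<le> p" for k using G(1)[OF that] by (auto simp: wiener_chaos_def split: if_splits)
  obtain c0 where c0: "AE \<omega> in M. G 0 \<omega> = c0" using G(1)[of 0] by (auto simp: wiener_chaos_def)
  \<comment> \<open>Cauchy-Schwarz over the p components costs a factor p, and adding up their
    errors another one; the 1 makes the inequality strict and covers p = 0.\<close>
  define \<epsilon>' where "\<epsilon>' = \<epsilon> / (real p * real p + 1)"
  have p1: "real p * real p + 1 > 0" by (simp add: add_nonneg_pos)
  have \<epsilon>': "\<epsilon>' > 0" using \<epsilon> p1 by (simp add: \<epsilon>'_def)
  have "\<forall>k\<in>{1..p}. \<exists>Sc. finite (fst Sc) \<and> (\<integral>\<^sup>+ \<omega>. ennreal ((G k \<omega> - (\<Sum>h\<in>fst Sc. snd Sc h * hermite k (X h \<omega>)))\<^sup>2) \<partial>M) < ennreal \<epsilon>'"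
  proof
    fix k assume that: "k \<in> {1..p}"
    have "\<exists>Q\<in>hermite_span X k. (\<integral>\<^sup>+ \<omega>. ennreal ((G k \<omega> - Q \<omega>)\<^sup>2) \<partial>M) < ennreal \<epsilon>'"
      using G(1)[of k] that \<epsilon>' by (auto simp: wiener_chaos_def)
    then obtain S c where "finite S" "(\<integral>\<^sup>+ \<omega>. ennreal ((G k \<omega> - (\<Sum>h\<in>S. c h * hermite k (X h \<omega>)))\<^sup>2) \<partial>M) < ennreal \<epsilon>'"
      unfolding hermite_span_def by blast
    thus "\<exists>Sc. finite (fst Sc) \<and> (\<integral>\<^sup>+ \<omega>. ennreal ((G k \<omega> - (\<Sum>h\<in>fst Sc. snd Sc h * hermite k (X h \<omega>)))\<^sup>2) \<partial>M) < ennreal \<epsilon>'"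
      by (intro exI[of _ "(S, c)"]) simp
  qed
  from bchoice[OF this] obtain Sc where Sc: "\<forall>k\<in>{1..p}. finite (fst (Sc k)) \<and> (\<integral>\<^sup>+ \<omega>. ennreal ((G k \<omega> - (\<Sum>h\<in>fst (Sc k). snd (Sc k) h * hermite k (X h \<omega>)))\<^sup>2) \<partial>M) < ennreal \<epsilon>'" ..
  define S where "S k = fst (Sc k)" for k
  define c where "c k = snd (Sc k)" for k
  have S: "\<And>k. k \<in> {1..p} \<Longrightarrow> finite (S k)"
     "\<And>k. k \<in> {1..p} \<Longrightarrow> (\<integral>\<^sup>+ \<omega>. ennreal ((G k \<omega> - (\<Sum>h\<in>S k. c k h * hermite k (X h \<omega>)))\<^sup>2) \<partial>M) < ennreal \<epsilon>'" using Sc by (auto simp: S_def c_def)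
  have "finite (\<Union>k\<in>{1..p}. S k)" using S(1) by auto
  from orthonormal_span_finite[OF this] obtain B where B0: "finite B" "\<forall>b\<in>B. \<forall>c\<in>B. inner b c = (if b = c then 1 else 0)"
    "\<forall>h\<in>(\<Union>k\<in>{1..p}. S k). h = (\<Sum>b\<in>B. inner h b *\<^sub>R b)" by (elim exE conjE)
  have B: "finite B" "\<And>b c. b\<in>B \<Longrightarrow> c\<in>B \<Longrightarrow> inner b c = (if b = c then 1 else 0)"
    "\<And>h k. k \<in> {1..p} \<Longrightarrow> h \<in> S k \<Longrightarrow> h = (\<Sum>b\<in>B. inner h b *\<^sub>R b)"
    using B0(1) B0(2)[rule_format] B0(3)[rule_format, OF UN_I] by (assumption | blast)+
  have "\<forall>k\<in>{1..p}. \<exists>f. gpoly B k f \<and> (AE \<omega> in M. (\<Sum>h\<in>S k. c k h * hermite k (X h \<omega>)) = f (\<lambda>b\<in>B. X b \<omega>))"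
  proof
    fix k assume k: "k \<in> {1..p}"
    show "\<exists>f. gpoly B k f \<and> (AE \<omega> in M. (\<Sum>h\<in>S k. c k h * hermite k (X h \<omega>)) = f (\<lambda>b\<in>B. X b \<omega>))"
      by (rule hermite_span_gpoly[OF B(1) B(2) S(1)[OF k] B(3)[OF k]])
  qed
  from bchoice[OF this] obtain f where f: "\<And>k. k \<in> {1..p} \<Longrightarrow> gpoly B k (f k)"
    "\<And>k. k \<in> {1..p} \<Longrightarrow> AE \<omega> in M. (\<Sum>h\<in>S k. c k h * hermite k (X h \<omega>)) = f k (\<lambda>b\<in>B. X b \<omega>)" by blast
  let ?R = "\<lambda>\<omega>. \<lambda>b\<in>B. X b \<omega>"
  let ?f = "\<lambda>x. c0 + (\<Sum>k\<in>{1..p}. f k x)"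
  have gf: "gpoly B p ?f"
    by (intro gpoly.add gpoly.const gpoly_sum gpoly_mono[OF f(1)]) auto
  have Rm[measurable]: "?R \<in> M \<rightarrow>\<^sub>M PiM B (\<lambda>_. borel)" by (rule measurable_restrict) simp
  have fm[measurable]: "(\<lambda>\<omega>. f k (?R \<omega>)) \<in> borel_measurable M" if "k \<in> {1..p}" for k
    by (rule measurable_compose[OF Rm gpoly_measurable[OF f(1)[OF that]]])
  note [measurable] = Gm
  have 1: "(\<integral>\<^sup>+ \<omega>. ennreal ((G k \<omega> - f k (?R \<omega>))\<^sup>2) \<partial>M) \<le> ennreal \<epsilon>'" if "k \<in> {1..p}" for k
  proof -
    have "(\<integral>\<^sup>+ \<omega>. ennreal ((G k \<omega> - f k (?R \<omega>))\<^sup>2) \<partial>M) = (\<integral>\<^sup>+ \<omega>. ennreal ((G k \<omega> - (\<Sum>h\<in>S k. c k h * hermite k (X h \<omega>)))\<^sup>2) \<partial>M)"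
      by (rule nn_integral_cong_AE) (use f(2)[OF that] in auto)
    thus ?thesis using S(2)[OF that] by simp
  qed
  have "(\<integral>\<^sup>+ \<omega>. ennreal ((F \<omega> - ?f (?R \<omega>))\<^sup>2) \<partial>M) \<le> (\<integral>\<^sup>+ \<omega>. (\<Sum>k\<in>{1..p}. ennreal p * ennreal ((G k \<omega> - f k (?R \<omega>))\<^sup>2)) \<partial>M)"
  proof (rule nn_integral_mono_AE)
    show "AE \<omega> in M. ennreal ((F \<omega> - ?f (?R \<omega>))\<^sup>2) \<le> (\<Sum>k\<in>{1..p}. ennreal p * ennreal ((G k \<omega> - f k (?R \<omega>))\<^sup>2))"
      using G(2) c0
    proof eventually_elim
      case (elim \<omega>)
      have "{..p} = insert 0 {1..p}" by auto
      hence "F \<omega> - ?f (?R \<omega>) = (\<Sum>k\<in>{1..p}. 1 * (G k \<omega> - f k (?R \<omega>)))" using elim by (simp add: sum_subtractf)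
      hence "(F \<omega> - ?f (?R \<omega>))\<^sup>2 \<le> (\<Sum>k\<in>{1..p}. 1\<^sup>2) * (\<Sum>k\<in>{1..p}. (G k \<omega> - f k (?R \<omega>))\<^sup>2)"
        using Cauchy_Schwarz_ineq_sum[of "\<lambda>_. 1" "\<lambda>k. G k \<omega> - f k (?R \<omega>)" "{1..p}"] by simp
      also have "\<dots> = (\<Sum>k\<in>{1..p}. real p * (G k \<omega> - f k (?R \<omega>))\<^sup>2)" by (simp add: sum_distrib_left)
      finally have "ennreal ((F \<omega> - ?f (?R \<omega>))\<^sup>2) \<le> ennreal (\<Sum>k\<in>{1..p}. real p * (G k \<omega> - f k (?R \<omega>))\<^sup>2)" by (rule ennreal_leI)
      also have "\<dots> = (\<Sum>k\<in>{1..p}. ennreal p * ennreal ((G k \<omega> - f k (?R \<omega>))\<^sup>2))"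
        by (subst sum_ennreal[symmetric]) (auto simp: ennreal_mult)
      finally show ?case .
    qed
  qed
  also have "\<dots> = (\<Sum>k\<in>{1..p}. ennreal p * (\<integral>\<^sup>+ \<omega>. ennreal ((G k \<omega> - f k (?R \<omega>))\<^sup>2) \<partial>M))"
    by (subst nn_integral_sum) (auto intro!: sum.cong nn_integral_cmult)
  also have "\<dots> \<le> (\<Sum>k\<in>{1..p}. ennreal p * ennreal \<epsilon>')"
    by (intro sum_mono mult_left_mono 1) auto
  also have "\<dots> = ennreal (real p * (real p * \<epsilon>'))"
    using \<epsilon>' by (simp add: ennreal_mult'[symmetric] ennreal_of_nat_eq_real_of_nat)
  also have "\<dots> < ennreal \<epsilon>"
  proof (rule ennreal_lessI[OF \<epsilon>])
    have "real p * (real p * \<epsilon>') = real p * real p * \<epsilon> / (real p * real p + 1)" by (simp add: \<epsilon>'_def)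
    also have "\<dots> < \<epsilon>" using \<epsilon> p1 by (simp add: divide_less_eq algebra_simps)
    finally show "real p * (real p * \<epsilon>') < \<epsilon>" .
  qed
  finally show ?thesis using B(1) gf X_law[OF B(1,2)] by blast
qed

lemma wiener_chaos_sum_square_integrable:
  assumes F: "F \<in> wiener_chaos_sum M X p"
  shows "F \<in> borel_measurable M" "integrable M (\<lambda>\<omega>. (F \<omega>)\<^sup>2)"
proof -
  show Fm[measurable]: "F \<in> borel_measurable M" using F unfolding wiener_chaos_sum_def by blast
  obtain B f where B: "finite B" "gpoly B p f" "distr M (gauss B) (\<lambda>\<omega>. \<lambda>b\<in>B. X b \<omega>) = gauss B"
     "(\<integral>\<^sup>+ \<omega>. ennreal ((F \<omega> - f (\<lambda>b\<in>B. X b \<omega>))\<^sup>2) \<partial>M) < ennreal 1"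
    using wiener_chaos_sum_approx[OF F zero_less_one] by blast
  let ?R = "\<lambda>\<omega>. \<lambda>b\<in>B. X b \<omega>"
  have Rm[measurable]: "?R \<in> M \<rightarrow>\<^sub>M PiM B (\<lambda>_. borel)" by (rule measurable_restrict) simp
  have fm[measurable]: "(\<lambda>\<omega>. f (?R \<omega>)) \<in> borel_measurable M"
    by (rule measurable_compose[OF Rm gpoly_measurable[OF B(2)]])
  have i1: "integrable M (\<lambda>\<omega>. (F \<omega> - f (?R \<omega>))\<^sup>2)"
    by (rule integrableI_nonneg) (use order.strict_trans[OF B(4)] in auto)
  have "integrable (distr M (gauss B) ?R) (\<lambda>x. (f x)\<^sup>2)"
    unfolding B(3) using gpoly_integrable_even[OF B(1,2), of 1] by simp
  hence i2: "integrable M (\<lambda>\<omega>. (f (?R \<omega>))\<^sup>2)"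
    by (subst (asm) integrable_distr_eq) (use gpoly_measurable[OF B(2)] in auto)
  have b: "a\<^sup>2 \<le> 2 * (a - b)\<^sup>2 + 2 * b\<^sup>2" for a b :: real
    using sum_squares_bound[of "a - b" b] zero_le_power2[of "a - 2 * b"] by (simp add: power2_eq_square algebra_simps)
  show "integrable M (\<lambda>\<omega>. (F \<omega>)\<^sup>2)"
    by (rule Bochner_Integration.integrable_bound[where f="\<lambda>\<omega>. 2 * (F \<omega> - f (?R \<omega>))\<^sup>2 + 2 * (f (?R \<omega>))\<^sup>2"])
       (use i1 i2 b in auto)
qed

end

text \<open>Almost sure convergence along a subsequence serves Fatou's lemma and dominated
  convergence; the convergence of the first two moments serves the right-hand sides of the
  estimates, which contain second moments and variances.\<close>

lemma (in prob_space) L2_approx: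
  assumes F[measurable]: "F \<in> borel_measurable M" and F2: "integrable M (\<lambda>\<omega>. (F \<omega>)\<^sup>2)"
    and Q[measurable]: "\<And>n. Q n \<in> borel_measurable M"
    and close: "\<And>n. (\<integral>\<^sup>+ \<omega>. ennreal ((F \<omega> - Q n \<omega>)\<^sup>2) \<partial>M) < ennreal (1 / real (Suc n))"
  shows "\<exists>r. strict_mono r \<and> (AE \<omega> in M. (\<lambda>n. Q (r n) \<omega>) \<longlonglongrightarrow> F \<omega>)"
    and "(\<lambda>n. expectation (Q n)) \<longlonglongrightarrow> expectation F"
    and "(\<lambda>n. expectation (\<lambda>\<omega>. (Q n \<omega>)\<^sup>2)) \<longlonglongrightarrow> expectation (\<lambda>\<omega>. (F \<omega>)\<^sup>2)"
proof -
  define D where "D n \<omega> = F \<omega> - Q n \<omega>" for n \<omega>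
  have [measurable]: "D n \<in> borel_measurable M" for n unfolding D_def[abs_def] by measurable
  have iD2: "integrable M (\<lambda>\<omega>. (D n \<omega>)\<^sup>2)" for n
    by (rule integrableI_nonneg) (use order.strict_trans[OF close[of n]] in \<open>auto simp: D_def\<close>)
  have D20: "0 \<le> expectation (\<lambda>\<omega>. (D n \<omega>)\<^sup>2)" for n by (rule integral_nonneg_AE) auto
  have eD2: "expectation (\<lambda>\<omega>. (D n \<omega>)\<^sup>2) < 1 / real (Suc n)" for n
  proof -
    have "ennreal (expectation (\<lambda>\<omega>. (D n \<omega>)\<^sup>2)) = (\<integral>\<^sup>+ \<omega>. ennreal ((D n \<omega>)\<^sup>2) \<partial>M)"
      by (rule nn_integral_eq_integral[symmetric, OF iD2]) simp
    hence "ennreal (expectation (\<lambda>\<omega>. (D n \<omega>)\<^sup>2)) < ennreal (1 / real (Suc n))" using close[of n] by (simp add: D_def)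
    thus ?thesis by (subst (asm) ennreal_less_iff[OF D20])
  qed
  have lim0: "(\<lambda>n. 1 / real (Suc n)) \<longlonglongrightarrow> 0" using LIMSEQ_inverse_real_of_nat by (simp add: inverse_eq_divide)
  have limD2: "(\<lambda>n. expectation (\<lambda>\<omega>. (D n \<omega>)\<^sup>2)) \<longlonglongrightarrow> 0"
    by (rule real_tendsto_sandwich[OF _ _ tendsto_const lim0]) (use D20 eD2 in \<open>auto intro!: always_eventually less_imp_le\<close>)
  have iF: "integrable M F" by (rule square_integrable_imp_integrable[OF F F2])
  have iD: "integrable M (D n)" for n by (rule square_integrable_imp_integrable[OF _ iD2]) simp
  show "\<exists>r. strict_mono r \<and> (AE \<omega> in M. (\<lambda>n. Q (r n) \<omega>) \<longlonglongrightarrow> F \<omega>)"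
  proof -
    have "(\<lambda>n. expectation (\<lambda>\<omega>. norm ((D n \<omega>)\<^sup>2))) \<longlonglongrightarrow> 0" using limD2 by simp
    from tendsto_L1_AE_subseq[OF iD2 this] obtain r where r: "strict_mono r" "AE \<omega> in M. (\<lambda>n. (D (r n) \<omega>)\<^sup>2) \<longlonglongrightarrow> 0" by blast
    from r(2) have "AE \<omega> in M. (\<lambda>n. Q (r n) \<omega>) \<longlonglongrightarrow> F \<omega>"
    proof eventually_elim
      case (elim \<omega>)
      hence "(\<lambda>n. sqrt ((D (r n) \<omega>)\<^sup>2)) \<longlonglongrightarrow> sqrt 0" by (rule tendsto_real_sqrt)
      hence "(\<lambda>n. D (r n) \<omega>) \<longlonglongrightarrow> 0" by (simp add: tendsto_rabs_zero_iff)
      hence "(\<lambda>n. F \<omega> - D (r n) \<omega>) \<longlonglongrightarrow> F \<omega> - 0" by (intro tendsto_diff tendsto_const)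
      thus ?case by (simp add: D_def)
    qed
    thus ?thesis using r(1) by blast
  qed
  have t0: "(\<lambda>n. sqrt (1 / real (Suc n))) \<longlonglongrightarrow> 0" using tendsto_real_sqrt[OF lim0] by simp
  have limD: "(\<lambda>n. expectation (D n)) \<longlonglongrightarrow> 0"
  proof (rule Lim_null_comparison[OF _ t0], rule always_eventually, rule allI)
    fix n
    have "0 \<le> variance (D n)" by (rule variance_positive)
    hence "(expectation (D n))\<^sup>2 \<le> 1 / real (Suc n)" using variance_eq[OF iD iD2, of n] eD2[of n] by simp
    thus "norm (expectation (D n)) \<le> sqrt (1 / real (Suc n))" using real_sqrt_le_mono by fastforce
  qed
  have QD: "Q n = (\<lambda>\<omega>. F \<omega> - D n \<omega>)" for n by (auto simp: D_def)
  have "(\<lambda>n. expectation F - expectation (D n)) \<longlonglongrightarrow> expectation F - 0"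
    by (intro tendsto_diff tendsto_const limD)
  thus "(\<lambda>n. expectation (Q n)) \<longlonglongrightarrow> expectation F"
    unfolding QD using iF iD by simp
  have iFD: "integrable M (\<lambda>\<omega>. F \<omega> * D n \<omega>)" and
    bFD: "\<bar>expectation (\<lambda>\<omega>. F \<omega> * D n \<omega>)\<bar> \<le> sqrt (1 / real (Suc n)) * (expectation (\<lambda>\<omega>. (F \<omega>)\<^sup>2) + 1)" for n
  proof -
    \<comment> \<open>The weight in Young's inequality balances the second moment of
      \<open>D n\<close>, which is below \<open>1 / Suc n\<close>: both terms become multiples of
      \<open>?t\<close>, which tends to 0.\<close>
    let ?t = "sqrt (1 / real (Suc n))"
    have t: "?t > 0" by simp
    have b: "\<bar>a * b\<bar> \<le> ?t * a\<^sup>2 + b\<^sup>2 / ?t" for a b :: real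
    proof -
      have "2 * (sqrt ?t * \<bar>a\<bar>) * (\<bar>b\<bar> / sqrt ?t) \<le> (sqrt ?t * \<bar>a\<bar>)\<^sup>2 + (\<bar>b\<bar> / sqrt ?t)\<^sup>2" by (rule sum_squares_bound)
      also have "\<dots> = ?t * a\<^sup>2 + b\<^sup>2 / ?t" using t by (simp add: power_mult_distrib power_divide)
      also have "2 * (sqrt ?t * \<bar>a\<bar>) * (\<bar>b\<bar> / sqrt ?t) = 2 * \<bar>a * b\<bar>" using t by (simp add: abs_mult)
      finally show ?thesis by linarith
    qed
    have i: "integrable M (\<lambda>\<omega>. ?t * (F \<omega>)\<^sup>2 + (D n \<omega>)\<^sup>2 / ?t)" using F2 iD2 by (intro Bochner_Integration.integrable_add integrable_mult_right integrable_divide_zero) auto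
    show iFD: "integrable M (\<lambda>\<omega>. F \<omega> * D n \<omega>)"
      by (rule Bochner_Integration.integrable_bound[OF i]) (use order.trans[OF b abs_ge_self] in auto)
    have "\<bar>expectation (\<lambda>\<omega>. F \<omega> * D n \<omega>)\<bar> \<le> expectation (\<lambda>\<omega>. \<bar>F \<omega> * D n \<omega>\<bar>)" by (rule integral_abs_bound)
    also have "\<dots> \<le> expectation (\<lambda>\<omega>. ?t * (F \<omega>)\<^sup>2 + (D n \<omega>)\<^sup>2 / ?t)"
      by (rule integral_mono[OF integrable_abs[OF iFD] i b])
    also have "\<dots> = ?t * expectation (\<lambda>\<omega>. (F \<omega>)\<^sup>2) + expectation (\<lambda>\<omega>. (D n \<omega>)\<^sup>2) / ?t"
      using F2 iD2 by (subst Bochner_Integration.integral_add) auto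
    also have "\<dots> \<le> ?t * expectation (\<lambda>\<omega>. (F \<omega>)\<^sup>2) + ?t"
    proof -
      have "expectation (\<lambda>\<omega>. (D n \<omega>)\<^sup>2) / ?t \<le> (1 / real (Suc n)) / ?t" using eD2[of n] t by (intro divide_right_mono) auto
      also have "(1 / real (Suc n)) / ?t = ?t" by (rule real_div_sqrt) simp
      finally show ?thesis by simp
    qed
    finally show "\<bar>expectation (\<lambda>\<omega>. F \<omega> * D n \<omega>)\<bar> \<le> ?t * (expectation (\<lambda>\<omega>. (F \<omega>)\<^sup>2) + 1)" by (simp add: ring_distribs)
  qed
  have "(\<lambda>n. sqrt (1 / real (Suc n)) * (expectation (\<lambda>\<omega>. (F \<omega>)\<^sup>2) + 1)) \<longlonglongrightarrow> 0"
    using tendsto_mult_right[OF t0, of "expectation (\<lambda>\<omega>. (F \<omega>)\<^sup>2) + 1"] by simp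
  hence limFD: "(\<lambda>n. expectation (\<lambda>\<omega>. F \<omega> * D n \<omega>)) \<longlonglongrightarrow> 0"
    by (rule Lim_null_comparison[rotated]) (use bFD in auto)
  have e: "expectation (\<lambda>\<omega>. (Q n \<omega>)\<^sup>2) = expectation (\<lambda>\<omega>. (F \<omega>)\<^sup>2) - 2 * expectation (\<lambda>\<omega>. F \<omega> * D n \<omega>) + expectation (\<lambda>\<omega>. (D n \<omega>)\<^sup>2)" for n
  proof -
    have "(\<lambda>\<omega>. (Q n \<omega>)\<^sup>2) = (\<lambda>\<omega>. (F \<omega>)\<^sup>2 - 2 * (F \<omega> * D n \<omega>) + (D n \<omega>)\<^sup>2)"
      unfolding QD by (simp add: power2_diff algebra_simps)
    thus ?thesis using F2 iFD iD2 by simp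
  qed
  have "(\<lambda>n. expectation (\<lambda>\<omega>. (F \<omega>)\<^sup>2) - 2 * expectation (\<lambda>\<omega>. F \<omega> * D n \<omega>) + expectation (\<lambda>\<omega>. (D n \<omega>)\<^sup>2)) \<longlonglongrightarrow> expectation (\<lambda>\<omega>. (F \<omega>)\<^sup>2) - 2 * 0 + 0"
    by (intro tendsto_intros limFD limD2)
  thus "(\<lambda>n. expectation (\<lambda>\<omega>. (Q n \<omega>)\<^sup>2)) \<longlonglongrightarrow> expectation (\<lambda>\<omega>. (F \<omega>)\<^sup>2)" unfolding e by simp
qed

section \<open>Transfer of the estimates to the chaos\<close>

context isonormal_gaussian_process
begin

text \<open>The approximants live on M, where they converge to F, while the estimates apply to their
  laws, which are those of polynomials in Gaussian vectors of varying dimension.\<close>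

definition approx_by_gpoly :: "nat \<Rightarrow> ('a \<Rightarrow> real) \<Rightarrow> (nat \<Rightarrow> 'a \<Rightarrow> real) \<Rightarrow> (nat \<Rightarrow> 'h set) \<Rightarrow> (nat \<Rightarrow> ('h \<Rightarrow> real) \<Rightarrow> real) \<Rightarrow> bool" where
  "approx_by_gpoly p F Q B f \<longleftrightarrow> (\<forall>n. finite (B n) \<and> gpoly (B n) p (f n) \<and> Q n \<in> borel_measurable M \<and>
     distr M borel (Q n) = distr (gauss (B n)) borel (f n)) \<and>
     (AE \<omega> in M. (\<lambda>n. Q n \<omega>) \<longlonglongrightarrow> F \<omega>) \<and> (\<lambda>n. expectation (Q n)) \<longlonglongrightarrow> expectation F \<and>
     (\<lambda>n. expectation (\<lambda>\<omega>. (Q n \<omega>)\<^sup>2)) \<longlonglongrightarrow> expectation (\<lambda>\<omega>. (F \<omega>)\<^sup>2)"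

lemma approx_by_gpolyD:
  assumes "approx_by_gpoly p F Q B f"
  shows "finite (B n)" "gpoly (B n) p (f n)" "Q n \<in> borel_measurable M"
    "distr M borel (Q n) = distr (gauss (B n)) borel (f n)"
    "AE \<omega> in M. (\<lambda>n. Q n \<omega>) \<longlonglongrightarrow> F \<omega>" "(\<lambda>n. expectation (Q n)) \<longlonglongrightarrow> expectation F"
    "(\<lambda>n. expectation (\<lambda>\<omega>. (Q n \<omega>)\<^sup>2)) \<longlonglongrightarrow> expectation (\<lambda>\<omega>. (F \<omega>)\<^sup>2)"
  using assms unfolding approx_by_gpoly_def by blast+

lemma approx_by_gpoly_expectation:
  fixes g :: "real \<Rightarrow> real"
  assumes "approx_by_gpoly p F Q B f" and [measurable]: "g \<in> borel_measurable borel"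
  shows "expectation (\<lambda>\<omega>. g (Q n \<omega>)) = (LINT x|gauss (B n). g (f n x))"
proof -
  note Q = approx_by_gpolyD[OF assms(1)]
  note [measurable] = Q(3) gpoly_measurable[OF Q(2)]
  have "expectation (\<lambda>\<omega>. g (Q n \<omega>)) = (LINT y|distr M borel (Q n). g y)" by (rule integral_distr[symmetric]) auto
  also have "\<dots> = (LINT x|gauss (B n). g (f n x))" unfolding Q(4) by (rule integral_distr) auto
  finally show ?thesis .
qed

lemma wiener_chaos_sum_sequence:
  assumes F: "F \<in> wiener_chaos_sum M X p"
  shows "\<exists>Q B f. approx_by_gpoly p F Q B f"
proof -
  have "\<forall>n. \<exists>Bf. finite (fst Bf) \<and> gpoly (fst Bf) p (snd Bf) \<and> distr M (gauss (fst Bf)) (\<lambda>\<omega>. \<lambda>b\<in>fst Bf. X b \<omega>) = gauss (fst Bf) \<and>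
     (\<integral>\<^sup>+ \<omega>. ennreal ((F \<omega> - snd Bf (\<lambda>b\<in>fst Bf. X b \<omega>))\<^sup>2) \<partial>M) < ennreal (1 / real (Suc n))"
  proof
    fix n
    have "(1 / real (Suc n)) > 0" by simp
    from wiener_chaos_sum_approx[OF F this]
    obtain B f where "finite B \<and> gpoly B p f \<and> distr M (gauss B) (\<lambda>\<omega>. \<lambda>b\<in>B. X b \<omega>) = gauss B \<and>
     (\<integral>\<^sup>+ \<omega>. ennreal ((F \<omega> - f (\<lambda>b\<in>B. X b \<omega>))\<^sup>2) \<partial>M) < ennreal (1 / real (Suc n))" by (elim exE)
    thus "\<exists>Bf. finite (fst Bf) \<and> gpoly (fst Bf) p (snd Bf) \<and> distr M (gauss (fst Bf)) (\<lambda>\<omega>. \<lambda>b\<in>fst Bf. X b \<omega>) = gauss (fst Bf) \<and>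
     (\<integral>\<^sup>+ \<omega>. ennreal ((F \<omega> - snd Bf (\<lambda>b\<in>fst Bf. X b \<omega>))\<^sup>2) \<partial>M) < ennreal (1 / real (Suc n))"
      by (intro exI[of _ "(B, f)"]) simp
  qed
  from choice[OF this] obtain Bf where Bf: "\<forall>n. finite (fst (Bf n)) \<and> gpoly (fst (Bf n)) p (snd (Bf n)) \<and> distr M (gauss (fst (Bf n))) (\<lambda>\<omega>. \<lambda>b\<in>fst (Bf n). X b \<omega>) = gauss (fst (Bf n)) \<and>
     (\<integral>\<^sup>+ \<omega>. ennreal ((F \<omega> - snd (Bf n) (\<lambda>b\<in>fst (Bf n). X b \<omega>))\<^sup>2) \<partial>M) < ennreal (1 / real (Suc n))" ..
  define B where "B n = fst (Bf n)" for n
  define f where "f n = snd (Bf n)" for n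
  define Q where "Q n \<omega> = f n (\<lambda>b\<in>B n. X b \<omega>)" for n \<omega>
  have B: "finite (B n)" "gpoly (B n) p (f n)" "distr M (gauss (B n)) (\<lambda>\<omega>. \<lambda>b\<in>B n. X b \<omega>) = gauss (B n)"
    "(\<integral>\<^sup>+ \<omega>. ennreal ((F \<omega> - Q n \<omega>)\<^sup>2) \<partial>M) < ennreal (1 / real (Suc n))" for n
    using Bf by (auto simp: B_def f_def Q_def)
  have Rm: "(\<lambda>\<omega>. \<lambda>b\<in>B n. X b \<omega>) \<in> M \<rightarrow>\<^sub>M PiM (B n) (\<lambda>_. borel)" for n by (rule measurable_restrict) simp
  have Qm: "Q n \<in> borel_measurable M" for n
    unfolding Q_def[abs_def] by (rule measurable_compose[OF Rm gpoly_measurable[OF B(2)]])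
  have tr: "distr M borel (Q n) = distr (gauss (B n)) borel (f n)" for n
  proof -
    have "distr (gauss (B n)) borel (f n) = distr (distr M (gauss (B n)) (\<lambda>\<omega>. \<lambda>b\<in>B n. X b \<omega>)) borel (f n)" by (simp add: B(3))
    also have "\<dots> = distr M borel (f n \<circ> (\<lambda>\<omega>. \<lambda>b\<in>B n. X b \<omega>))"
      by (rule distr_distr) (use Rm gpoly_measurable[OF B(2)] in auto)
    finally show ?thesis by (simp add: Q_def[abs_def] o_def)
  qed
  note L = L2_approx[OF wiener_chaos_sum_square_integrable[OF F] Qm B(4)]
  from L(1) obtain r where r: "strict_mono r" "AE \<omega> in M. (\<lambda>n. Q (r n) \<omega>) \<longlonglongrightarrow> F \<omega>" by blast
  have "approx_by_gpoly p F (\<lambda>n. Q (r n)) (\<lambda>n. B (r n)) (\<lambda>n. f (r n))"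
    unfolding approx_by_gpoly_def
    using B(1,2) Qm tr r(2) LIMSEQ_subseq_LIMSEQ[OF L(2) r(1)] LIMSEQ_subseq_LIMSEQ[OF L(3) r(1)] by (simp add: o_def)
  thus ?thesis by blast
qed

text \<open>Fatou's lemma along the approximants. The moment of F is a nonnegative integral because
  its finiteness is part of what is shown.\<close>

lemma wiener_chaos_sum_hypercontractive:
  "\<exists>C\<ge>0. \<forall>F\<in>wiener_chaos_sum M X p. (\<integral>\<^sup>+ \<omega>. ennreal (F \<omega> ^ (2 * 2 ^ j)) \<partial>M) \<le> ennreal (C * (expectation (\<lambda>\<omega>. (F \<omega>)\<^sup>2)) ^ (2 ^ j))"
proof -
  obtain C where C: "C \<ge> 0" "\<And>(I::'h set) f. finite I \<Longrightarrow> gpoly I p f \<Longrightarrow>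
     (\<integral>x. f x ^ (2 * 2 ^ j) \<partial>gauss I) \<le> C * (\<integral>x. (f x)\<^sup>2 \<partial>gauss I) ^ (2 ^ j)"
    using gauss_hypercontractive[of p j] by blast
  have "(\<integral>\<^sup>+ \<omega>. ennreal (F \<omega> ^ (2 * 2 ^ j)) \<partial>M) \<le> ennreal (C * (expectation (\<lambda>\<omega>. (F \<omega>)\<^sup>2)) ^ (2 ^ j))"
    if F: "F \<in> wiener_chaos_sum M X p" for F
  proof -
    obtain Q B f where approx: "approx_by_gpoly p F Q B f"
      using wiener_chaos_sum_sequence[OF F] by blast
    note Q = approx_by_gpolyD[OF approx]
    note [measurable] = Q(3)
    let ?k = "2 * 2 ^ j :: nat"
    have pw: "(0::real) \<le> a ^ ?k" for a by (simp add: zero_le_even_power)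
    have b: "(\<integral>\<^sup>+ \<omega>. ennreal (Q n \<omega> ^ ?k) \<partial>M) \<le> ennreal (C * (expectation (\<lambda>\<omega>. (Q n \<omega>)\<^sup>2)) ^ (2 ^ j))" for n
    proof -
      have fm: "f n \<in> gauss (B n) \<rightarrow>\<^sub>M borel" using gpoly_measurable[OF Q(2)] by simp
      have "(\<integral>\<^sup>+ \<omega>. ennreal (Q n \<omega> ^ ?k) \<partial>M) = (\<integral>\<^sup>+ y. ennreal (y ^ ?k) \<partial>distr M borel (Q n))"
        by (rule nn_integral_distr[symmetric]) auto
      also have "\<dots> = (\<integral>\<^sup>+ x. ennreal (f n x ^ ?k) \<partial>gauss (B n))"
        unfolding Q(4) by (rule nn_integral_distr[OF fm]) auto
      also have "\<dots> = ennreal (\<integral>x. f n x ^ ?k \<partial>gauss (B n))"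
        by (rule nn_integral_eq_integral) (use gpoly_integrable_even[OF Q(1,2)] pw in auto)
      also have "\<dots> \<le> ennreal (C * (\<integral>x. (f n x)\<^sup>2 \<partial>gauss (B n)) ^ (2 ^ j))"
        by (intro ennreal_leI C(2) Q)
      also have "(\<integral>x. (f n x)\<^sup>2 \<partial>gauss (B n)) = expectation (\<lambda>\<omega>. (Q n \<omega>)\<^sup>2)" by (rule approx_by_gpoly_expectation[OF approx, symmetric]) simp
      finally show ?thesis .
    qed
    have "(\<integral>\<^sup>+ \<omega>. ennreal (F \<omega> ^ ?k) \<partial>M) = (\<integral>\<^sup>+ \<omega>. liminf (\<lambda>n. ennreal (Q n \<omega> ^ ?k)) \<partial>M)"
    proof (rule nn_integral_cong_AE)
      show "AE \<omega> in M. ennreal (F \<omega> ^ ?k) = liminf (\<lambda>n. ennreal (Q n \<omega> ^ ?k))"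
        using Q(5)
      proof eventually_elim
        case (elim \<omega>)
        hence "(\<lambda>n. ennreal (Q n \<omega> ^ ?k)) \<longlonglongrightarrow> ennreal (F \<omega> ^ ?k)" by (intro tendsto_ennrealI tendsto_power)
        thus ?case by (intro lim_imp_Liminf[symmetric]) auto
      qed
    qed
    also have "\<dots> \<le> liminf (\<lambda>n. \<integral>\<^sup>+ \<omega>. ennreal (Q n \<omega> ^ ?k) \<partial>M)" by (rule nn_integral_liminf) simp
    also have "\<dots> \<le> liminf (\<lambda>n. ennreal (C * (expectation (\<lambda>\<omega>. (Q n \<omega>)\<^sup>2)) ^ (2 ^ j)))"
      by (rule Liminf_mono) (use b in auto)
    also have "\<dots> = ennreal (C * (expectation (\<lambda>\<omega>. (F \<omega>)\<^sup>2)) ^ (2 ^ j))"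
      by (intro lim_imp_Liminf tendsto_ennrealI tendsto_mult tendsto_const tendsto_power Q(7)) simp
    finally show ?thesis .
  qed
  thus ?thesis using C(1) by blast
qed

text \<open>The variances of the approximants converge to v and are thus positive from some index
  on, as \<open>smooth_bound\<close> demands; on the left, \<open>\<phi>'\<close> is bounded and
  continuous, so dominated convergence applies.\<close>

lemma wiener_chaos_sum_smooth:
  assumes p: "p \<ge> 1"
  shows "\<exists>K>0. \<forall>F\<in>wiener_chaos_sum M X p. \<forall>v \<phi> \<phi>' B L \<eta>. v = variance F \<longrightarrow> v > 0 \<longrightarrow>
     (\<forall>x. (\<phi> has_real_derivative \<phi>' x) (at x)) \<longrightarrow> continuous_on UNIV \<phi>' \<longrightarrow>
     (\<forall>x. \<bar>\<phi> x\<bar> \<le> B) \<longrightarrow> (\<forall>x. \<bar>\<phi>' x\<bar> \<le> L) \<longrightarrow> \<eta> > 0 \<longrightarrow>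
     expectation (\<lambda>\<omega>. \<phi>' (F \<omega>)) \<le> K * (B / \<eta> + L * (\<eta> / sqrt v) powr (1 / (2 * real p - 1)))"
proof -
  obtain K where K: "smooth_bound TYPE('h) p K" using gauss_smooth_bound[OF p] by blast
  show ?thesis
  proof (intro exI[of _ K] conjI ballI allI impI)
    show "K > 0" using K by (simp add: smooth_bound_def)
    fix F v and \<phi> \<phi>' :: "real \<Rightarrow> real" and B L \<eta> :: real
    assume F: "F \<in> wiener_chaos_sum M X p" and v: "v = variance F" "v > 0"
      and \<phi>: "\<forall>x. (\<phi> has_real_derivative \<phi>' x) (at x)" "continuous_on UNIV \<phi>'" "\<forall>x. \<bar>\<phi> x\<bar> \<le> B" "\<forall>x. \<bar>\<phi>' x\<bar> \<le> L" and \<eta>: "\<eta> > 0"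
    obtain Q I f where approx: "approx_by_gpoly p F Q I f"
      using wiener_chaos_sum_sequence[OF F] by blast
    note Q = approx_by_gpolyD[OF approx]
    note sq = wiener_chaos_sum_square_integrable[OF F]
    note [measurable] = Q(3) sq(1) borel_measurable_continuous_onI[OF \<phi>(2)]
    define V where "V n = expectation (\<lambda>\<omega>. (Q n \<omega>)\<^sup>2) - (expectation (Q n))\<^sup>2" for n
    have vF: "v = expectation (\<lambda>\<omega>. (F \<omega>)\<^sup>2) - (expectation F)\<^sup>2"
      unfolding v(1) by (rule variance_eq[OF square_integrable_imp_integrable[OF sq] sq(2)])
    have limV: "V \<longlonglongrightarrow> v" unfolding V_def[abs_def] vF by (intro tendsto_intros Q(6,7))
    have ev: "\<forall>\<^sub>F n in sequentially. V n > 0" by (rule order_tendstoD(1)[OF limV v(2)])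
    have c: "(\<lambda>n. \<phi>' (Q n \<omega>)) \<longlonglongrightarrow> \<phi>' (F \<omega>)" if "(\<lambda>n. Q n \<omega>) \<longlonglongrightarrow> F \<omega>" for \<omega>
      using \<phi>(2) that by (intro isCont_tendsto_compose[of "F \<omega>" \<phi>']) (auto simp: continuous_on_eq_continuous_at)
    have lim1: "(\<lambda>n. expectation (\<lambda>\<omega>. \<phi>' (Q n \<omega>))) \<longlonglongrightarrow> expectation (\<lambda>\<omega>. \<phi>' (F \<omega>))"
    proof (rule integral_dominated_convergence[where w="\<lambda>_. L"])
      show "AE \<omega> in M. (\<lambda>n. \<phi>' (Q n \<omega>)) \<longlonglongrightarrow> \<phi>' (F \<omega>)" using Q(5) by eventually_elim (rule c)
    qed (use \<phi>(4) in auto)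
    have lim2: "(\<lambda>n. K * (B / \<eta> + L * (\<eta> / sqrt (V n)) powr (1 / (2 * real p - 1)))) \<longlonglongrightarrow> K * (B / \<eta> + L * (\<eta> / sqrt v) powr (1 / (2 * real p - 1)))"
      using v(2) \<eta> by (intro tendsto_intros limV) auto
    show "expectation (\<lambda>\<omega>. \<phi>' (F \<omega>)) \<le> K * (B / \<eta> + L * (\<eta> / sqrt v) powr (1 / (2 * real p - 1)))"
    proof (rule tendsto_le[OF _ lim2 lim1])
      show "\<forall>\<^sub>F n in sequentially. expectation (\<lambda>\<omega>. \<phi>' (Q n \<omega>)) \<le> K * (B / \<eta> + L * (\<eta> / sqrt (V n)) powr (1 / (2 * real p - 1)))"
        using ev
      proof eventually_elim
        case (elim n)
        have "V n = (\<integral>x. (f n x)\<^sup>2 \<partial>gauss (I n)) - (\<integral>x. f n x \<partial>gauss (I n))\<^sup>2"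
          unfolding V_def using approx_by_gpoly_expectation[OF approx, of "\<lambda>x. x\<^sup>2" n] approx_by_gpoly_expectation[OF approx, of "\<lambda>x. x" n] by simp
        moreover have "expectation (\<lambda>\<omega>. \<phi>' (Q n \<omega>)) = (\<integral>x. \<phi>' (f n x) \<partial>gauss (I n))" by (rule approx_by_gpoly_expectation[OF approx]) simp
        ultimately show ?case
          using K[unfolded smooth_bound_def, THEN conjunct2, rule_format, OF Q(1) Q(2) _ elim \<phi>(1)[rule_format] \<phi>(2) \<phi>(3)[rule_format] \<phi>(4)[rule_format] \<eta>] by simp
      qed
    qed simp
  qed
qed

end

section \<open>Total variation, Fortet-Mourier distance and smooth laws\<close>

lemma continuous_antiderivative:
  fixes \<psi> :: "real \<Rightarrow> real"
  assumes "continuous_on UNIV \<psi>"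
  shows "\<exists>\<Psi>. \<forall>x. (\<Psi> has_real_derivative \<psi> x) (at x)"
  using einterval_antiderivative[of "-\<infinity>" "\<infinity>" \<psi>] assms
  by (auto simp: continuous_on_eq_continuous_at has_real_derivative_iff_has_vector_derivative)

lemma derivative_lipschitz_on:
  fixes f f' :: "real \<Rightarrow> real"
  assumes d: "\<And>x. (f has_real_derivative f' x) (at x)" and b: "\<And>x. \<bar>f' x\<bar> \<le> L"
  shows "L-lipschitz_on UNIV f"
proof (rule lipschitz_onI)
  show "0 \<le> L" using b[of 0] by linarith
  have *: "\<bar>f y - f x\<bar> \<le> L * (y - x)" if xy: "x < y" for x y
  proof -
    obtain z where "f y - f x = (y - x) * f' z" using MVT2[OF xy, of f f'] d by blast
    thus ?thesis using b[of z] xy by (simp add: abs_mult mult.commute mult_left_mono)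
  qed
  fix x y :: real
  show "dist (f x) (f y) \<le> L * dist x y"
    using *[of x y] *[of y x] by (cases x y rule: linorder_cases) (auto simp: dist_real_def abs_minus_commute)
qed

text \<open>The estimate of \<open>wiener_chaos_sum_smooth\<close> as a property of the law alone,
  with the variance absorbed in K. Since \<open>\<phi>'\<close> is bounded and continuous, the
  property passes to weak limits.\<close>

definition smooth_law :: "real measure \<Rightarrow> real \<Rightarrow> real \<Rightarrow> bool" where
  "smooth_law \<mu> K s \<longleftrightarrow> (\<forall>\<phi> \<phi>' B L \<eta>. (\<forall>x. (\<phi> has_real_derivative \<phi>' x) (at x)) \<longrightarrow> continuous_on UNIV \<phi>' \<longrightarrow>
     (\<forall>x. \<bar>\<phi> x\<bar> \<le> B) \<longrightarrow> (\<forall>x. \<bar>\<phi>' x\<bar> \<le> L) \<longrightarrow> \<eta> > 0 \<longrightarrow> (LINT x|\<mu>. \<phi>' x) \<le> K * (B / \<eta> + L * \<eta> powr s))"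

text \<open>The hypotheses are symmetric under a change of sign of \<open>\<phi>\<close>, so the
  one-sided estimate is in fact two-sided.\<close>

lemma smooth_lawD:
  assumes "smooth_law \<mu> K s" "\<And>x. (\<phi> has_real_derivative \<phi>' x) (at x)" "continuous_on UNIV \<phi>'"
    "\<And>x. \<bar>\<phi> x\<bar> \<le> B" "\<And>x. \<bar>\<phi>' x\<bar> \<le> L" "\<eta> > 0"
  shows "\<bar>LINT x|\<mu>. \<phi>' x\<bar> \<le> K * (B / \<eta> + L * \<eta> powr s)"
proof -
  have 1: "(LINT x|\<mu>. \<phi>' x) \<le> K * (B / \<eta> + L * \<eta> powr s)"
    using assms unfolding smooth_law_def by blast
  have n: "\<forall>x. ((\<lambda>x. - \<phi> x) has_real_derivative - \<phi>' x) (at x)" "continuous_on UNIV (\<lambda>x. - \<phi>' x)"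
    "\<forall>x. \<bar>- \<phi> x\<bar> \<le> B" "\<forall>x. \<bar>- \<phi>' x\<bar> \<le> L"
    using assms by (auto intro!: DERIV_minus continuous_intros)
  have "(LINT x|\<mu>. - \<phi>' x) \<le> K * (B / \<eta> + L * \<eta> powr s)"
    by (rule assms(1)[unfolded smooth_law_def, rule_format, of "\<lambda>x. - \<phi> x" "\<lambda>x. - \<phi>' x"]) (use n assms(6) in auto)
  with 1 show ?thesis by simp
qed

text \<open>\<open>\<psi>'\<close> is the average of \<open>\<psi>\<close> over \<open>[x, x + \<alpha>]\<close>; the difference has an antiderivative bounded by \<open>\<alpha>\<close>.\<close>

lemma smoothing:
  fixes \<psi> :: "real \<Rightarrow> real"
  assumes c: "continuous_on UNIV \<psi>" and b: "\<And>x. 0 \<le> \<psi> x" "\<And>x. \<psi> x \<le> 1" and \<alpha>: "\<alpha> > 0"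
  obtains \<psi>' where "\<And>x. 0 \<le> \<psi>' x" "\<And>x. \<psi>' x \<le> 1" "(1 / \<alpha>)-lipschitz_on UNIV \<psi>'"
    "\<And>\<mu> K s \<eta>. real_distribution \<mu> \<Longrightarrow> smooth_law \<mu> K s \<Longrightarrow> \<eta> > 0 \<Longrightarrow>
       \<bar>(LINT x|\<mu>. \<psi> x) - (LINT x|\<mu>. \<psi>' x)\<bar> \<le> K * (\<alpha> / \<eta> + \<eta> powr s)"
proof -
  obtain \<Psi> where \<Psi>: "\<And>x. (\<Psi> has_real_derivative \<psi> x) (at x)" using continuous_antiderivative[OF c] by blast
  have c\<Psi>: "continuous_on UNIV \<Psi>" using \<Psi> by (meson DERIV_isCont continuous_at_imp_continuous_on)
  obtain \<Theta> where \<Theta>: "\<And>x. (\<Theta> has_real_derivative \<Psi> x) (at x)" using continuous_antiderivative[OF c\<Psi>] by blast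
  define \<psi>' where "\<psi>' x = (\<Psi> (x + \<alpha>) - \<Psi> x) / \<alpha>" for x
  have shift: "((\<lambda>x. f (x + \<alpha>)) has_real_derivative f' (x + \<alpha>)) (at x)"
    if "\<And>x. (f has_real_derivative f' x) (at x)" for f f' :: "real \<Rightarrow> real" and x
    using that[of "x + \<alpha>"] by (simp add: DERIV_shift)
  have ex: "\<exists>z. \<psi>' x = \<psi> z" for x
  proof -
    obtain z where "\<Psi> (x + \<alpha>) - \<Psi> x = (x + \<alpha> - x) * \<psi> z" using MVT2[of x "x + \<alpha>" \<Psi> \<psi>] \<Psi> \<alpha> by auto
    thus ?thesis using \<alpha> by (intro exI[of _ z]) (simp add: \<psi>'_def)
  qed
  have 01: "0 \<le> \<psi>' x" "\<psi>' x \<le> 1" for x using ex[of x] b by auto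
  have c': "continuous_on UNIV \<psi>'"
    unfolding \<psi>'_def[abs_def] using \<alpha> by (intro continuous_intros continuous_on_compose2[OF c\<Psi>]) auto
  have lip: "(1 / \<alpha>)-lipschitz_on UNIV \<psi>'"
  proof (rule derivative_lipschitz_on)
    fix x
    show "(\<psi>' has_real_derivative (\<psi> (x + \<alpha>) - \<psi> x) / \<alpha>) (at x)"
      unfolding \<psi>'_def[abs_def] by (intro DERIV_cdivide DERIV_diff shift \<Psi>)
    have "\<bar>\<psi> (x + \<alpha>) - \<psi> x\<bar> \<le> 1" using b[of x] b[of "x + \<alpha>"] by linarith
    thus "\<bar>(\<psi> (x + \<alpha>) - \<psi> x) / \<alpha>\<bar> \<le> 1 / \<alpha>" using \<alpha> by (simp add: divide_right_mono)
  qed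
  \<comment> \<open>\<open>\<Psi>\<close> minus its own average over
    \<open>[x, x + \<alpha>]\<close>. Its derivative is \<open>\<psi> - \<psi>'\<close>, and as
    \<open>\<Psi>\<close> has slopes between 0 and 1 it differs from that average by at most
    \<open>\<alpha>\<close>.\<close>
  define \<phi> where "\<phi> x = \<Psi> x - (\<Theta> (x + \<alpha>) - \<Theta> x) / \<alpha>" for x
  have d\<phi>: "(\<phi> has_real_derivative \<psi> x - \<psi>' x) (at x)" for x
    unfolding \<phi>_def[abs_def] \<psi>'_def by (intro DERIV_cdivide DERIV_diff shift \<Psi> \<Theta>)
  have b\<phi>: "\<bar>\<phi> x\<bar> \<le> \<alpha>" for x
  proof -
    obtain z where z: "x < z" "z < x + \<alpha>" "\<Theta> (x + \<alpha>) - \<Theta> x = (x + \<alpha> - x) * \<Psi> z" using MVT2[of x "x + \<alpha>" \<Theta> \<Psi>] \<Theta> \<alpha> by auto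
    hence "\<phi> x = \<Psi> x - \<Psi> z" using \<alpha> by (simp add: \<phi>_def)
    moreover obtain y where "\<Psi> z - \<Psi> x = (z - x) * \<psi> y" using MVT2[of x z \<Psi> \<psi>] \<Psi> z by auto
    ultimately have "\<phi> x = - ((z - x) * \<psi> y)" by linarith
    moreover have "0 \<le> (z - x) * \<psi> y" using z b by simp
    ultimately have "\<bar>\<phi> x\<bar> = (z - x) * \<psi> y" by simp
    also have "\<dots> \<le> \<alpha> * 1" using z b \<alpha> by (intro mult_mono) auto
    finally show ?thesis by simp
  qed
  show ?thesis
  proof (rule that[OF 01 lip])
    fix \<mu> K s and \<eta> :: real assume "real_distribution \<mu>" and S: "smooth_law \<mu> K s" and \<eta>: "\<eta> > 0"
    interpret real_distribution \<mu> by fact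
    have m[measurable]: "\<psi> \<in> borel_measurable borel" "\<psi>' \<in> borel_measurable borel"
      using c c' by (auto intro: borel_measurable_continuous_onI)
    have i: "integrable \<mu> \<psi>" "integrable \<mu> \<psi>'"
      by (rule integrable_const_bound[where B=1]; use b 01 in auto)+
    have "\<bar>\<psi> x - \<psi>' x\<bar> \<le> 1" for x using b[of x] 01[of x] by linarith
    from smooth_lawD[OF S d\<phi> _ b\<phi> this \<eta>] have "\<bar>LINT x|\<mu>. \<psi> x - \<psi>' x\<bar> \<le> K * (\<alpha> / \<eta> + 1 * \<eta> powr s)"
      by (auto intro!: continuous_intros c c')
    thus "\<bar>(LINT x|\<mu>. \<psi> x) - (LINT x|\<mu>. \<psi>' x)\<bar> \<le> K * (\<alpha> / \<eta> + \<eta> powr s)" using i by simp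
  qed
qed

section \<open>From Lipschitz test functions to Borel sets\<close>

definition fm_close :: "real measure \<Rightarrow> real measure \<Rightarrow> real \<Rightarrow> bool" where
  "fm_close \<mu> \<nu> d \<longleftrightarrow> (\<forall>\<phi>. 1-lipschitz_on UNIV \<phi> \<longrightarrow> (\<forall>x. \<bar>\<phi> x\<bar> \<le> 1) \<longrightarrow> \<bar>(LINT x|\<mu>. \<phi> x) - (LINT x|\<nu>. \<phi> x)\<bar> \<le> d)"

lemma fm_close_lipschitz:
  fixes \<psi> :: "real \<Rightarrow> real"
  assumes d: "fm_close \<mu> \<nu> d" and L: "L-lipschitz_on UNIV \<psi>" "L \<le> c" and c: "c \<ge> 1" and b: "\<And>x. \<bar>\<psi> x\<bar> \<le> 1"
  shows "\<bar>(LINT x|\<mu>. \<psi> x) - (LINT x|\<nu>. \<psi> x)\<bar> \<le> c * d"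
proof -
  have "(1 / c * L)-lipschitz_on UNIV (\<lambda>x. 1 / c * \<psi> x)"
    using lipschitz_on_cmult_real[OF L(1), of "1/c"] c by simp
  hence "1-lipschitz_on UNIV (\<lambda>x. 1 / c * \<psi> x)" by (rule lipschitz_on_mono) (use L(2) c in auto)
  moreover have "\<bar>1 / c * \<psi> x\<bar> \<le> 1" for x using b[of x] c by (simp add: abs_mult divide_le_eq_1)
  ultimately have "\<bar>(LINT x|\<mu>. 1 / c * \<psi> x) - (LINT x|\<nu>. 1 / c * \<psi> x)\<bar> \<le> d"
    using d unfolding fm_close_def by blast
  hence "\<bar>1 / c * ((LINT x|\<mu>. \<psi> x) - (LINT x|\<nu>. \<psi> x))\<bar> \<le> d" by (simp add: diff_divide_distrib)
  thus ?thesis using c by (simp add: abs_mult field_simps)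
qed

text \<open>Under both laws \<open>\<psi>\<close> is replaced by its average, which costs the terms
  with K; the averages are compared by the distance d, scaled by their Lipschitz constant
  \<open>1 / \<alpha>\<close>. As \<open>\<alpha>\<close> is at most 1, this scaling respects the
  bound 1 on test functions.\<close>

lemma fm_close_smooth_lipschitz:
  fixes \<psi> :: "real \<Rightarrow> real"
  assumes \<mu>: "real_distribution \<mu>" "smooth_law \<mu> K s" and \<nu>: "real_distribution \<nu>" "smooth_law \<nu> K s"
    and d: "fm_close \<mu> \<nu> d" and c: "continuous_on UNIV \<psi>" and b: "\<And>x. 0 \<le> \<psi> x" "\<And>x. \<psi> x \<le> 1"
    and \<alpha>: "0 < \<alpha>" "\<alpha> \<le> 1" and \<eta>: "\<eta> > 0"
  shows "\<bar>(LINT x|\<mu>. \<psi> x) - (LINT x|\<nu>. \<psi> x)\<bar> \<le> d / \<alpha> + 2 * K * (\<alpha> / \<eta> + \<eta> powr s)"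
proof -
  obtain \<psi>' where p: "\<And>x. 0 \<le> \<psi>' x" "\<And>x. \<psi>' x \<le> 1" "(1 / \<alpha>)-lipschitz_on UNIV \<psi>'"
    "\<And>\<mu> K s \<eta>. real_distribution \<mu> \<Longrightarrow> smooth_law \<mu> K s \<Longrightarrow> \<eta> > 0 \<Longrightarrow>
       \<bar>(LINT x|\<mu>. \<psi> x) - (LINT x|\<mu>. \<psi>' x)\<bar> \<le> K * (\<alpha> / \<eta> + \<eta> powr s)"
    using smoothing[OF c b \<alpha>(1)] by metis
  have "\<bar>(LINT x|\<mu>. \<psi>' x) - (LINT x|\<nu>. \<psi>' x)\<bar> \<le> 1 / \<alpha> * d"
    by (rule fm_close_lipschitz[OF d p(3)]) (use \<alpha> p in \<open>auto simp: abs_of_nonneg\<close>)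
  hence "\<bar>(LINT x|\<mu>. \<psi>' x) - (LINT x|\<nu>. \<psi>' x)\<bar> \<le> d / \<alpha>" by simp
  moreover have "2 * K * (\<alpha> / \<eta> + \<eta> powr s) = K * (\<alpha> / \<eta> + \<eta> powr s) + K * (\<alpha> / \<eta> + \<eta> powr s)" by simp
  ultimately show ?thesis using p(4)[OF \<mu> \<eta>] p(4)[OF \<nu> \<eta>] by linarith
qed

lemma compact_inner_approx:
  assumes "real_distribution \<mu>" and A: "A \<in> sets borel" and e: "e > 0"
  shows "\<exists>K\<subseteq>A. compact K \<and> measure \<mu> A \<le> measure \<mu> K + e"
proof (rule ccontr)
  interpret real_distribution \<mu> by fact
  assume "\<not> ?thesis"
  hence n: "\<And>K. K \<subseteq> A \<Longrightarrow> compact K \<Longrightarrow> measure \<mu> K \<le> measure \<mu> A - e" by (metis not_le less_imp_le less_diff_eq)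
  have "0 \<le> measure \<mu> A - e" using n[of "{}"] by simp
  have "emeasure \<mu> A = (SUP K\<in>{K. K \<subseteq> A \<and> compact K}. emeasure \<mu> K)"
    by (rule inner_regular) (use A in \<open>auto simp: emeasure_eq_measure\<close>)
  also have "\<dots> \<le> ennreal (measure \<mu> A - e)"
    by (rule SUP_least) (use n in \<open>auto simp: emeasure_eq_measure intro!: ennreal_leI\<close>)
  finally have "measure \<mu> A \<le> measure \<mu> A - e" using \<open>0 \<le> measure \<mu> A - e\<close> by (simp add: emeasure_eq_measure)
  thus False using e by simp
qed

text \<open>For nonempty closed K these functions decrease to the indicator of K. Their slope grows
  with k, which is harmless where an estimate holds uniformly over all continuous test functions
  with values in the unit interval.\<close>

definition tent :: "real set \<Rightarrow> nat \<Rightarrow> real \<Rightarrow> real" where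
  "tent K k x = max 0 (1 - real k * infdist x K)"

lemma tent_bounds: "0 \<le> tent K k x" "tent K k x \<le> 1"
  by (auto simp: tent_def infdist_nonneg)

lemma tent_lipschitz: "(real k)-lipschitz_on UNIV (tent K k)"
proof (rule lipschitz_onI)
  fix x y :: real
  have "\<bar>tent K k x - tent K k y\<bar> \<le> \<bar>real k * infdist x K - real k * infdist y K\<bar>" unfolding tent_def by linarith
  also have "\<dots> = real k * \<bar>infdist x K - infdist y K\<bar>" by (simp add: abs_mult flip: right_diff_distrib)
  also have "\<dots> \<le> real k * dist x y" by (intro mult_left_mono infdist_triangle_abs) auto
  finally show "dist (tent K k x) (tent K k y) \<le> real k * dist x y" by (simp add: dist_real_def)
qed simp

lemma tent_continuous: "continuous_on UNIV (tent K k)"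
  by (rule lipschitz_on_continuous_on[OF tent_lipschitz])

lemma tent_measurable[measurable]: "tent K k \<in> borel_measurable borel"
  by (rule borel_measurable_continuous_onI[OF tent_continuous])

lemma tent_eq_1: "x \<in> K \<Longrightarrow> tent K k x = 1"
  by (simp add: tent_def)

lemma tent_tendsto:
  assumes "closed K" "K \<noteq> {}"
  shows "(\<lambda>k. tent K k x) \<longlonglongrightarrow> indicator K x"
proof (cases "x \<in> K")
  case True
  thus ?thesis by (simp add: tent_eq_1)
next
  case False
  hence i: "infdist x K > 0" using in_closed_iff_infdist_zero[OF assms, of x] infdist_nonneg[of x K] by simp
  then obtain n :: nat where n: "1 / infdist x K < n" using reals_Archimedean2 by blast
  have "tent K k x = 0" if "k \<ge> n" for k
  proof -
    have "1 / infdist x K \<le> real k" using n that by linarith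
    hence "1 \<le> real k * infdist x K" using i by (simp add: divide_le_eq)
    thus ?thesis by (simp add: tent_def)
  qed
  hence "\<forall>\<^sub>F k in sequentially. tent K k x = 0" by (auto simp: eventually_sequentially)
  thus ?thesis using False by (simp add: tendsto_eventually)
qed

text \<open>By inner regularity A may be replaced by a compact subset K. Its measure is at most the
  integral of any tent over K, and under the other law these integrals tend to the measure of
  K.\<close>

lemma measure_le_of_tent:
  assumes \<mu>: "real_distribution \<mu>" and \<nu>: "real_distribution \<nu>" and A: "A \<in> sets borel" and c: "c \<ge> 0"
    and h: "\<And>K k. (LINT x|\<mu>. tent K k x) \<le> (LINT x|\<nu>. tent K k x) + c"
  shows "measure \<mu> A \<le> measure \<nu> A + c"
proof (rule field_le_epsilon)
  fix e :: real assume e: "e > 0"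
  interpret \<mu>: real_distribution \<mu> by fact
  interpret \<nu>: real_distribution \<nu> by fact
  obtain K where K: "K \<subseteq> A" "compact K" "measure \<mu> A \<le> measure \<mu> K + e" using compact_inner_approx[OF \<mu> A e] by blast
  have Kb[measurable]: "K \<in> sets borel" by (rule borel_closed[OF compact_imp_closed[OF K(2)]])
  show "measure \<mu> A \<le> measure \<nu> A + c + e"
  \<comment> \<open>For empty K the value of \<open>infdist\<close> is 0, so the tents are
    constantly 1 and do not tend to the indicator.\<close>
  proof (cases "K = {}")
    case True
    hence "measure \<mu> A \<le> e" using K(3) by simp
    thus ?thesis using c measure_nonneg[of \<nu> A] by linarith
  next
    case False
    have lim: "(\<lambda>k. LINT x|\<nu>. tent K k x) \<longlonglongrightarrow> (LINT x|\<nu>. indicator K x)"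
      by (rule integral_dominated_convergence[where w="\<lambda>_. 1"])
         (use tent_tendsto[OF compact_imp_closed[OF K(2)] False] tent_bounds in \<open>auto simp: abs_of_nonneg\<close>)
    have "measure \<mu> K \<le> (LINT x|\<nu>. tent K k x) + c" for k
    proof -
      have "measure \<mu> K = (LINT x|\<mu>. indicator K x)" by simp
      also have "\<dots> \<le> (LINT x|\<mu>. tent K k x)"
      proof (rule integral_mono)
        show "integrable \<mu> (\<lambda>x. indicator K x :: real)" by (rule \<mu>.integrable_const_bound[where B=1]) (auto simp: indicator_def)
        show "integrable \<mu> (tent K k)" by (rule \<mu>.integrable_const_bound[where B=1]) (use tent_bounds in \<open>auto simp: abs_of_nonneg\<close>)
        show "indicator K x \<le> tent K k x" for x using tent_bounds(1)[of K k x] tent_eq_1[of x K k] by (auto simp: indicator_def)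
      qed
      finally show ?thesis using h[of K k] by linarith
    qed
    hence "measure \<mu> K \<le> (LINT x|\<nu>. indicator K x) + c"
      by (intro LIMSEQ_le_const[OF tendsto_add[OF lim tendsto_const]]) auto
    also have "(LINT x|\<nu>. indicator K x) = measure \<nu> K" by simp
    also have "\<dots> \<le> measure \<nu> A" by (rule \<nu>.finite_measure_mono) (use K A in auto)
    finally show ?thesis using K(3) by simp
  qed
qed

lemma measure_close_of_tent:
  assumes \<mu>: "real_distribution \<mu>" and \<nu>: "real_distribution \<nu>" and A: "A \<in> sets borel"
    and h: "\<And>K k. \<bar>(LINT x|\<mu>. tent K k x) - (LINT x|\<nu>. tent K k x)\<bar> \<le> c"
  shows "\<bar>measure \<mu> A - measure \<nu> A\<bar> \<le> c"
proof -
  have c: "c \<ge> 0" using h[of "{}" 0] by linarith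
  have "measure \<mu> A \<le> measure \<nu> A + c"
    by (rule measure_le_of_tent[OF \<mu> \<nu> A c]) (use h in \<open>auto simp: abs_le_iff algebra_simps\<close>)
  moreover have "measure \<nu> A \<le> measure \<mu> A + c"
    by (rule measure_le_of_tent[OF \<nu> \<mu> A c]) (use h in \<open>auto simp: abs_le_iff algebra_simps\<close>)
  ultimately show ?thesis by linarith
qed

lemma fm_close_measure:
  assumes \<mu>: "real_distribution \<mu>" "smooth_law \<mu> K s" and \<nu>: "real_distribution \<nu>" "smooth_law \<nu> K s"
    and d: "fm_close \<mu> \<nu> d" "d > 0" and K: "K \<ge> 0" and s: "s > 0" and A: "A \<in> sets borel"
  shows "\<bar>measure \<mu> A - measure \<nu> A\<bar> \<le> (1 + 4 * K) * d powr (s / (1 + 2 * s))"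
proof -
  interpret \<mu>: real_distribution \<mu> by fact
  interpret \<nu>: real_distribution \<nu> by fact
  define e where "e = s / (1 + 2 * s)"
  have e: "e > 0" using s by (simp add: e_def)
  show ?thesis
  \<comment> \<open>For d at least 1 the right-hand side is at least 1; for smaller d the smoothing
    scale below is admissible, that is, at most 1.\<close>
  proof (cases "d \<ge> 1")
    case True
    have "\<bar>measure \<mu> A - measure \<nu> A\<bar> \<le> 1"
      using \<mu>.prob_le_1[of A] \<nu>.prob_le_1[of A] measure_nonneg[of \<mu> A] measure_nonneg[of \<nu> A] by linarith
    also have "\<dots> \<le> 1 * d powr e" using ge_one_powr_ge_zero[OF True] e by simp
    also have "\<dots> \<le> (1 + 4 * K) * d powr e" using K by (intro mult_right_mono) auto
    finally show ?thesis by (simp add: e_def)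
  next
    case False
    \<comment> \<open>The error is
      \<open>d / \<alpha> + 2 * K * (\<alpha> / \<eta> + \<eta> powr s)\<close>. Its three powers
      agree when \<open>\<alpha> = \<eta> powr (1 + s)\<close> and
      \<open>d = \<eta> powr (1 + 2 * s)\<close>, and are then all equal to
      \<open>d powr e\<close>.\<close>
    define \<eta> where "\<eta> = d powr (1 / (1 + 2 * s))"
    define \<alpha> where "\<alpha> = d powr ((1 + s) / (1 + 2 * s))"
    have \<eta>: "\<eta> > 0" and \<alpha>: "\<alpha> > 0" using d by (auto simp: \<eta>_def \<alpha>_def)
    have \<alpha>1: "\<alpha> \<le> 1" unfolding \<alpha>_def using False d s by (intro powr_le1) auto
    have 1: "\<eta> powr s = d powr e" by (simp add: \<eta>_def e_def powr_powr)
    have 2: "\<alpha> / \<eta> = d powr e" unfolding \<alpha>_def \<eta>_def powr_diff[symmetric] e_def by (simp add: diff_divide_distrib[symmetric])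
    have 3: "d / \<alpha> = d powr e"
    proof -
      have "d / \<alpha> = d powr (1 - (1 + s) / (1 + 2 * s))" using d by (simp add: \<alpha>_def powr_diff)
      also have "1 - (1 + s) / (1 + 2 * s) = e" using s by (simp add: e_def field_simps)
      finally show ?thesis .
    qed
    have "\<bar>measure \<mu> A - measure \<nu> A\<bar> \<le> d / \<alpha> + 2 * K * (\<alpha> / \<eta> + \<eta> powr s)"
      by (rule measure_close_of_tent[OF \<mu>(1) \<nu>(1) A])
         (rule fm_close_smooth_lipschitz[OF \<mu> \<nu> d(1) tent_continuous tent_bounds \<alpha> \<alpha>1 \<eta>])
    also have "\<dots> = (1 + 4 * K) * d powr e" unfolding 1 2 3 by (simp add: algebra_simps)
    finally show ?thesis by (simp add: e_def)
  qed
qed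

text \<open>At distance 0 the slope of the tents costs nothing, so that they compare the two laws
  directly.\<close>

lemma fm_close_zero_measure:
  assumes \<mu>: "real_distribution \<mu>" and \<nu>: "real_distribution \<nu>" and d: "fm_close \<mu> \<nu> 0" and A: "A \<in> sets borel"
  shows "measure \<mu> A = measure \<nu> A"
proof -
  have "\<bar>measure \<mu> A - measure \<nu> A\<bar> \<le> 0"
  proof (rule measure_close_of_tent[OF \<mu> \<nu> A])
    fix K k
    have "\<bar>(LINT x|\<mu>. tent K k x) - (LINT x|\<nu>. tent K k x)\<bar> \<le> max 1 (real k) * 0"
      by (rule fm_close_lipschitz[OF d tent_lipschitz]) (use tent_bounds in \<open>auto simp: abs_of_nonneg\<close>)
    thus "\<bar>(LINT x|\<mu>. tent K k x) - (LINT x|\<nu>. tent K k x)\<bar> \<le> 0" by simp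
  qed
  thus ?thesis by simp
qed

lemma antiderivative_bound:
  fixes \<Psi> \<psi> :: "real \<Rightarrow> real"
  assumes \<Psi>: "\<And>x. (\<Psi> has_real_derivative \<psi> x) (at x)" and [measurable]: "\<psi> \<in> borel_measurable borel"
    and p: "\<And>x. 0 \<le> \<psi> x" and i: "integrable lborel \<psi>"
  shows "\<bar>\<Psi> y - \<Psi> x\<bar> \<le> (LINT x|lborel. \<psi> x)"
proof -
  have *: "\<bar>\<Psi> b - \<Psi> a\<bar> \<le> (LINT x|lborel. \<psi> x)" if "a \<le> b" for a b
  proof -
    have "(\<integral>\<^sup>+ x. ennreal (\<psi> x) * indicator {a..b} x \<partial>lborel) = ennreal (\<Psi> b - \<Psi> a)"
      by (rule nn_integral_FTC_Icc) (use \<Psi> p that in auto)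
    moreover have "(\<integral>\<^sup>+ x. ennreal (\<psi> x) * indicator {a..b} x \<partial>lborel) \<le> (\<integral>\<^sup>+ x. ennreal (\<psi> x) \<partial>lborel)"
      by (rule nn_integral_mono) (auto simp: indicator_def)
    moreover have "(\<integral>\<^sup>+ x. ennreal (\<psi> x) \<partial>lborel) = ennreal (LINT x|lborel. \<psi> x)"
      by (rule nn_integral_eq_integral[OF i]) (use p in auto)
    ultimately have "ennreal (\<Psi> b - \<Psi> a) \<le> ennreal (LINT x|lborel. \<psi> x)" by simp
    hence "\<Psi> b - \<Psi> a \<le> (LINT x|lborel. \<psi> x)" using p by (subst (asm) ennreal_le_iff) (auto intro!: integral_nonneg_AE)
    moreover have "\<Psi> a \<le> \<Psi> b" using DERIV_nonneg_imp_nondecreasing[OF that, of \<Psi>] \<Psi> p by blast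
    ultimately show ?thesis by simp
  qed
  show ?thesis using *[of x y] *[of y x] by (cases "x \<le> y") (auto simp: abs_minus_commute)
qed

text \<open>For a compact null set K the Lebesgue integrals of the tents tend to 0, and they bound
  the oscillation of the antiderivatives. For fixed \<open>\<eta>\<close> the term with
  \<open>1 / \<eta>\<close> therefore vanishes in the limit, leaving a multiple of
  \<open>\<eta> powr s\<close>, and then \<open>\<eta>\<close> tends to 0.\<close>

lemma smooth_law_absolutely_continuous:
  assumes \<mu>: "real_distribution \<mu>" "smooth_law \<mu> C s" and s: "s > 0"
  shows "absolutely_continuous lborel \<mu>"
proof -
  interpret real_distribution \<mu> by fact
  have "measure \<mu> A = 0" if A: "A \<in> null_sets lborel" for A
  proof -
    have Ab: "A \<in> sets borel" using A by auto
    have K0: "measure \<mu> K \<le> 0" if K: "K \<subseteq> A" "compact K" for K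
    proof (cases "K = {}")
      case False
      have [measurable]: "K \<in> sets borel" by (rule borel_closed[OF compact_imp_closed[OF K(2)]])
      have "emeasure lborel K = 0" using null_sets_subset[OF A _ K(1)] by auto
      hence lK: "measure lborel K = 0" by (simp add: measure_def)
      obtain R where R: "\<And>x. x \<in> K \<Longrightarrow> \<bar>x\<bar> \<le> R" using compact_imp_bounded[OF K(2)] by (auto simp: bounded_iff)
      \<comment> \<open>A slope of at least 1 confines the tents to a fixed bounded interval around
        K, which makes them integrable and supplies the dominating function.\<close>
      let ?t = "\<lambda>k. tent K (Suc k)"
      have supp: "?t k x \<le> indicator {-R-1..R+1} x" for k x
      proof (cases "x \<in> {-R-1..R+1}")
        case False
        have "1 \<le> infdist x K"
        proof -
          have "1 \<le> dist x y" if "y \<in> K" for y using R[OF that] False by (auto simp: dist_real_def)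
          thus ?thesis unfolding infdist_def using \<open>K \<noteq> {}\<close> by (auto intro!: cINF_greatest)
        qed
        hence "1 \<le> real (Suc k) * infdist x K" using mult_mono[of 1 "real (Suc k)" 1 "infdist x K"] by simp
        thus ?thesis using False by (simp add: tent_def)
      qed (use tent_bounds in simp)
      have iI: "integrable lborel (indicator {-R-1..R+1} :: real \<Rightarrow> real)" by (rule integrable_real_indicator) (auto simp: emeasure_lborel_Icc_eq)
      have it: "integrable lborel (?t k)" for k
        by (rule Bochner_Integration.integrable_bound[OF iI]) (use supp tent_bounds in \<open>auto simp: abs_of_nonneg\<close>)
      have "(\<lambda>k. LINT x|lborel. ?t k x) \<longlonglongrightarrow> (LINT x|lborel. indicator K x)"
        by (rule integral_dominated_convergence[where w="indicator {-R-1..R+1}"])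
           (use iI supp tent_bounds LIMSEQ_Suc[OF tent_tendsto[OF compact_imp_closed[OF K(2)] False]] in \<open>auto simp: abs_of_nonneg\<close>)
      hence lim: "(\<lambda>k. LINT x|lborel. ?t k x) \<longlonglongrightarrow> 0" using lK by simp
      have b: "measure \<mu> K \<le> C * ((LINT x|lborel. ?t k x) / \<eta> + 1 * \<eta> powr s)" if \<eta>: "\<eta> > 0" for k \<eta>
      proof -
        obtain \<Psi> where \<Psi>: "\<And>x. (\<Psi> has_real_derivative ?t k x) (at x)" using continuous_antiderivative[OF tent_continuous] by blast
        have "measure \<mu> K = (LINT x|\<mu>. indicator K x)" by simp
        also have "\<dots> \<le> (LINT x|\<mu>. ?t k x)"
        proof (rule integral_mono)
          show "integrable \<mu> (\<lambda>x. indicator K x :: real)" by (rule integrable_const_bound[where B=1]) (auto simp: indicator_def)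
          show "integrable \<mu> (?t k)" by (rule integrable_const_bound[where B=1]) (use tent_bounds in \<open>auto simp: abs_of_nonneg\<close>)
          show "indicator K x \<le> ?t k x" for x using tent_bounds(1)[of K "Suc k" x] tent_eq_1[of x K "Suc k"] by (auto simp: indicator_def)
        qed
        also have "\<dots> \<le> C * ((LINT x|lborel. ?t k x) / \<eta> + 1 * \<eta> powr s)"
        proof (rule abs_le_D1, rule smooth_lawD[OF \<mu>(2) _ tent_continuous _ _ \<eta>])
          show "((\<lambda>x. \<Psi> x - \<Psi> 0) has_real_derivative ?t k x) (at x)" for x by (auto intro!: derivative_eq_intros \<Psi>)
          show "\<bar>\<Psi> x - \<Psi> 0\<bar> \<le> (LINT x|lborel. ?t k x)" for x
            by (rule antiderivative_bound[OF \<Psi> tent_measurable tent_bounds(1) it])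
          show "\<bar>?t k x\<bar> \<le> 1" for x using tent_bounds[of K "Suc k" x] by simp
        qed
        finally show ?thesis .
      qed
      have b2: "measure \<mu> K \<le> C * (0 / \<eta> + 1 * \<eta> powr s)" if \<eta>: "\<eta> > 0" for \<eta>
      proof (rule LIMSEQ_le_const)
        show "(\<lambda>k. C * ((LINT x|lborel. ?t k x) / \<eta> + 1 * \<eta> powr s)) \<longlonglongrightarrow> C * (0 / \<eta> + 1 * \<eta> powr s)"
          using \<eta> by (intro tendsto_mult tendsto_add tendsto_divide tendsto_const lim) auto
      qed (use b[OF \<eta>] in auto)
      have "(\<lambda>n. inverse (real (Suc n)) powr s) \<longlonglongrightarrow> 0"
        using tendsto_zero_powrI[OF LIMSEQ_inverse_real_of_nat tendsto_const _ s] by auto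
      hence "(\<lambda>n. C * (inverse (real (Suc n)) powr s)) \<longlonglongrightarrow> C * 0" by (intro tendsto_mult tendsto_const)
      thus "measure \<mu> K \<le> 0"
        by (intro LIMSEQ_le_const[of "\<lambda>n. C * (inverse (real (Suc n)) powr s)"]) (use b2[of "inverse (real (Suc _))"] in auto)
    qed simp
    have "measure \<mu> A \<le> 0"
    proof (rule field_le_epsilon)
      fix e :: real assume "e > 0"
      then obtain K where "K \<subseteq> A" "compact K" "measure \<mu> A \<le> measure \<mu> K + e" using compact_inner_approx[OF \<mu>(1) Ab] by blast
      thus "measure \<mu> A \<le> 0 + e" using K0[of K] by linarith
    qed
    thus ?thesis using measure_nonneg[of \<mu> A] by linarith
  qed
  thus ?thesis unfolding absolutely_continuous_def by (auto simp: emeasure_eq_measure intro!: null_setsI)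
qed

lemma smooth_law_weak_limit:
  assumes \<mu>: "\<And>n. real_distribution (\<mu> n)" and \<nu>: "real_distribution \<nu>" and w: "weak_conv_m \<mu> \<nu>"
    and s: "\<forall>\<^sub>F n in sequentially. smooth_law (\<mu> n) K s"
  shows "smooth_law \<nu> K s"
  unfolding smooth_law_def
proof (intro allI impI)
  fix \<phi> \<phi>' :: "real \<Rightarrow> real" and B L \<eta> :: real
  assume h: "\<forall>x. (\<phi> has_real_derivative \<phi>' x) (at x)" "continuous_on UNIV \<phi>'" "\<forall>x. \<bar>\<phi> x\<bar> \<le> B" "\<forall>x. \<bar>\<phi>' x\<bar> \<le> L" "\<eta> > 0"
  have "(\<lambda>n. LINT x|\<mu> n. \<phi>' x) \<longlonglongrightarrow> (LINT x|\<nu>. \<phi>' x)"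
    by (rule weak_conv_imp_integral_bdd_continuous_conv[OF \<mu> \<nu> w]) (use h in \<open>auto simp: continuous_on_eq_continuous_at\<close>)
  moreover have "\<forall>\<^sub>F n in sequentially. (LINT x|\<mu> n. \<phi>' x) \<le> K * (B / \<eta> + L * \<eta> powr s)"
    using s by eventually_elim (use h in \<open>auto simp: smooth_law_def\<close>)
  ultimately show "(LINT x|\<nu>. \<phi>' x) \<le> K * (B / \<eta> + L * \<eta> powr s)"
    by (intro tendsto_upperbound) auto
qed

section \<open>Moments, variances and the two distances under weak convergence\<close>

text \<open>Variances are not continuous under weak convergence, but those of truncated variables
  are. Truncation is 1-Lipschitz and so does not increase the variance of \<open>G n\<close>, and
  some truncation of Y has positive variance, since otherwise Y would be almost surely
  constant.\<close>

lemma variance_lower_bound: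
  fixes Y :: "'b \<Rightarrow> real" and G :: "nat \<Rightarrow> 'a \<Rightarrow> real"
  assumes M: "prob_space M" and N: "prob_space N" and Y[measurable]: "Y \<in> borel_measurable N" and v: "prob_space.variance N Y > 0"
    and G[measurable]: "\<And>n. G n \<in> borel_measurable M" and G2: "\<And>n. integrable M (\<lambda>\<omega>. (G n \<omega>)\<^sup>2)"
    and conv: "\<And>g::real \<Rightarrow> real. continuous_on UNIV g \<Longrightarrow> (\<exists>B. \<forall>x. \<bar>g x\<bar> \<le> B) \<Longrightarrow> (\<lambda>n. LINT \<omega>|M. g (G n \<omega>)) \<longlonglongrightarrow> (LINT \<omega>|N. g (Y \<omega>))"
  shows "\<exists>v0>0. \<forall>\<^sub>F n in sequentially. v0 \<le> prob_space.variance M (G n)"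
proof -
  interpret M: prob_space M by fact
  interpret N: prob_space N by fact
  define cl where "cl k x = max (- real k) (min (real k) x)" for k and x :: real
  have clb: "\<bar>cl k x\<bar> \<le> real k" for k x by (auto simp: cl_def)
  have clc: "continuous_on UNIV (cl k)" for k unfolding cl_def[abs_def] by (intro continuous_intros)
  have [measurable]: "cl k \<in> borel_measurable borel" for k by (rule borel_measurable_continuous_onI[OF clc])
  have cl2b: "(cl k x)\<^sup>2 \<le> (real k)\<^sup>2" for k x using power_mono[OF clb[of k x], of 2] by simp
  define V where "V k = (LINT \<omega>|N. (cl k (Y \<omega>))\<^sup>2) - (LINT \<omega>|N. cl k (Y \<omega>))\<^sup>2" for k
  have iN: "integrable N (\<lambda>\<omega>. cl k (Y \<omega>))" "integrable N (\<lambda>\<omega>. (cl k (Y \<omega>))\<^sup>2)" for k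
    by (rule N.integrable_const_bound[where B="real k"], use clb in auto)
       (rule N.integrable_const_bound[where B="(real k)\<^sup>2"], use cl2b in auto)
  have iM: "integrable M (\<lambda>\<omega>. cl k (G n \<omega>))" "integrable M (\<lambda>\<omega>. (cl k (G n \<omega>))\<^sup>2)" for k n
    by (rule M.integrable_const_bound[where B="real k"], use clb in auto)
       (rule M.integrable_const_bound[where B="(real k)\<^sup>2"], use cl2b in auto)
  have "\<exists>k. V k > 0"
  proof (rule ccontr)
    assume "\<not> ?thesis"
    hence V0: "V k \<le> 0" for k by (simp add: not_less)
    define m where "m k = N.expectation (\<lambda>\<omega>. cl k (Y \<omega>))" for k
    have "AE \<omega> in N. cl k (Y \<omega>) = m k" for k
    proof -
      have "V k = N.expectation (\<lambda>\<omega>. (cl k (Y \<omega>) - m k)\<^sup>2)"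
        unfolding m_def V_def by (rule N.variance_eq[OF iN, symmetric])
      moreover have "0 \<le> N.expectation (\<lambda>\<omega>. (cl k (Y \<omega>) - m k)\<^sup>2)" by (rule integral_nonneg_AE) auto
      ultimately have "N.expectation (\<lambda>\<omega>. (cl k (Y \<omega>) - m k)\<^sup>2) = 0" using V0[of k] by linarith
      moreover have "integrable N (\<lambda>\<omega>. (cl k (Y \<omega>) - m k)\<^sup>2)" using iN by (simp add: power2_diff)
      ultimately have "AE \<omega> in N. (cl k (Y \<omega>) - m k)\<^sup>2 = 0" by (subst (asm) integral_nonneg_eq_0_iff_AE) auto
      thus ?thesis by eventually_elim simp
    qed
    hence AEm: "AE \<omega> in N. \<forall>k. cl k (Y \<omega>) = m k" by (subst AE_all_countable) blast
    obtain y where y: "\<forall>k. cl k y = m k"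
    proof (rule ccontr)
      assume "\<not> thesis"
      hence none: "\<not> (\<forall>k. cl k y = m k)" for y using that by blast
      have "AE \<omega> in N. False" using AEm by eventually_elim (use none in blast)
      thus False by simp
    qed
    have "AE \<omega> in N. Y \<omega> = y" using AEm
    proof eventually_elim
      case (elim \<omega>)
      obtain k :: nat where "max \<bar>Y \<omega>\<bar> \<bar>y\<bar> \<le> real k" using real_arch_simple by blast
      hence "cl k (Y \<omega>) = Y \<omega>" "cl k y = y" by (auto simp: cl_def)
      thus ?case using elim y by metis
    qed
    hence AEy: "AE \<omega> in N. Y \<omega> = y" .
    have "N.expectation Y = N.expectation (\<lambda>_. y)" by (rule integral_cong_AE) (use AEy in auto)
    hence "N.expectation Y = y" by (simp add: N.prob_space)
    hence "N.variance Y = N.expectation (\<lambda>_. 0)" using AEy by (intro integral_cong_AE) auto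
    thus False using v by simp
  qed
  then obtain k where k: "V k > 0" ..
  define W where "W n = (LINT \<omega>|M. (cl k (G n \<omega>))\<^sup>2) - (LINT \<omega>|M. cl k (G n \<omega>))\<^sup>2" for n
  have "W \<longlonglongrightarrow> V k"
    unfolding W_def[abs_def] V_def
  proof (intro tendsto_diff tendsto_power conv)
    show "\<exists>B. \<forall>x. \<bar>cl k x\<bar> \<le> B" using clb by blast
    show "\<exists>B. \<forall>x. \<bar>(cl k x)\<^sup>2\<bar> \<le> B" using cl2b by (intro exI[of _ "(real k)\<^sup>2"]) auto
  qed (auto intro!: continuous_intros clc)
  hence ev: "\<forall>\<^sub>F n in sequentially. V k / 2 < W n" by (rule order_tendstoD(1)) (use k in simp)
  have W: "W n \<le> M.variance (G n)" for n
  proof -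
    let ?m = "M.expectation (G n)"
    have iG: "integrable M (G n)" by (rule M.square_integrable_imp_integrable[OF G G2])
    \<comment> \<open>The mean square deviation of the truncated variable is least around its own
      mean, so that the truncated mean of \<open>G n\<close> may take its place, to which the
      Lipschitz bound applies.\<close>
    have "0 \<le> (M.expectation (\<lambda>\<omega>. cl k (G n \<omega>)) - cl k ?m)\<^sup>2" by simp
    hence "W n \<le> M.expectation (\<lambda>\<omega>. (cl k (G n \<omega>))\<^sup>2) - 2 * M.expectation (\<lambda>\<omega>. cl k (G n \<omega>)) * cl k ?m + (cl k ?m)\<^sup>2"
      unfolding W_def by (simp add: power2_diff)
    also have "\<dots> = M.expectation (\<lambda>\<omega>. (cl k (G n \<omega>) - cl k ?m)\<^sup>2)"
      using iM by (simp add: power2_diff M.prob_space)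
    also have "\<dots> \<le> M.expectation (\<lambda>\<omega>. (G n \<omega> - ?m)\<^sup>2)"
    proof (rule integral_mono)
      show "integrable M (\<lambda>\<omega>. (cl k (G n \<omega>) - cl k ?m)\<^sup>2)" using iM by (simp add: power2_diff)
      show "integrable M (\<lambda>\<omega>. (G n \<omega> - ?m)\<^sup>2)" using iG G2 by (simp add: power2_diff)
      fix \<omega>
      have "\<bar>cl k (G n \<omega>) - cl k ?m\<bar> \<le> \<bar>G n \<omega> - ?m\<bar>" unfolding cl_def by linarith
      from power_mono[OF this, of 2] show "(cl k (G n \<omega>) - cl k ?m)\<^sup>2 \<le> (G n \<omega> - ?m)\<^sup>2" by simp
    qed
    finally show ?thesis .
  qed
  from ev have "\<forall>\<^sub>F n in sequentially. V k / 2 \<le> M.variance (G n)"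
    by eventually_elim (rule order.trans[OF less_imp_le W])
  thus ?thesis using k by (intro exI[of _ "V k / 2"]) auto
qed

text \<open>The Paley-Zygmund argument: a fourth moment controlled by the second prevents mass from escaping.\<close>

lemma second_moments_bounded:
  fixes Y :: "'b \<Rightarrow> real" and G :: "nat \<Rightarrow> 'a \<Rightarrow> real"
  assumes M: "prob_space M" and N: "prob_space N" and Y[measurable]: "Y \<in> borel_measurable N"
    and G[measurable]: "\<And>n. G n \<in> borel_measurable M" and G2: "\<And>n. integrable M (\<lambda>\<omega>. (G n \<omega>)\<^sup>2)"
    and C: "C > 0" and hyp: "\<And>n. (\<integral>\<^sup>+ \<omega>. ennreal (G n \<omega> ^ 4) \<partial>M) \<le> ennreal (C * (LINT \<omega>|M. (G n \<omega>)\<^sup>2)\<^sup>2)"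
    and conv: "\<And>g::real \<Rightarrow> real. continuous_on UNIV g \<Longrightarrow> (\<exists>B. \<forall>x. \<bar>g x\<bar> \<le> B) \<Longrightarrow> (\<lambda>n. LINT \<omega>|M. g (G n \<omega>)) \<longlonglongrightarrow> (LINT \<omega>|N. g (Y \<omega>))"
  shows "\<exists>S. \<forall>n. (LINT \<omega>|M. (G n \<omega>)\<^sup>2) \<le> S"
proof -
  interpret M: prob_space M by fact
  interpret N: prob_space N by fact
  define h where "h k x = min 1 (max 0 (\<bar>x\<bar> - real k))" for k and x :: real
  have hb: "0 \<le> h k x" "h k x \<le> 1" for k x by (auto simp: h_def)
  have hc: "continuous_on UNIV (h k)" for k unfolding h_def[abs_def] by (intro continuous_intros)
  have [measurable]: "h k \<in> borel_measurable borel" for k by (rule borel_measurable_continuous_onI[OF hc])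
  have "(\<lambda>k. LINT \<omega>|N. h k (Y \<omega>)) \<longlonglongrightarrow> (LINT \<omega>|N. 0)"
  proof (rule integral_dominated_convergence[where w="\<lambda>_. 1"])
    have "(\<lambda>k. h k y) \<longlonglongrightarrow> 0" for y
    proof (rule tendsto_eventually)
      obtain n :: nat where "\<bar>y\<bar> \<le> real n" using real_arch_simple by blast
      hence "h k y = 0" if "k \<ge> n" for k using that by (auto simp: h_def)
      thus "\<forall>\<^sub>F k in sequentially. h k y = 0" by (auto simp: eventually_sequentially)
    qed
    thus "AE \<omega> in N. (\<lambda>k. h k (Y \<omega>)) \<longlonglongrightarrow> 0" by simp
  qed (use hb in \<open>auto simp: abs_of_nonneg\<close>)
  hence "\<forall>\<^sub>F k in sequentially. (LINT \<omega>|N. h k (Y \<omega>)) < 1 / (4 * C)" using C by (intro order_tendstoD(2)) auto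
  \<comment> \<open>The bound \<open>1 / (4 * C)\<close> keeps the last term of the splitting below
    under a quarter of the second moment.\<close>
  then obtain k where k: "(LINT \<omega>|N. h k (Y \<omega>)) < 1 / (4 * C)" by (auto simp: eventually_sequentially)
  have "(\<lambda>n. LINT \<omega>|M. h k (G n \<omega>)) \<longlonglongrightarrow> (LINT \<omega>|N. h k (Y \<omega>))"
    by (rule conv[OF hc]) (use hb in \<open>auto intro!: exI[of _ 1] simp: abs_of_nonneg\<close>)
  hence "\<forall>\<^sub>F n in sequentially. (LINT \<omega>|M. h k (G n \<omega>)) < 1 / (4 * C)" by (rule order_tendstoD(2)) (rule k)
  then obtain n0 where n0: "\<And>n. n \<ge> n0 \<Longrightarrow> (LINT \<omega>|M. h k (G n \<omega>)) < 1 / (4 * C)" by (auto simp: eventually_sequentially)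
  \<comment> \<open>If \<open>?m > ?R\<close>, then a value with square above \<open>?m / 2\<close>
    exceeds k + 1 in modulus, where \<open>h k\<close> equals 1.\<close>
  let ?R = "2 * (real k + 1)\<^sup>2"
  have large: "(LINT \<omega>|M. (G n \<omega>)\<^sup>2) \<le> ?R" if n: "n \<ge> n0" for n
  proof (rule ccontr)
    let ?m = "LINT \<omega>|M. (G n \<omega>)\<^sup>2"
    assume "\<not> ?m \<le> ?R"
    hence mR: "?m > ?R" by simp
    moreover have "?R > 0" by (simp add: add_nonneg_pos)
    ultimately have m0: "?m > 0" by linarith
    have p4: "0 \<le> x ^ 4" for x :: real by (simp add: zero_le_even_power)
    have i4: "integrable M (\<lambda>\<omega>. G n \<omega> ^ 4)"
      by (rule integrableI_nonneg) (use p4 order.strict_trans1[OF hyp[of n]] in auto)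
    have e4: "(LINT \<omega>|M. G n \<omega> ^ 4) \<le> C * ?m\<^sup>2"
    proof -
      have "ennreal (LINT \<omega>|M. G n \<omega> ^ 4) = (\<integral>\<^sup>+ \<omega>. ennreal (G n \<omega> ^ 4) \<partial>M)"
        by (rule nn_integral_eq_integral[symmetric, OF i4]) (use p4 in auto)
      also note hyp[of n]
      finally show ?thesis using C by (subst (asm) ennreal_le_iff) auto
    qed
    have ih: "integrable M (\<lambda>\<omega>. h k (G n \<omega>))" by (rule M.integrable_const_bound[where B=1]) (use hb in \<open>auto simp: abs_of_nonneg\<close>)
    \<comment> \<open>Values with square at most \<open>?m / 2\<close> are covered by the first
      term. For the others \<open>h k\<close> is 1, and the last two terms dominate the square by
      the inequality of arithmetic and geometric means. The three expectations are
      \<open>?m / 2\<close>, at most \<open>?m / 4\<close> and less than \<open>?m / 4\<close>, a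
      contradiction.\<close>
    have "?m \<le> (LINT \<omega>|M. ?m / 2 + G n \<omega> ^ 4 / (4 * C * ?m) + C * ?m * h k (G n \<omega>))"
    proof (rule integral_mono[OF G2])
      show "integrable M (\<lambda>\<omega>. ?m / 2 + G n \<omega> ^ 4 / (4 * C * ?m) + C * ?m * h k (G n \<omega>))" using i4 ih by auto
      fix \<omega>
      let ?x = "G n \<omega>"
      have q: "0 \<le> ?x ^ 4 / (4 * C * ?m)" using p4 C m0 by simp
      show "?x\<^sup>2 \<le> ?m / 2 + ?x ^ 4 / (4 * C * ?m) + C * ?m * h k ?x"
      proof (cases "?x\<^sup>2 \<le> ?m / 2")
        case True
        have "0 \<le> C * ?m * h k ?x" using C m0 hb by simp
        thus ?thesis using True q by linarith
      next
        case False
        hence "(real k + 1)\<^sup>2 < \<bar>?x\<bar>\<^sup>2" using mR by simp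
        hence "real k + 1 < \<bar>?x\<bar>" by (rule power2_less_imp_less) simp
        hence h1: "h k ?x = 1" by (simp add: h_def)
        have "0 \<le> (?x\<^sup>2 - 2 * C * ?m)\<^sup>2 / (4 * C * ?m)" using C m0 by simp
        also have "\<dots> = ?x ^ 4 / (4 * C * ?m) + C * ?m - ?x\<^sup>2"
        proof -
          have "(?x\<^sup>2 - 2 * C * ?m)\<^sup>2 = ?x ^ 4 + (C * ?m) * (4 * C * ?m) - ?x\<^sup>2 * (4 * C * ?m)"
            by (simp add: power2_eq_square power4_eq_xxxx algebra_simps)
          thus ?thesis using C m0 by (simp add: add_divide_distrib diff_divide_distrib)
        qed
        finally show ?thesis using h1 m0 by simp
      qed
    qed
    also have "\<dots> = ?m / 2 + (LINT \<omega>|M. G n \<omega> ^ 4) / (4 * C * ?m) + C * ?m * (LINT \<omega>|M. h k (G n \<omega>))"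
      using i4 ih by (simp add: M.prob_space)
    also have "(LINT \<omega>|M. G n \<omega> ^ 4) / (4 * C * ?m) \<le> C * ?m\<^sup>2 / (4 * C * ?m)"
      using e4 C m0 by (intro divide_right_mono) auto
    also have "C * ?m\<^sup>2 / (4 * C * ?m) = ?m / 4" using C m0 by (simp add: power2_eq_square)
    finally have "?m \<le> ?m / 2 + ?m / 4 + C * ?m * (LINT \<omega>|M. h k (G n \<omega>))" by simp
    moreover have "C * ?m * (LINT \<omega>|M. h k (G n \<omega>)) < C * ?m * (1 / (4 * C))"
      using n0[OF n] C m0 by (intro mult_strict_left_mono) auto
    moreover have "C * ?m * (1 / (4 * C)) = ?m / 4" using C by simp
    ultimately show False by linarith
  qed
  \<comment> \<open>The finitely many n below \<open>n0\<close> are covered by adding their second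
    moments.\<close>
  let ?S = "?R + (\<Sum>n<n0. LINT \<omega>|M. (G n \<omega>)\<^sup>2)"
  have nn: "0 \<le> (LINT \<omega>|M. (G n \<omega>)\<^sup>2)" for n by (rule integral_nonneg_AE) auto
  have "(LINT \<omega>|M. (G n \<omega>)\<^sup>2) \<le> ?S" for n
  proof (cases "n \<ge> n0")
    case True
    have "0 \<le> (\<Sum>n<n0. LINT \<omega>|M. (G n \<omega>)\<^sup>2)" by (intro sum_nonneg nn)
    thus ?thesis using large[OF True] by linarith
  next
    case False
    hence "(LINT \<omega>|M. (G n \<omega>)\<^sup>2) \<le> (\<Sum>n<n0. LINT \<omega>|M. (G n \<omega>)\<^sup>2)" by (intro member_le_sum nn) auto
    moreover have "0 \<le> ?R" by simp
    ultimately show ?thesis by linarith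
  qed
  thus ?thesis by blast
qed

section \<open>Elementary properties of the two distances\<close>

context
  fixes M :: "'a measure" and N :: "'b measure" and F :: "'a \<Rightarrow> real" and Y :: "'b \<Rightarrow> real"
  assumes M: "prob_space M" and N: "prob_space N" and F[measurable]: "F \<in> borel_measurable M" and Y[measurable]: "Y \<in> borel_measurable N"
begin

abbreviation "fm_test \<equiv> {\<phi> :: real \<Rightarrow> real. 1-lipschitz_on UNIV \<phi> \<and> (\<forall>x. \<bar>\<phi> x\<bar> \<le> 1)}"

lemma fm_test_measurable: "\<phi> \<in> fm_test \<Longrightarrow> \<phi> \<in> borel_measurable borel"
  by (auto intro: borel_measurable_continuous_onI lipschitz_on_continuous_on)

lemma fm_test_bdd: "bdd_above ((\<lambda>\<phi>. \<bar>(LINT \<omega>|M. \<phi> (F \<omega>)) - (LINT \<omega>|N. \<phi> (Y \<omega>))\<bar>) ` fm_test)"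
proof (rule bdd_aboveI2)
  interpret M: prob_space M by (rule M)
  interpret N: prob_space N by (rule N)
  fix \<phi> :: "real \<Rightarrow> real" assume \<phi>: "\<phi> \<in> fm_test"
  note [measurable] = fm_test_measurable[OF \<phi>]
  have "\<bar>LINT \<omega>|M. \<phi> (F \<omega>)\<bar> \<le> 1"
  proof -
    have "\<bar>LINT \<omega>|M. \<phi> (F \<omega>)\<bar> \<le> (LINT \<omega>|M. \<bar>\<phi> (F \<omega>)\<bar>)" by (rule integral_abs_bound)
    also have "\<dots> \<le> (LINT \<omega>|M. 1)"
      by (rule integral_mono) (use \<phi> in \<open>auto intro!: M.integrable_const_bound[where B=1]\<close>)
    finally show ?thesis by (simp add: M.prob_space)
  qed
  moreover have "\<bar>LINT \<omega>|N. \<phi> (Y \<omega>)\<bar> \<le> 1"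
  proof -
    have "\<bar>LINT \<omega>|N. \<phi> (Y \<omega>)\<bar> \<le> (LINT \<omega>|N. \<bar>\<phi> (Y \<omega>)\<bar>)" by (rule integral_abs_bound)
    also have "\<dots> \<le> (LINT \<omega>|N. 1)"
      by (rule integral_mono) (use \<phi> in \<open>auto intro!: N.integrable_const_bound[where B=1]\<close>)
    finally show ?thesis by (simp add: N.prob_space)
  qed
  ultimately show "\<bar>(LINT \<omega>|M. \<phi> (F \<omega>)) - (LINT \<omega>|N. \<phi> (Y \<omega>))\<bar> \<le> 2" by linarith
qed

lemma fm_close_d_FM: "fm_close (distr M borel F) (distr N borel Y) (d_FM M F N Y)"
  unfolding fm_close_def
proof (intro allI impI)
  fix \<phi> :: "real \<Rightarrow> real" assume h: "1-lipschitz_on UNIV \<phi>" "\<forall>x. \<bar>\<phi> x\<bar> \<le> 1"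
  hence \<phi>: "\<phi> \<in> fm_test" by simp
  note [measurable] = fm_test_measurable[OF \<phi>]
  have "(LINT x|distr M borel F. \<phi> x) = (LINT \<omega>|M. \<phi> (F \<omega>))" "(LINT x|distr N borel Y. \<phi> x) = (LINT \<omega>|N. \<phi> (Y \<omega>))"
    by (rule integral_distr; simp)+
  thus "\<bar>(LINT x|distr M borel F. \<phi> x) - (LINT x|distr N borel Y. \<phi> x)\<bar> \<le> d_FM M F N Y"
    unfolding d_FM_def using cSUP_upper[OF \<phi> fm_test_bdd] by simp
qed

lemma d_FM_nonneg: "0 \<le> d_FM M F N Y"
  using fm_close_d_FM unfolding fm_close_def
  by (metis (mono_tags, lifting) abs_ge_zero abs_zero lipschitz_on_constant lipschitz_on_le order.trans zero_le_one)

lemma d_FM_le: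
  assumes "\<And>\<phi>. \<phi> \<in> fm_test \<Longrightarrow> \<bar>(LINT \<omega>|M. \<phi> (F \<omega>)) - (LINT \<omega>|N. \<phi> (Y \<omega>))\<bar> \<le> c"
  shows "d_FM M F N Y \<le> c"
  unfolding d_FM_def
proof (rule cSUP_least)
  have "(\<lambda>_. 0) \<in> fm_test" by (auto intro!: lipschitz_onI)
  thus "fm_test \<noteq> {}" by blast
qed (rule assms)

lemma measure_distr_eq:
  assumes "A \<in> sets borel"
  shows "measure (distr M borel F) A = measure M {\<omega> \<in> space M. F \<omega> \<in> A}" "measure (distr N borel Y) A = measure N {\<omega> \<in> space N. Y \<omega> \<in> A}"
  using assms by (auto simp: measure_distr vimage_def Int_def conj_commute intro!: arg_cong[where f="measure _"])

lemma d_TV_le: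
  assumes "\<And>A. A \<in> sets borel \<Longrightarrow> \<bar>measure (distr M borel F) A - measure (distr N borel Y) A\<bar> \<le> c"
  shows "d_TV M F N Y \<le> c"
  unfolding d_TV_def by (rule cSUP_least) (use assms measure_distr_eq in auto)

lemma d_TV_le_1: "d_TV M F N Y \<le> 1"
proof (rule d_TV_le)
  interpret M: prob_space M by (rule M)
  interpret N: prob_space N by (rule N)
  interpret M': prob_space "distr M borel F" by (rule M.prob_space_distr) simp
  interpret N': prob_space "distr N borel Y" by (rule N.prob_space_distr) simp
  fix A :: "real set"
  show "\<bar>measure (distr M borel F) A - measure (distr N borel Y) A\<bar> \<le> 1"
    using M'.prob_le_1[of A] N'.prob_le_1[of A] measure_nonneg[of "distr M borel F" A] measure_nonneg[of "distr N borel Y" A] by linarith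
qed

lemma d_TV_nonneg: "0 \<le> d_TV M F N Y"
proof -
  interpret M: prob_space M by (rule M)
  interpret N: prob_space N by (rule N)
  have "bdd_above ((\<lambda>A. \<bar>measure M {\<omega> \<in> space M. F \<omega> \<in> A} - measure N {\<omega> \<in> space N. Y \<omega> \<in> A}\<bar>) ` sets borel)"
  proof (rule bdd_aboveI2)
    fix A :: "real set"
    show "\<bar>measure M {\<omega> \<in> space M. F \<omega> \<in> A} - measure N {\<omega> \<in> space N. Y \<omega> \<in> A}\<bar> \<le> 1"
      using M.prob_le_1[of "{\<omega> \<in> space M. F \<omega> \<in> A}"] N.prob_le_1[of "{\<omega> \<in> space N. Y \<omega> \<in> A}"]
        measure_nonneg[of M "{\<omega> \<in> space M. F \<omega> \<in> A}"] measure_nonneg[of N "{\<omega> \<in> space N. Y \<omega> \<in> A}"] by linarith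
  qed
  from cSUP_upper[OF _ this, of "{}"] show ?thesis unfolding d_TV_def by simp
qed

end

text \<open>On a Skorohod space the variables converge pointwise, and
  \<open>min 2 \<bar>Z n x - Z' x\<bar>\<close> dominates the difference of every test function at
  once, which makes the convergence uniform over the supremum.\<close>

lemma d_FM_tendsto_0:
  fixes Y :: "'b \<Rightarrow> real" and G :: "nat \<Rightarrow> 'a \<Rightarrow> real"
  assumes M: "prob_space M" and N: "prob_space N" and Y[measurable]: "Y \<in> borel_measurable N" and G[measurable]: "\<And>n. G n \<in> borel_measurable M"
    and w: "weak_conv_m (\<lambda>n. distr M borel (G n)) (distr N borel Y)"
  shows "(\<lambda>n. d_FM M (G n) N Y) \<longlonglongrightarrow> 0"
proof -
  have rd: "real_distribution (distr M borel (G n))" "real_distribution (distr N borel Y)" for n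
    by (auto intro!: prob_space.real_distribution_distr M N)
  obtain \<Omega> :: "real measure" and Z Z' where Z0: "prob_space \<Omega>" "\<forall>n. Z n \<in> borel_measurable \<Omega>" "\<forall>n. distr \<Omega> borel (Z n) = distr M borel (G n)"
    "Z' \<in> \<Omega> \<rightarrow>\<^sub>M lborel" "distr \<Omega> borel Z' = distr N borel Y" "\<forall>x\<in>space \<Omega>. (\<lambda>n. Z n x) \<longlonglongrightarrow> Z' x"
    using Skorohod[OF rd w] by (elim exE conjE)
  hence Z: "prob_space \<Omega>" "\<And>n. Z n \<in> borel_measurable \<Omega>" "\<And>n. distr \<Omega> borel (Z n) = distr M borel (G n)"
    "Z' \<in> borel_measurable \<Omega>" "distr \<Omega> borel Z' = distr N borel Y" "\<And>x. x \<in> space \<Omega> \<Longrightarrow> (\<lambda>n. Z n x) \<longlonglongrightarrow> Z' x"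
    by auto
  interpret \<Omega>: prob_space \<Omega> by fact
  note [measurable] = Z(2,4)
  define e where "e n = (LINT x|\<Omega>. min 2 \<bar>Z n x - Z' x\<bar>)" for n
  have lim: "e \<longlonglongrightarrow> (LINT x|\<Omega>. 0)"
    unfolding e_def[abs_def]
  proof (rule integral_dominated_convergence[where w="\<lambda>_. 2"])
    show "AE x in \<Omega>. (\<lambda>n. min 2 \<bar>Z n x - Z' x\<bar>) \<longlonglongrightarrow> 0"
    proof (rule AE_I2)
      fix x assume "x \<in> space \<Omega>"
      hence "(\<lambda>n. min 2 \<bar>Z n x - Z' x\<bar>) \<longlonglongrightarrow> min 2 \<bar>Z' x - Z' x\<bar>" by (intro tendsto_intros Z(6))
      thus "(\<lambda>n. min 2 \<bar>Z n x - Z' x\<bar>) \<longlonglongrightarrow> 0" by simp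
    qed
  qed auto
  have le: "d_FM M (G n) N Y \<le> e n" for n
  proof (rule d_FM_le[OF M N G Y])
    fix \<phi> :: "real \<Rightarrow> real" assume \<phi>: "\<phi> \<in> {\<phi>. 1-lipschitz_on UNIV \<phi> \<and> (\<forall>x. \<bar>\<phi> x\<bar> \<le> 1)}"
    have [measurable]: "\<phi> \<in> borel_measurable borel"
      using \<phi> by (auto intro: borel_measurable_continuous_onI lipschitz_on_continuous_on)
    have "(LINT \<omega>|M. \<phi> (G n \<omega>)) = (LINT x|distr M borel (G n). \<phi> x)" by (rule integral_distr[symmetric]) auto
    also have "\<dots> = (LINT x|\<Omega>. \<phi> (Z n x))" unfolding Z(3)[symmetric] by (rule integral_distr) auto
    finally have 1: "(LINT \<omega>|M. \<phi> (G n \<omega>)) = (LINT x|\<Omega>. \<phi> (Z n x))" .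
    have "(LINT \<omega>|N. \<phi> (Y \<omega>)) = (LINT x|distr N borel Y. \<phi> x)" by (rule integral_distr[symmetric]) auto
    also have "\<dots> = (LINT x|\<Omega>. \<phi> (Z' x))" unfolding Z(5)[symmetric] by (rule integral_distr) auto
    finally have 2: "(LINT \<omega>|N. \<phi> (Y \<omega>)) = (LINT x|\<Omega>. \<phi> (Z' x))" .
    have i: "integrable \<Omega> (\<lambda>x. \<phi> (Z n x))" "integrable \<Omega> (\<lambda>x. \<phi> (Z' x))"
      by (rule \<Omega>.integrable_const_bound[where B=1]; use \<phi> in auto)+
    have "\<bar>(LINT x|\<Omega>. \<phi> (Z n x)) - (LINT x|\<Omega>. \<phi> (Z' x))\<bar> = \<bar>LINT x|\<Omega>. \<phi> (Z n x) - \<phi> (Z' x)\<bar>" using i by simp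
    also have "\<dots> \<le> (LINT x|\<Omega>. \<bar>\<phi> (Z n x) - \<phi> (Z' x)\<bar>)" by (rule integral_abs_bound)
    also have "\<dots> \<le> e n" unfolding e_def
    proof (rule integral_mono)
      show "integrable \<Omega> (\<lambda>x. \<bar>\<phi> (Z n x) - \<phi> (Z' x)\<bar>)" using i by auto
      show "integrable \<Omega> (\<lambda>x. min 2 \<bar>Z n x - Z' x\<bar>)" by (rule \<Omega>.integrable_const_bound[where B=2]) auto
      fix x
      have "\<bar>\<phi> (Z n x)\<bar> \<le> 1" "\<bar>\<phi> (Z' x)\<bar> \<le> 1" using \<phi> by auto
      moreover have "\<bar>\<phi> (Z n x) - \<phi> (Z' x)\<bar> \<le> \<bar>Z n x - Z' x\<bar>"
        using \<phi> lipschitz_onD[of 1 UNIV \<phi> "Z n x" "Z' x"] by (auto simp: dist_real_def)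
      ultimately show "\<bar>\<phi> (Z n x) - \<phi> (Z' x)\<bar> \<le> min 2 \<bar>Z n x - Z' x\<bar>" by linarith
    qed
    finally show "\<bar>(LINT \<omega>|M. \<phi> (G n \<omega>)) - (LINT \<omega>|N. \<phi> (Y \<omega>))\<bar> \<le> e n" unfolding 1 2 .
  qed
  show ?thesis
  proof (rule real_tendsto_sandwich[where f="\<lambda>_. 0" and h=e])
    show "\<forall>\<^sub>F n in sequentially. 0 \<le> d_FM M (G n) N Y" by (rule always_eventually, rule allI, rule d_FM_nonneg[OF M N G Y])
    show "\<forall>\<^sub>F n in sequentially. d_FM M (G n) N Y \<le> e n" by (rule always_eventually, rule allI, rule le)
    show "e \<longlonglongrightarrow> 0" using lim by simp
  qed simp
qed

theorem theorem3p1: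
  fixes M :: "'a measure" and N :: "'b measure"
    and X :: "'h::{real_inner, complete_space} \<Rightarrow> 'a \<Rightarrow> real"
    and F :: "nat \<Rightarrow> 'a \<Rightarrow> real" and Finf :: "'b \<Rightarrow> real" and p :: nat
  assumes "isonormal_gaussian_process M X"
    and "sets M = generated_sets M X"
    and "p \<ge> 2"
    and "\<And>n. n \<ge> 1 \<Longrightarrow> F n \<in> wiener_chaos_sum M X p"
    and "prob_space N"
    and "Finf \<in> borel_measurable N"
    and "weak_conv_m (\<lambda>n. distr M borel (F n)) (distr N borel Finf)"
    and "prob_space.variance N Finf > 0"
  shows "(\<forall>r::real. r \<ge> 1 \<longrightarrow>
            (SUP n\<in>{1..}. \<integral>\<^sup>+ \<omega>. ennreal (\<bar>F n \<omega>\<bar> powr r) \<partial>M) < \<infinity>) \<and>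
         ((\<exists>c>0. \<forall>n\<ge>1. d_TV M (F n) N Finf
                        \<le> c * d_FM M (F n) N Finf powr (1 / (2 * real p + 1))) \<and>
          (\<lambda>n. d_TV M (F n) N Finf) \<longlonglongrightarrow> 0) \<and>
         absolutely_continuous lborel (distr N borel Finf)"
proof -
  interpret isonormal_gaussian_process M X by (rule assms(1))
  interpret N: prob_space N by (rule assms(5))
  note N = assms(5) and Y[measurable] = assms(6)
  define e where "e = 1 / (2 * real p + 1)"
  define s where "s = 1 / (2 * real p - 1)"
  \<comment> \<open>s is the exponent of \<open>wiener_chaos_sum_smooth\<close>, and
    \<open>fm_close_measure\<close> turns it into \<open>s / (1 + 2 * s)\<close>, the exponent of
    the theorem.\<close>
  have e: "e > 0" and s: "s > 0" and es: "s / (1 + 2 * s) = e"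
    using assms(3) by (auto simp: e_def s_def field_simps)
  \<comment> \<open>Membership in the chaoses is assumed from n = 1 on, so the sequence is shifted
    by one.\<close>
  let ?G = "\<lambda>n. F (Suc n)"
  have Fc: "F n \<in> wiener_chaos_sum M X p" if "n \<ge> 1" for n by (rule assms(4)[OF that])
  have Fm[measurable]: "F n \<in> borel_measurable M" and F2: "integrable M (\<lambda>\<omega>. (F n \<omega>)\<^sup>2)" if "n \<ge> 1" for n
    using wiener_chaos_sum_square_integrable[OF Fc[OF that]] .
  have G2: "integrable M (\<lambda>\<omega>. (?G n \<omega>)\<^sup>2)" for n by (rule F2) simp
  have Gm[measurable]: "?G n \<in> borel_measurable M" for n by (rule Fm) simp
  let ?\<mu> = "\<lambda>n. distr M borel (?G n)" and ?\<nu> = "distr N borel Finf"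
  have rd: "real_distribution (?\<mu> n)" "real_distribution ?\<nu>" for n
    by (auto intro!: real_distribution_distr N.real_distribution_distr)
  have w: "weak_conv_m ?\<mu> ?\<nu>"
    using assms(7) unfolding weak_conv_m_def weak_conv_def by (auto intro: LIMSEQ_Suc)
  have conv: "(\<lambda>n. LINT \<omega>|M. g (?G n \<omega>)) \<longlonglongrightarrow> (LINT \<omega>|N. g (Finf \<omega>))"
    if g: "continuous_on UNIV g" "\<exists>B. \<forall>x. \<bar>g x\<bar> \<le> B" for g :: "real \<Rightarrow> real"
  proof -
    have [measurable]: "g \<in> borel_measurable borel" by (rule borel_measurable_continuous_onI[OF g(1)])
    obtain B where "\<forall>x. \<bar>g x\<bar> \<le> B" using g(2) ..
    hence "(\<lambda>n. integral\<^sup>L (?\<mu> n) g) \<longlonglongrightarrow> integral\<^sup>L ?\<nu> g"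
      using g(1) by (intro weak_conv_imp_integral_bdd_continuous_conv[OF rd w]) (auto simp: continuous_on_eq_continuous_at)
    thus ?thesis by (simp add: integral_distr)
  qed

  obtain C1 where C1: "C1 \<ge> 0" "\<And>F. F \<in> wiener_chaos_sum M X p \<Longrightarrow>
      (\<integral>\<^sup>+ \<omega>. ennreal (F \<omega> ^ 4) \<partial>M) \<le> ennreal (C1 * (expectation (\<lambda>\<omega>. (F \<omega>)\<^sup>2))\<^sup>2)"
    using wiener_chaos_sum_hypercontractive[of p 1] by auto
  have "(\<integral>\<^sup>+ \<omega>. ennreal (?G n \<omega> ^ 4) \<partial>M) \<le> ennreal ((C1 + 1) * (expectation (\<lambda>\<omega>. (?G n \<omega>)\<^sup>2))\<^sup>2)" for n
    \<comment> \<open>The 1 makes the constant positive, as \<open>second_moments_bounded\<close>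
      requires.\<close>
    by (rule order.trans[OF C1(2)[OF Fc]]) (auto intro!: ennreal_leI mult_right_mono)
  from second_moments_bounded[OF prob_space_axioms N Y Gm G2 _ this conv]
  obtain S where S: "expectation (\<lambda>\<omega>. (?G n \<omega>)\<^sup>2) \<le> S" for n using C1(1) by auto
  have moments: "(SUP n\<in>{1..}. \<integral>\<^sup>+ \<omega>. ennreal (\<bar>F n \<omega>\<bar> powr r) \<partial>M) < \<infinity>" if r: "r \<ge> 1" for r
  proof -
    obtain j :: nat where j: "r \<le> 2 ^ j" using real_arch_pow[of 2 r] by (auto intro: less_imp_le)
    obtain C where C: "C \<ge> 0" "\<And>F. F \<in> wiener_chaos_sum M X p \<Longrightarrow>
        (\<integral>\<^sup>+ \<omega>. ennreal (F \<omega> ^ (2 * 2 ^ j)) \<partial>M) \<le> ennreal (C * (expectation (\<lambda>\<omega>. (F \<omega>)\<^sup>2)) ^ (2 ^ j))"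
      using wiener_chaos_sum_hypercontractive[of p j] by blast
    have "(SUP n\<in>{1..}. \<integral>\<^sup>+ \<omega>. ennreal (\<bar>F n \<omega>\<bar> powr r) \<partial>M) \<le> 1 + ennreal (C * S ^ (2 ^ j))"
    proof (rule SUP_least)
      fix n :: nat assume "n \<in> {1..}"
      then obtain m where n: "n = Suc m" "n \<ge> 1" by (cases n) auto
      note [measurable] = Fm[OF n(2)]
      have pw: "\<bar>x\<bar> powr r \<le> 1 + x ^ (2 * 2 ^ j)" for x :: real
      proof (cases "\<bar>x\<bar> \<le> 1")
        case True
        hence "\<bar>x\<bar> powr r \<le> 1" using r by (intro powr_le1) auto
        moreover have "0 \<le> x ^ (2 * 2 ^ j)" by (simp add: zero_le_even_power)
        ultimately show ?thesis by linarith
      next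
        case False
        have "0 \<le> (2::real) ^ j" by simp
        moreover have "real (2 * 2 ^ j) = 2 * 2 ^ j" by simp
        ultimately have "r \<le> real (2 * 2 ^ j)" using j by linarith
        hence "\<bar>x\<bar> powr r \<le> \<bar>x\<bar> powr real (2 * 2 ^ j)" using False by (intro powr_mono) auto
        also have "\<dots> = \<bar>x\<bar> ^ (2 * 2 ^ j)" using False by (subst powr_realpow) auto
        also have "\<dots> = x ^ (2 * 2 ^ j)" by (simp add: power_even_abs)
        finally show ?thesis by simp
      qed
      have "(\<integral>\<^sup>+ \<omega>. ennreal (\<bar>F n \<omega>\<bar> powr r) \<partial>M) \<le> (\<integral>\<^sup>+ \<omega>. 1 + ennreal (F n \<omega> ^ (2 * 2 ^ j)) \<partial>M)"
      proof (rule nn_integral_mono)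
        fix \<omega>
        have "ennreal (\<bar>F n \<omega>\<bar> powr r) \<le> ennreal (1 + F n \<omega> ^ (2 * 2 ^ j))" by (rule ennreal_leI[OF pw])
        thus "ennreal (\<bar>F n \<omega>\<bar> powr r) \<le> 1 + ennreal (F n \<omega> ^ (2 * 2 ^ j))" 
          by (subst (asm) ennreal_plus) (auto simp: zero_le_even_power)
      qed
      also have "\<dots> = 1 + (\<integral>\<^sup>+ \<omega>. ennreal (F n \<omega> ^ (2 * 2 ^ j)) \<partial>M)"
        by (subst nn_integral_add) (auto simp: emeasure_space_1)
      also have "\<dots> \<le> 1 + ennreal (C * S ^ (2 ^ j))"
      proof (intro add_left_mono order.trans[OF C(2)[OF Fc[OF n(2)]]] ennreal_leI mult_left_mono power_mono)
        show "expectation (\<lambda>\<omega>. (F n \<omega>)\<^sup>2) \<le> S" using S[of m] n by simp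
        show "0 \<le> expectation (\<lambda>\<omega>. (F n \<omega>)\<^sup>2)" by (rule integral_nonneg_AE) auto
      qed (rule C(1))
      finally show "(\<integral>\<^sup>+ \<omega>. ennreal (\<bar>F n \<omega>\<bar> powr r) \<partial>M) \<le> 1 + ennreal (C * S ^ (2 ^ j))" .
    qed
    also have "\<dots> < \<infinity>" by simp
    finally show ?thesis .
  qed

  obtain v0 where v0: "v0 > 0" "\<forall>\<^sub>F n in sequentially. v0 \<le> variance (?G n)"
    using variance_lower_bound[OF prob_space_axioms N Y assms(8) Gm G2 conv] by blast
  obtain K where K: "K > 0" "\<forall>F\<in>wiener_chaos_sum M X p. \<forall>v \<phi> \<phi>' B L \<eta>. v = variance F \<longrightarrow> v > 0 \<longrightarrow>
     (\<forall>x. (\<phi> has_real_derivative \<phi>' x) (at x)) \<longrightarrow> continuous_on UNIV \<phi>' \<longrightarrow>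
     (\<forall>x. \<bar>\<phi> x\<bar> \<le> B) \<longrightarrow> (\<forall>x. \<bar>\<phi>' x\<bar> \<le> L) \<longrightarrow> \<eta> > 0 \<longrightarrow>
     expectation (\<lambda>\<omega>. \<phi>' (F \<omega>)) \<le> K * (B / \<eta> + L * (\<eta> / sqrt v) powr s)"
    using wiener_chaos_sum_smooth[of p] assms(3) unfolding s_def by auto
  \<comment> \<open>One constant for all the laws with variance at least v0: the factor exceeds both
    1 and \<open>(1 / sqrt v0) powr s\<close>, the coefficients of the two terms.\<close>
  define K' where "K' = K * (1 + (1 / sqrt v0) powr s)"
  have K': "K' \<ge> 0" using K(1) by (simp add: K'_def)
  have smooth_G: "smooth_law (?\<mu> n) K' s" if v: "v0 \<le> variance (?G n)" for n
    unfolding smooth_law_def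
  proof (intro allI impI)
    fix \<phi> \<phi>' :: "real \<Rightarrow> real" and B L \<eta> :: real
    assume h: "\<forall>x. (\<phi> has_real_derivative \<phi>' x) (at x)" "continuous_on UNIV \<phi>'" "\<forall>x. \<bar>\<phi> x\<bar> \<le> B" "\<forall>x. \<bar>\<phi>' x\<bar> \<le> L" "\<eta> > 0"
    have [measurable]: "\<phi>' \<in> borel_measurable borel" by (rule borel_measurable_continuous_onI[OF h(2)])
    have B0: "B \<ge> 0" and L0: "L \<ge> 0" using h(3,4) abs_ge_zero order.trans by blast+
    let ?v = "variance (?G n)"
    have vp: "?v > 0" using v v0(1) by linarith
    have "(LINT x|?\<mu> n. \<phi>' x) = expectation (\<lambda>\<omega>. \<phi>' (?G n \<omega>))" by (rule integral_distr) auto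
    also have "\<dots> \<le> K * (B / \<eta> + L * (\<eta> / sqrt ?v) powr s)"
      by (rule K(2)[rule_format, OF Fc refl vp h(1)[rule_format] h(2) h(3)[rule_format] h(4)[rule_format] h(5)]) simp
    also have "\<dots> \<le> K * (B / \<eta> + L * (\<eta> powr s * (1 / sqrt v0) powr s))"
    proof -
      have "\<eta> / sqrt ?v \<le> \<eta> * (1 / sqrt v0)" using v v0(1) h(5) by (simp add: divide_left_mono)
      hence "(\<eta> / sqrt ?v) powr s \<le> (\<eta> * (1 / sqrt v0)) powr s" using h(5) vp s by (intro powr_mono2) auto
      also have "\<dots> = \<eta> powr s * (1 / sqrt v0) powr s" by (rule powr_mult)
      finally show ?thesis using K(1) L0 by (intro mult_left_mono add_left_mono) auto
    qed
    also have "\<dots> \<le> K * ((1 + (1 / sqrt v0) powr s) * (B / \<eta> + L * \<eta> powr s))"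
    proof (rule mult_left_mono)
      have "0 \<le> (1 / sqrt v0) powr s * (B / \<eta>)" "0 \<le> L * \<eta> powr s" using B0 L0 h(5) by auto
      thus "B / \<eta> + L * (\<eta> powr s * (1 / sqrt v0) powr s) \<le> (1 + (1 / sqrt v0) powr s) * (B / \<eta> + L * \<eta> powr s)"
        by (simp only: ring_distribs mult_1_left mult_ac)
    qed (use K(1) in simp)
    finally show "(LINT x|?\<mu> n. \<phi>' x) \<le> K' * (B / \<eta> + L * \<eta> powr s)" unfolding K'_def by (simp only: mult.assoc)
  qed
  have evs: "\<forall>\<^sub>F n in sequentially. smooth_law (?\<mu> n) K' s"
    using v0(2) by eventually_elim (rule smooth_G)
  have smooth_Y: "smooth_law ?\<nu> K' s" by (rule smooth_law_weak_limit[OF rd w evs])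
  obtain n0 where n0: "\<And>n. n \<ge> n0 \<Longrightarrow> smooth_law (?\<mu> n) K' s" using evs by (auto simp: eventually_sequentially)

  let ?d = "\<lambda>n. d_FM M (F n) N Finf" and ?t = "\<lambda>n. d_TV M (F n) N Finf"
  \<comment> \<open>At the finitely many early indices, where no lower bound on the variance is at
    hand, the total variation distance is at most 1, and 1 is \<open>a n * ?d n powr e\<close> if
    the distance \<open>?d n\<close> is positive. The sum of these values goes into c.\<close>
  define a where "a n = (if ?d n = 0 then 0 else 1 / ?d n powr e)" for n
  define c where "c = (1 + 4 * K') + (\<Sum>n\<le>n0. a n)"
  have d0: "0 \<le> ?d n" if "n \<ge> 1" for n by (rule d_FM_nonneg[OF prob_space_axioms N Fm[OF that] Y])
  have t0: "0 \<le> ?t n" if "n \<ge> 1" for n by (rule d_TV_nonneg[OF prob_space_axioms N Fm[OF that] Y])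
  have a0: "0 \<le> a n" for n by (simp add: a_def)
  have sa: "0 \<le> (\<Sum>n\<le>n0. a n)" by (rule sum_nonneg) (rule a0)
  have c0: "c > 0" unfolding c_def using K' sa by linarith
  have tv: "?t n \<le> c * ?d n powr e" if n: "n \<ge> 1" for n
  \<comment> \<open>\<open>fm_close_measure\<close> chooses its scales as powers of a positive
    distance. At distance 0 the right-hand side is 0, and the two laws coincide.\<close>
  proof (cases "?d n = 0")
    case True
    have "fm_close (distr M borel (F n)) ?\<nu> 0"
      using fm_close_d_FM[OF prob_space_axioms N Fm[OF n] Y] True by simp
    hence "?t n \<le> 0"
      using fm_close_zero_measure[OF real_distribution_distr[OF Fm[OF n]] rd(2)]
      by (intro d_TV_le[OF prob_space_axioms N Fm[OF n] Y]) auto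
    thus ?thesis using True by simp
  next
    case False
    hence dp: "?d n > 0" using d0[OF n] by linarith
    obtain m where m: "n = Suc m" using n by (cases n) auto
    show ?thesis
    proof (cases "m \<ge> n0")
      case True
      have "?t n \<le> (1 + 4 * K') * ?d n powr e"
      proof (rule d_TV_le[OF prob_space_axioms N Fm[OF n] Y])
        fix A :: "real set" assume A: "A \<in> sets borel"
        show "\<bar>measure (distr M borel (F n)) A - measure ?\<nu> A\<bar> \<le> (1 + 4 * K') * ?d n powr e"
          unfolding es[symmetric]
          by (rule fm_close_measure[OF _ _ rd(2) smooth_Y fm_close_d_FM[OF prob_space_axioms N Fm[OF n] Y] dp K' s A])
             (use rd(1)[of m] n0[OF True] m in auto)
      qed
      also have "\<dots> \<le> c * ?d n powr e"
        using sa by (intro mult_right_mono) (auto simp: c_def)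
      finally show ?thesis .
    next
      case False
      have "?t n \<le> 1" by (rule d_TV_le_1[OF prob_space_axioms N Fm[OF n] Y])
      also have "1 = a n * ?d n powr e" using dp by (simp add: a_def)
      also have "\<dots> \<le> c * ?d n powr e"
      proof (rule mult_right_mono)
        have "a n \<le> (\<Sum>n\<le>n0. a n)" using False m a0 by (intro member_le_sum) auto
        thus "a n \<le> c" using K' by (simp add: c_def)
      qed simp
      finally show ?thesis .
    qed
  qed
  have "(\<lambda>n. ?d (Suc n)) \<longlonglongrightarrow> 0" by (rule d_FM_tendsto_0[OF prob_space_axioms N Y Gm w])
  hence "(\<lambda>n. c * ?d (Suc n) powr e) \<longlonglongrightarrow> c * 0"
    using e d0 by (intro tendsto_mult tendsto_const tendsto_zero_powrI) auto
  hence "(\<lambda>n. c * ?d (Suc n) powr e) \<longlonglongrightarrow> 0" by simp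
  hence "(\<lambda>n. ?t (Suc n)) \<longlonglongrightarrow> 0"
  proof (rule real_tendsto_sandwich[where f="\<lambda>_. 0", rotated 3])
    show "\<forall>\<^sub>F n in sequentially. 0 \<le> ?t (Suc n)" by (rule always_eventually, rule allI, rule t0) simp
    show "\<forall>\<^sub>F n in sequentially. ?t (Suc n) \<le> c * ?d (Suc n) powr e" by (rule always_eventually, rule allI, rule tv) simp
  qed simp
  hence "?t \<longlonglongrightarrow> 0" by (rule LIMSEQ_imp_Suc)
  moreover have "\<exists>c>0. \<forall>n\<ge>1. ?t n \<le> c * ?d n powr (1 / (2 * real p + 1))"
    using c0 tv unfolding e_def by blast
  moreover have "absolutely_continuous lborel ?\<nu>"
    by (rule smooth_law_absolutely_continuous[OF rd(2) smooth_Y s])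
  ultimately show ?thesis using moments by blast
qed

end
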